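(* Assume that: (i) Condition C holds; (ii) there exists $\epsilon>0$ such that $P$-a.s. $\sum_{j=1}^d p_n(i,j)>\epsilon$ for all $i\in\mathcal D$ and all $n\in\mathbb Z$; (iii) $\limsup_{n\to\infty}\frac1n\log E_P(\|a_{n-1}a_{n-2}\cdots a_1a_0\|)<0$. Then $P(v_P>0)=1$, where $v_P$ is the asymptotic speed, i.e. the ($\mathbb P^\mu$-a.s., for every $\mu\in\mathcal M_d$) limit $v_P=\lim_{n\to\infty}\xi_n/n$.
   Context: Setting. Fix $d\ge 1$, $\mathcal D=\{1,\dots,d\}$. Let $(\mathcal S,\mathcal B)$ be a measurable space, $\Omega=\mathcal S^{\mathbb Z}$ with product $\sigma$-algebra $\mathcal F$, and $P$ a probability measure on $(\Omega,\mathcal F)$ (law of the environment $\omega=(\omega_n)_{n\in\mathbb Z}$) with expectation $E_P$. $\theta:\Omega\to\Omega$ is the shift $(\theta\omega)_n=\omega_{n+1}$. Let $p,q,r$ be measurable functions from $\mathcal S$ to the nonnegative $d\times d$ matrices with $p+q+r$ stochastic; $p_n=p(\omega_n)$, $q_n=q(\omega_n)$, $r_n=r(\omega_n)$. Given $\omega$, the walk $X_t=(\xi_t,Y_t)$, $t\ge0$, is the Markov chain on $\mathbb Z\times\mathcal D$ which from $(n,i)$ jumps to $(n+1,j)$, $(n,j)$, $(n-1,j)$ with probability $p_n(i,j)$, $r_n(i,j)$, $q_n(i,j)$ respectively. $P^i_\omega$ is its law started at $(0,i)$. $\mathcal M_d$ is the set of collections $\mu=(\mu_\omega)_{\omega\in\Omega}$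 of probability measures on $\mathcal D$ depending measurably on $\omega$ and only through $(\omega_n)_{n\le0}$. $P^\mu_\omega$ is the law of the walk with $\xi_0=0$, $Y_0\sim\mu_\omega$; the annealed law is $\mathbb P^\mu(F\times G)=\int_F P_\omega^\mu(G)\,P(d\omega)$. $T_n=\inf\{t\ge0:\xi_t=n\}$ ($\inf\emptyset=\infty$). For vectors $\|x\|=\max_i|x^i|$, for matrices $\|\cdot\|$ is the induced operator norm; $\mathbf 1=(1,\dots,1)$; $I$ is the identity matrix. $\eta_n(i,j)=P^i_{\theta^n\omega}(T_1<\infty,\ Y_{T_1}=j)$. Condition C: (C1) $(\omega_n)$ is stationary and ergodic under $P$; (C2) $E_P\big(\log\frac1{1-\|r_0+p_0\|}\big)<\infty$ and $E_P\big(\log\frac1{1-\|r_0+q_0\|}\big)<\infty$; (C3) for all $j\in\mathcal D$, $\sum_i q_0(i,j)>0$ and $\sum_i p_0(i,j)>0$, $P$-a.s.; (C4) $P(\eta_0(i,j)>0)=1$ for all $i,j\in\mathcal D$. Under Condition C there is a unique stationary sequence $(\zeta_n)_{n\in\mathbb Z}$ of stochastic matrices (functions of $\omega$) with $\zeta_n=(I-q_n\zeta_{n-1}-r_n)^{-1}p_n$ $P$-a.s. Put $\gamma_n=(I-q_n\zeta_{n-1}-r_n)^{-1}$ and $a_n=\gamma_nq_n$. Let $\lambda=\lim_n\frac1n E_P(\log\|a_n\cdots a_1\|)$; condition (iii) implies $\lambda<0$ by Jensen's inequality. When $\lambda<0$ the walk satisfies $\xi_n\to+\infty$ a.s., $\zeta_n=\eta_n$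 $P$-a.s., and the limit $v_P=\lim\xi_n/n$ exists and equals the constant $1/E_P\big(\pi_\omega\cdot(b_0+a_0b_{-1}+a_0a_{-1}b_{-2}+\cdots)\big)$ (with $1/\infty:=0$), where $b_n=\gamma_n\mathbf 1$ and $\pi_\omega=\lim_{n\to\infty}e_i\,\eta_{-n}\cdots\eta_{-1}$ (row vector, independent of $i$). *)

theory Defs
  imports "HOL-Probability.Probability"
begin

text \<open>
  The library instance \<^term>\<open>norm\<close> on matrices is the Euclidean norm of the entries. The matrix
  norm needed here is the one induced by the maximum norm \<^term>\<open>infnorm\<close> on vectors; the
  definition is that of \<^term>\<open>onorm\<close> with \<^term>\<open>infnorm\<close> in place of \<^term>\<open>norm\<close>.
\<close>

definition max_opnorm :: "real^'d^'d \<Rightarrow> real" where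
  "max_opnorm A = (SUP x. infnorm (A *v x) / infnorm x)"

text \<open>\<open>log (1 / (1 - x))\<close> for \<open>0 \<le> x \<le> 1\<close>. The value at \<open>x = 1\<close> must be \<open>\<infinity>\<close>, whereas
  \<^term>\<open>ln (1 / 0 :: real) = 0\<close> in the library.\<close>

definition log_inv_gap :: "real \<Rightarrow> ennreal" where
  "log_inv_gap x = (if x < 1 then ennreal (ln (1 / (1 - x))) else \<infinity>)"

definition extended_ln :: "ennreal \<Rightarrow> ereal" where
  "extended_ln x = (if x = 0 then - \<infinity> else if x = \<infinity> then \<infinity> else ereal (ln (enn2real x)))"

definition nonneg_matrix :: "real^'d^'d \<Rightarrow> bool" where
  "nonneg_matrix A \<longleftrightarrow> (\<forall>i j. 0 \<le> A $ i $ j)"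

definition stochastic_matrix :: "real^'d^'d \<Rightarrow> bool" where
  "stochastic_matrix A \<longleftrightarrow> nonneg_matrix A \<and> (\<forall>i. (\<Sum>j\<in>UNIV. A $ i $ j) = 1)"

definition env_space :: "'s measure \<Rightarrow> (int \<Rightarrow> 's) measure" where
  "env_space S = (\<Pi>\<^sub>M n\<in>UNIV. S)"

text \<open>\<open>env_shift n\<close> is the \<open>n\<close>-th iterate of the shift \<open>\<theta> = env_shift 1\<close>.\<close>

definition env_shift :: "int \<Rightarrow> (int \<Rightarrow> 's) \<Rightarrow> (int \<Rightarrow> 's)" where
  "env_shift n \<omega> = (\<lambda>k. \<omega> (k + n))"

definition stationary_env :: "(int \<Rightarrow> 's) measure \<Rightarrow> bool" where
  "stationary_env P \<longleftrightarrow> distr P P (env_shift 1) = P"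

definition ergodic_env :: "(int \<Rightarrow> 's) measure \<Rightarrow> bool" where
  "ergodic_env P \<longleftrightarrow>
    (\<forall>A\<in>sets P. env_shift 1 -` A \<inter> space P = A \<longrightarrow> measure P A = 0 \<or> measure P A = 1)"

definition path_space :: "(nat \<Rightarrow> 'z) measure" where
  "path_space = (\<Pi>\<^sub>M t\<in>UNIV. count_space UNIV)"

definition chain_kernel :: "'z pmf \<Rightarrow> ('z \<Rightarrow> 'z pmf) \<Rightarrow> nat \<Rightarrow> (nat \<Rightarrow> 'z) \<Rightarrow> 'z measure" where
  "chain_kernel \<nu> K t x = (if t = 0 then measure_pmf \<nu> else measure_pmf (K (x (t - 1))))"

text \<open>The Ionescu Tulcea extension of the finite-dimensional distributions
  of the chain with initial law \<open>\<nu>\<close> and transition kernel \<open>K\<close>; see \<open>emeasure_chain_law\<close>.\<close>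

definition chain_law :: "'z pmf \<Rightarrow> ('z \<Rightarrow> 'z pmf) \<Rightarrow> (nat \<Rightarrow> 'z) measure" where
  "chain_law \<nu> K =
    projective_family.lim UNIV
      (Ionescu_Tulcea.CI (chain_kernel \<nu> K) (\<lambda>_. count_space UNIV)) (\<lambda>_. count_space UNIV)"

lemma Ionescu_Tulcea_chain_kernel:
  fixes \<nu> :: "'z::countable pmf"
  shows "Ionescu_Tulcea (chain_kernel \<nu> K) (\<lambda>_. count_space UNIV)"
proof (rule Ionescu_Tulcea.intro)
  fix i :: nat
  show "chain_kernel \<nu> K i
      \<in> measurable (\<Pi>\<^sub>M j\<in>{0..<i}. count_space UNIV) (subprob_algebra (count_space UNIV))"
  proof (cases "i = 0")
    case True
    then show ?thesis
      by (auto simp: chain_kernel_def[abs_def] measure_pmf_in_subprob_algebra)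
  next
    case False
    have "(\<lambda>x. x (i - 1)) \<in> measurable (\<Pi>\<^sub>M j\<in>{0..<i}. count_space UNIV) (count_space UNIV)"
      using False by (intro measurable_component_singleton) auto
    moreover have "(\<lambda>z. measure_pmf (K z))
        \<in> measurable (count_space UNIV) (subprob_algebra (count_space UNIV))"
      by (auto simp: measure_pmf_in_subprob_algebra)
    ultimately show ?thesis
      using False by (auto simp: chain_kernel_def[abs_def] intro: measurable_compose)
  qed
next
  show "prob_space (chain_kernel \<nu> K i x)"
    if "x \<in> space (\<Pi>\<^sub>M j\<in>{0..<i}. count_space UNIV)" for i x
    by (auto simp: chain_kernel_def measure_pmf.prob_space_axioms)
qed

lemma prob_space_chain_law:
  fixes \<nu> :: "'z::countable pmf"
  shows "prob_space (chain_law \<nu> K)"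
    and "sets (chain_law \<nu> K) = sets path_space"
proof -
  interpret Ionescu_Tulcea "chain_kernel \<nu> K" "\<lambda>_. count_space UNIV"
    by (rule Ionescu_Tulcea_chain_kernel)
  show "sets (chain_law \<nu> K) = sets path_space"
    by (simp add: chain_law_def path_space_def)
  have "emeasure PF.lim (PF.emb UNIV {} (space (PiM {} (\<lambda>_. count_space UNIV)))) = emeasure (CI {}) (space (CI {}))"
    by (subst lim) (auto simp: PF.space_P)
  also have "\<dots> = 1"
    by (intro prob_space.emeasure_space_1 PF.prob_space_P) auto
  finally have "emeasure PF.lim (PF.emb UNIV {} (space (PiM {} (\<lambda>_. count_space UNIV)))) = 1" .
  then show "prob_space (chain_law \<nu> K)"
    by (intro prob_spaceI) (simp add: chain_law_def prod_emb_def space_PiM PiE_def extensional_def)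
qed

lemma emeasure_chain_law:
  fixes \<nu> :: "'z::countable pmf"
  shows "emeasure (chain_law \<nu> K) {x. \<forall>t\<le>n. x t = z t} =
    ennreal (pmf \<nu> (z 0) * (\<Prod>t<n. pmf (K (z t)) (z (Suc t))))"
proof -
  interpret Ionescu_Tulcea "chain_kernel \<nu> K" "\<lambda>_. count_space UNIV"
    by (rule Ionescu_Tulcea_chain_kernel)
  define B where "B m = (\<Pi>\<^sub>E t\<in>{0..<m}. {z t})" for m :: nat
  define c where "c m = (if m = 0 then pmf \<nu> (z 0) else pmf (K (z (m - 1))) (z m))" for m :: nat
  let ?M = "\<lambda>m::nat. \<Pi>\<^sub>M t\<in>{0..<m}. (count_space UNIV :: 'z measure)"
  have B[measurable]: "B m \<in> sets (?M m)" for m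
    unfolding B_def by (intro sets_PiM_I_finite) auto
  have u: "(\<lambda>_. undefined) \<in> space (?M 0)"
    by (simp add: space_PiM)
  have eP: "emeasure (eP m x) (B (Suc m)) = ennreal (c m) * indicator (B m) x"
    if x: "x \<in> space (?M m)" for m x
  proof -
    have x': "x t = undefined" if "t \<notin> {0..<m}" for t
      using x that by (auto simp: space_PiM PiE_def extensional_def)
    have "(\<lambda>y. fun_upd x m y) -` B (Suc m) \<inter> space (count_space UNIV) = (if x \<in> B m then {z m} else {})"
      using x' by (auto simp: B_def PiE_def extensional_def Pi_def less_Suc_eq split: if_splits)
    then have "emeasure (eP m x) (B (Suc m)) =
        emeasure (chain_kernel \<nu> K m x) (if x \<in> B m then {z m} else {})"
      using x by (subst emeasure_eP) auto
    also have "\<dots> = ennreal (c m) * indicator (B m) x"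
      using PiE_mem[of x "{0..<m}" "\<lambda>t. {z t}" "m - 1"]
      by (auto simp: chain_kernel_def c_def emeasure_pmf_single B_def split: split_indicator)
    finally show ?thesis .
  qed
  have C: "emeasure (C 0 m (\<lambda>_. undefined)) (B m) = ennreal (\<Prod>t<m. c t)" for m
  proof (induction m)
    case 0
    have "indicator (B 0) (\<lambda>_. undefined) = (1 :: ennreal)"
      by (simp add: B_def)
    then show ?case using B[of 0] by (simp only: C.simps add_0 emeasure_return) simp
  next
    case (Suc m)
    have sp: "space (C 0 m (\<lambda>_. undefined)) = space (?M m)"
      and st: "sets (C 0 m (\<lambda>_. undefined)) = sets (?M m)"
      using space_C[OF u, of m] sets_C[OF u, of m] by auto
    have ne: "space (?M m) \<noteq> {}"
      by (simp add: space_PiM_empty_iff)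
    have "emeasure (C 0 (Suc m) (\<lambda>_. undefined)) (B (Suc m)) =
        (\<integral>\<^sup>+x. emeasure (eP m x) (B (Suc m)) \<partial>C 0 m (\<lambda>_. undefined))"
      unfolding C.simps add_0
      by (rule emeasure_bind[where N="?M (Suc m)"])
        (use sp ne in \<open>simp_all add: measurable_cong_sets[OF st refl] B\<close>)
    also have "\<dots> = (\<integral>\<^sup>+x. ennreal (c m) * indicator (B m) x \<partial>C 0 m (\<lambda>_. undefined))"
      by (intro nn_integral_cong) (simp add: sp eP)
    also have "\<dots> = ennreal (c m) * emeasure (C 0 m (\<lambda>_. undefined)) (B m)"
      using B by (intro nn_integral_cmult_indicator) (simp add: st)
    finally show ?case
      by (simp add: Suc.IH ennreal_mult[symmetric] prod_nonneg c_def mult.commute)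
  qed
  have "{x. \<forall>t\<le>n. x t = z t} = PF.emb UNIV {0..<Suc n} (B (Suc n))"
    by (auto simp: prod_emb_def B_def PiE_iff less_Suc_eq_le restrict_extensional split: if_splits)
  then have "emeasure (chain_law \<nu> K) {x. \<forall>t\<le>n. x t = z t} =
      emeasure (C 0 (Suc n) (\<lambda>_. undefined)) (B (Suc n))"
    unfolding chain_law_def
    by (simp only: lim[OF finite_atLeastLessThan B])
      (use sets.sets_into_space[OF B[of "Suc n"]] in
        \<open>simp only: emeasure_CI[OF subset_refl B] space_PiM prod_emb_id\<close>)
  then show ?thesis
    unfolding C by (simp add: prod.lessThan_Suc_shift c_def del: prod.lessThan_Suc)
qed

lemma space_path_space [simp]: "space path_space = UNIV"
  by (simp add: path_space_def space_PiM)

lemma sets_path_space_cylinders: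
  "sets (path_space :: (nat \<Rightarrow> 'z::countable) measure) =
    sigma_sets UNIV (insert {} {A. \<exists>n z. A = {x. \<forall>t\<le>n. x t = z t}})" (is "_ = sigma_sets UNIV ?G")
proof
  show "sigma_sets UNIV ?G \<subseteq> sets path_space"
  proof (rule sets.sigma_sets_subset[of _ path_space, simplified], safe)
    fix n :: nat and z :: "nat \<Rightarrow> 'z"
    have "{x \<in> space path_space. \<forall>t\<in>{..n}. x t = z t} \<in> sets path_space"
      unfolding path_space_def by measurable
    then show "{x. \<forall>t\<le>n. x t = z t} \<in> sets path_space"
      by (simp add: Ball_def)
  qed
  have coord: "{x. x t \<in> A} \<in> sets (sigma UNIV ?G)" for t and A :: "'z set"
  proof -
    have "{x. x t \<in> A} = (\<Union>w\<in>{w. length w = Suc t \<and> w ! t \<in> A}. {x. \<forall>s\<le>t. x s = w ! s})"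
    proof safe
      fix x :: "nat \<Rightarrow> 'z" assume "x t \<in> A"
      then show "x \<in> (\<Union>w\<in>{w. length w = Suc t \<and> w ! t \<in> A}. {x. \<forall>s\<le>t. x s = w ! s})"
        by (intro UN_I[of "map x [0..<Suc t]"]) (auto simp del: upt_Suc)
    qed auto
    also have "\<dots> \<in> sets (sigma UNIV ?G)"
      by (intro sets.countable_UN'') (auto intro!: sigma_sets.Basic)
    finally show ?thesis .
  qed
  have "sigma_sets UNIV {{f :: nat \<Rightarrow> 'z. f t \<in> A} |t A. True} \<subseteq> sets (sigma UNIV ?G)"
    using sets.sigma_sets_subset[of "{{f :: nat \<Rightarrow> 'z. f t \<in> A} |t A. True}" "sigma UNIV ?G"]
    using coord by auto
  then show "sets path_space \<subseteq> sigma_sets UNIV ?G"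
    by (simp add: path_space_def sets_PiM_single PiE_UNIV_domain)
qed

lemma measurable_chain_law:
  fixes \<nu> :: "'w \<Rightarrow> 'z::countable pmf"
  assumes [measurable]: "\<And>z. (\<lambda>\<omega>. pmf (\<nu> \<omega>) z) \<in> borel_measurable M"
    and [measurable]: "\<And>z z'. (\<lambda>\<omega>. pmf (K \<omega> z) z') \<in> borel_measurable M"
  shows "(\<lambda>\<omega>. chain_law (\<nu> \<omega>) (K \<omega>)) \<in> measurable M (prob_algebra path_space)"
proof (rule measurable_prob_algebra_generated[OF sets_path_space_cylinders])
  show "Int_stable (insert {} {A. \<exists>n z. A = {x :: nat \<Rightarrow> 'z. \<forall>t\<le>n. x t = z t}})"
  proof (rule Int_stableI)
    have cyl: "{x. \<forall>t\<le>n. x t = z t} \<inter> {x. \<forall>t\<le>m. x t = w t}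
        \<in> insert {} {A. \<exists>n z. A = {x :: nat \<Rightarrow> 'z. \<forall>t\<le>n. x t = z t}}" if "n \<le> m" for n m z w
    proof (cases "\<forall>t\<le>n. z t = w t")
      case True
      then have "{x. \<forall>t\<le>n. x t = z t} \<inter> {x. \<forall>t\<le>m. x t = w t} = {x. \<forall>t\<le>m. x t = w t}"
        using that by auto
      then show ?thesis by blast
    next
      case False
      then have "{x. \<forall>t\<le>n. x t = z t} \<inter> {x. \<forall>t\<le>m. x t = w t} = {}"
        using that by fastforce
      then show ?thesis by simp
    qed
    fix a b :: "(nat \<Rightarrow> 'z) set"
    assume ab: "a \<in> insert {} {A. \<exists>n z. A = {x. \<forall>t\<le>n. x t = z t}}"
      "b \<in> insert {} {A. \<exists>n z. A = {x. \<forall>t\<le>n. x t = z t}}"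
    show "a \<inter> b \<in> insert {} {A. \<exists>n z. A = {x. \<forall>t\<le>n. x t = z t}}"
    proof (cases "a = {} \<or> b = {}")
      case False
      then obtain n z m w where a: "a = {x. \<forall>t\<le>n. x t = z t}" and b: "b = {x. \<forall>t\<le>m. x t = w t}"
        using ab by blast
      show ?thesis
        using cyl[of n m z w] cyl[of m n w z] nat_le_linear[of n m] unfolding a b
        by (metis Int_commute)
    qed auto
  qed
  fix A :: "(nat \<Rightarrow> 'z) set"
  assume "A \<in> insert {} {A. \<exists>n z. A = {x. \<forall>t\<le>n. x t = z t}}"
  then consider "A = {}" | n z where "A = {x. \<forall>t\<le>n. x t = z t}"
    by blast
  then show "(\<lambda>\<omega>. emeasure (chain_law (\<nu> \<omega>) (K \<omega>)) A) \<in> borel_measurable M"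
    by cases (simp_all add: emeasure_chain_law)
qed (auto simp: prob_space_chain_law)

definition jump_prob ::
  "('s \<Rightarrow> real^'d^'d) \<Rightarrow> ('s \<Rightarrow> real^'d^'d) \<Rightarrow> ('s \<Rightarrow> real^'d^'d) \<Rightarrow> (int \<Rightarrow> 's) \<Rightarrow>
    int \<times> 'd \<Rightarrow> int \<times> 'd \<Rightarrow> real" where
  "jump_prob p q r \<omega> = (\<lambda>(n, i) (m, j).
    if m = n + 1 then p (\<omega> n) $ i $ j
    else if m = n then r (\<omega> n) $ i $ j
    else if m = n - 1 then q (\<omega> n) $ i $ j
    else 0)"

text \<open>\<^const>\<open>embed_pmf\<close> requires the jump probabilities to sum to \<open>1\<close>; see \<open>pmf_walk_step\<close>.\<close>

definition walk_step ::
  "('s \<Rightarrow> real^'d^'d) \<Rightarrow> ('s \<Rightarrow> real^'d^'d) \<Rightarrow> ('s \<Rightarrow> real^'d^'d) \<Rightarrow> (int \<Rightarrow> 's) \<Rightarrow>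
    int \<times> 'd \<Rightarrow> (int \<times> 'd) pmf" where
  "walk_step p q r \<omega> x = embed_pmf (jump_prob p q r \<omega> x)"

lemma pmf_walk_step:
  fixes p q r :: "'s \<Rightarrow> real^'d::finite^'d"
  assumes "nonneg_matrix (p (\<omega> n))" "nonneg_matrix (q (\<omega> n))" "nonneg_matrix (r (\<omega> n))"
    and "stochastic_matrix (p (\<omega> n) + q (\<omega> n) + r (\<omega> n))"
  shows "pmf (walk_step p q r \<omega> (n, i)) y = jump_prob p q r \<omega> (n, i) y"
  unfolding walk_step_def
proof (rule pmf_embed_pmf)
  show nonneg: "0 \<le> jump_prob p q r \<omega> (n, i) x" for x
    using assms by (auto simp: jump_prob_def nonneg_matrix_def split: prod.split)
  have "(\<integral>\<^sup>+x. ennreal (jump_prob p q r \<omega> (n, i) x) \<partial>count_space UNIV)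
      = (\<Sum>x\<in>{n - 1, n, n + 1} \<times> UNIV. ennreal (jump_prob p q r \<omega> (n, i) x))"
    by (rule nn_integral_count_space') (auto simp: jump_prob_def split: if_splits)
  also have "\<dots> = ennreal (\<Sum>x\<in>{n - 1, n, n + 1} \<times> UNIV. jump_prob p q r \<omega> (n, i) x)"
    using nonneg by (simp add: sum_ennreal)
  also have "(\<Sum>x\<in>{n - 1, n, n + 1} \<times> UNIV. jump_prob p q r \<omega> (n, i) x)
      = (\<Sum>m\<in>{n - 1, n, n + 1}. \<Sum>j\<in>UNIV. jump_prob p q r \<omega> (n, i) (m, j))"
    by (simp add: sum.cartesian_product)
  also have "\<dots> = (\<Sum>j\<in>UNIV. (p (\<omega> n) + q (\<omega> n) + r (\<omega> n)) $ i $ j)"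
    by (simp add: jump_prob_def sum.distrib)
  also have "\<dots> = 1"
    using assms(4) by (simp only: stochastic_matrix_def)
  finally show "(\<integral>\<^sup>+x. ennreal (jump_prob p q r \<omega> (n, i) x) \<partial>count_space UNIV) = 1"
    by simp
qed

definition quenched_law ::
  "('s \<Rightarrow> real^'d^'d) \<Rightarrow> ('s \<Rightarrow> real^'d^'d) \<Rightarrow> ('s \<Rightarrow> real^'d^'d) \<Rightarrow> (int \<Rightarrow> 's) \<Rightarrow>
    'd::finite pmf \<Rightarrow> (nat \<Rightarrow> int \<times> 'd) measure" where
  "quenched_law p q r \<omega> \<nu> = chain_law (map_pmf (Pair 0) \<nu>) (walk_step p q r \<omega>)"

definition initial_laws :: "'s measure \<Rightarrow> ((int \<Rightarrow> 's) \<Rightarrow> 'd::finite pmf) set" where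
  "initial_laws S = {\<mu>.
    (\<forall>j. (\<lambda>\<omega>. pmf (\<mu> \<omega>) j) \<in> borel_measurable (env_space S)) \<and>
    (\<forall>\<omega>\<in>space (env_space S). \<forall>\<omega>'\<in>space (env_space S).
      (\<forall>n\<le>0. \<omega> n = \<omega>' n) \<longrightarrow> \<mu> \<omega> = \<mu> \<omega>')}"

text \<open>The monadic bind is meaningful only for measurable kernels; \<open>emeasure_annealed_law\<close> below
  confirms the defining property of the annealed law.\<close>

definition annealed_law ::
  "(int \<Rightarrow> 's) measure \<Rightarrow> ('s \<Rightarrow> real^'d^'d) \<Rightarrow> ('s \<Rightarrow> real^'d^'d) \<Rightarrow> ('s \<Rightarrow> real^'d^'d) \<Rightarrow>
    ((int \<Rightarrow> 's) \<Rightarrow> 'd::finite pmf) \<Rightarrow> ((int \<Rightarrow> 's) \<times> (nat \<Rightarrow> int \<times> 'd)) measure" where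
  "annealed_law P p q r \<mu> =
    P \<bind> (\<lambda>\<omega>. distr (quenched_law p q r \<omega> (\<mu> \<omega>)) (P \<Otimes>\<^sub>M path_space) (Pair \<omega>))"

lemma emeasure_annealed_law:
  fixes p q r :: "'s \<Rightarrow> real^'d::finite^'d"
  assumes P: "prob_space P" "sets P = sets (env_space S)"
    and [measurable]: "p \<in> borel_measurable S" "q \<in> borel_measurable S" "r \<in> borel_measurable S"
    and nonneg: "\<And>s. s \<in> space S \<Longrightarrow> nonneg_matrix (p s) \<and> nonneg_matrix (q s) \<and> nonneg_matrix (r s)"
    and stoch: "\<And>s. s \<in> space S \<Longrightarrow> stochastic_matrix (p s + q s + r s)"
    and \<mu>: "\<mu> \<in> initial_laws S"
    and F: "F \<in> sets P" and G: "G \<in> sets path_space"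
  shows "emeasure (annealed_law P p q r \<mu>) (F \<times> G) =
    (\<integral>\<^sup>+\<omega>\<in>F. emeasure (quenched_law p q r \<omega> (\<mu> \<omega>)) G \<partial>P)"
proof -
  interpret prob_space P by fact
  note [measurable_cong] = P(2)
  have sp: "space P = space (env_space S)"
    using P(2) by (rule sets_eq_imp_space_eq)
  have coord[measurable]: "(\<lambda>\<omega>. \<omega> n) \<in> measurable P S" for n
    unfolding measurable_cong_sets[OF P(2) refl] env_space_def by measurable
  have mem: "\<omega> n \<in> space S" if "\<omega> \<in> space P" for \<omega> n
    using that measurable_space[OF coord] by blast
  have entry[measurable]: "(\<lambda>\<omega>. f (\<omega> n) $ i $ j) \<in> borel_measurable P"
    if [measurable]: "f \<in> borel_measurable S" for f :: "'s \<Rightarrow> real^'d^'d" and n i j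
  proof -
    have "(\<lambda>A::real^'d^'d. A $ i $ j) \<in> borel_measurable borel"
      by (intro borel_measurable_continuous_onI continuous_intros)
    then show ?thesis by measurable
  qed
  have step: "(\<lambda>\<omega>. pmf (walk_step p q r \<omega> z) z') \<in> borel_measurable P" for z z'
  proof -
    obtain n i m j where z: "z = (n, i)" "z' = (m, j)" by (cases z, cases z') auto
    have "(\<lambda>\<omega>. jump_prob p q r \<omega> z z') \<in> borel_measurable P"
      unfolding z jump_prob_def by simp
    then show ?thesis
      by (rule measurable_cong[THEN iffD1, rotated])
        (unfold z, rule pmf_walk_step[symmetric], use mem nonneg stoch in auto)
  qed
  have init: "(\<lambda>\<omega>. pmf (map_pmf (Pair (0::int)) (\<mu> \<omega>)) z) \<in> borel_measurable P" for z
  proof (cases "fst z = 0")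
    case True
    then have "pmf (map_pmf (Pair (0::int)) (\<mu> \<omega>)) z = pmf (\<mu> \<omega>) (snd z)" for \<omega>
      using pmf_map_inj'[of "Pair (0::int)" "\<mu> \<omega>" "snd z"] by (cases z) (auto simp: inj_def)
    then show ?thesis
      using \<mu> by (simp add: initial_laws_def measurable_cong_sets[OF P(2) refl])
  next
    case False
    then have "pmf (map_pmf (Pair (0::int)) (\<mu> \<omega>)) z = 0" for \<omega>
      by (intro pmf_map_outside) auto
    then show ?thesis by simp
  qed
  have quenched: "(\<lambda>\<omega>. quenched_law p q r \<omega> (\<mu> \<omega>)) \<in> measurable P (subprob_algebra path_space)"
    unfolding quenched_law_def
    by (rule measurable_prob_algebraD, rule measurable_chain_law) (rule init step)+
  have "(\<lambda>\<omega>. distr (quenched_law p q r \<omega> (\<mu> \<omega>)) (P \<Otimes>\<^sub>M path_space) (Pair \<omega>))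
      \<in> measurable P (subprob_algebra (P \<Otimes>\<^sub>M path_space))"
    by (rule measurable_distr2[OF _ quenched]) simp
  then have "emeasure (annealed_law P p q r \<mu>) (F \<times> G) = (\<integral>\<^sup>+\<omega>. emeasure
      (distr (quenched_law p q r \<omega> (\<mu> \<omega>)) (P \<Otimes>\<^sub>M path_space) (Pair \<omega>)) (F \<times> G) \<partial>P)"
    unfolding annealed_law_def using F G not_empty by (intro emeasure_bind) auto
  also have "\<dots> = (\<integral>\<^sup>+\<omega>\<in>F. emeasure (quenched_law p q r \<omega> (\<mu> \<omega>)) G \<partial>P)"
  proof (rule nn_integral_cong)
    fix \<omega> assume \<omega>: "\<omega> \<in> space P"
    have s: "sets (quenched_law p q r \<omega> (\<mu> \<omega>)) = sets path_space"
      by (simp add: quenched_law_def prob_space_chain_law)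
    have "Pair \<omega> \<in> measurable (quenched_law p q r \<omega> (\<mu> \<omega>)) (P \<Otimes>\<^sub>M path_space)"
      unfolding measurable_cong_sets[OF s refl] using \<omega> by simp
    then have "emeasure (distr (quenched_law p q r \<omega> (\<mu> \<omega>)) (P \<Otimes>\<^sub>M path_space) (Pair \<omega>)) (F \<times> G)
        = emeasure (quenched_law p q r \<omega> (\<mu> \<omega>)) (Pair \<omega> -` (F \<times> G) \<inter> space path_space)"
      using F G sets_eq_imp_space_eq[OF s] by (subst emeasure_distr) auto
    also have "Pair \<omega> -` (F \<times> G) \<inter> space path_space = (if \<omega> \<in> F then G else {})"
      by auto
    finally show "emeasure (distr (quenched_law p q r \<omega> (\<mu> \<omega>)) (P \<Otimes>\<^sub>M path_space) (Pair \<omega>)) (F \<times> G)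
        = emeasure (quenched_law p q r \<omega> (\<mu> \<omega>)) G * indicator F \<omega>"
      by (simp split: split_indicator)
  qed
  finally show ?thesis .
qed

definition hit_time :: "int \<Rightarrow> (nat \<Rightarrow> int \<times> 'd) \<Rightarrow> enat" where
  "hit_time n x = Inf (enat ` {t. fst (x t) = n})"

definition eta ::
  "('s \<Rightarrow> real^'d^'d) \<Rightarrow> ('s \<Rightarrow> real^'d^'d) \<Rightarrow> ('s \<Rightarrow> real^'d^'d) \<Rightarrow> int \<Rightarrow> (int \<Rightarrow> 's) \<Rightarrow>
    real^'d^'d::finite" where
  "eta p q r n \<omega> = (\<chi> i j. measure (quenched_law p q r (env_shift n \<omega>) (return_pmf i))
    {x. hit_time 1 x < \<infinity> \<and> snd (x (the_enat (hit_time 1 x))) = j})"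

definition condition_C ::
  "(int \<Rightarrow> 's) measure \<Rightarrow> ('s \<Rightarrow> real^'d^'d) \<Rightarrow> ('s \<Rightarrow> real^'d^'d) \<Rightarrow> ('s \<Rightarrow> real^'d^'d::finite) \<Rightarrow> bool"
  where
  "condition_C P p q r \<longleftrightarrow>
    stationary_env P \<and> ergodic_env P \<and>
    (\<integral>\<^sup>+\<omega>. log_inv_gap (max_opnorm (r (\<omega> 0) + p (\<omega> 0))) \<partial>P) < \<infinity> \<and>
    (\<integral>\<^sup>+\<omega>. log_inv_gap (max_opnorm (r (\<omega> 0) + q (\<omega> 0))) \<partial>P) < \<infinity> \<and>
    (\<forall>j. AE \<omega> in P. (\<Sum>i\<in>UNIV. q (\<omega> 0) $ i $ j) > 0 \<and> (\<Sum>i\<in>UNIV. p (\<omega> 0) $ i $ j) > 0) \<and>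
    (\<forall>i j. AE \<omega> in P. eta p q r 0 \<omega> $ i $ j > 0)"

definition gamma_mat ::
  "('s \<Rightarrow> real^'d^'d) \<Rightarrow> ('s \<Rightarrow> real^'d^'d) \<Rightarrow> (int \<Rightarrow> (int \<Rightarrow> 's) \<Rightarrow> real^'d^'d) \<Rightarrow>
    int \<Rightarrow> (int \<Rightarrow> 's) \<Rightarrow> real^'d^'d" where
  "gamma_mat q r \<zeta> n \<omega> = matrix_inv (mat 1 - q (\<omega> n) ** \<zeta> (n - 1) \<omega> - r (\<omega> n))"

text \<open>The matrices are functions of the environment, so the sequence is stationary (jointly with the
  environment) if and only if it commutes with the shift almost surely.\<close>

definition stationary_solution ::
  "(int \<Rightarrow> 's) measure \<Rightarrow> ('s \<Rightarrow> real^'d^'d) \<Rightarrow> ('s \<Rightarrow> real^'d^'d) \<Rightarrow> ('s \<Rightarrow> real^'d^'d) \<Rightarrow>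
    (int \<Rightarrow> (int \<Rightarrow> 's) \<Rightarrow> real^'d^'d) \<Rightarrow> bool" where
  "stationary_solution P p q r \<zeta> \<longleftrightarrow>
    (\<forall>n. \<zeta> n \<in> borel_measurable P) \<and>
    (\<forall>n. AE \<omega> in P. \<zeta> (n + 1) \<omega> = \<zeta> n (env_shift 1 \<omega>)) \<and>
    (\<forall>n. AE \<omega> in P. stochastic_matrix (\<zeta> n \<omega>)) \<and>
    (\<forall>n. AE \<omega> in P. \<zeta> n \<omega> = gamma_mat q r \<zeta> n \<omega> ** p (\<omega> n))"

definition a_mat ::
  "('s \<Rightarrow> real^'d^'d) \<Rightarrow> ('s \<Rightarrow> real^'d^'d) \<Rightarrow> (int \<Rightarrow> (int \<Rightarrow> 's) \<Rightarrow> real^'d^'d) \<Rightarrow>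
    int \<Rightarrow> (int \<Rightarrow> 's) \<Rightarrow> real^'d^'d" where
  "a_mat q r \<zeta> n \<omega> = gamma_mat q r \<zeta> n \<omega> ** q (\<omega> n)"

primrec a_prod ::
  "('s \<Rightarrow> real^'d^'d) \<Rightarrow> ('s \<Rightarrow> real^'d^'d) \<Rightarrow> (int \<Rightarrow> (int \<Rightarrow> 's) \<Rightarrow> real^'d^'d) \<Rightarrow>
    nat \<Rightarrow> (int \<Rightarrow> 's) \<Rightarrow> real^'d^'d" where
  "a_prod q r \<zeta> 0 \<omega> = mat 1"
| "a_prod q r \<zeta> (Suc n) \<omega> = a_mat q r \<zeta> (int n) \<omega> ** a_prod q r \<zeta> n \<omega>"

end

theory Submission
  imports Defs
begin

text \<open>
  Let \<open>T n\<close> be the hitting time of level \<open>n\<close>. Only the upper bound on the mean of \<open>T 1\<close> uses the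
  matrices \<open>\<zeta>\<close>: with \<open>\<tau> n = \<gamma> n (1 + q n \<tau> (n - 1))\<close>, started from \<open>0\<close> at a remote level below the origin,
  and \<open>h n = \<tau> n + \<zeta> n h (n + 1)\<close>, \<open>h 1 = 0\<close>, the equation for \<open>\<zeta>\<close> yields
  \<open>h n = 1 + p n h (n + 1) + r n h n + q n h (n - 1)\<close>. Hence \<open>h 0 = \<tau> 0\<close> dominates the truncated mean
  of \<open>T 1\<close>. Ellipticity gives \<open>\<gamma> n 1 \<le> 1 / \<epsilon>\<close>, so the mean of \<open>\<tau> 0\<close> is at most
  \<open>1 / \<epsilon>\<close> times the sum of the mean norms of the products of the \<open>a n\<close>, which decay geometrically.

  The walk observed at the times \<open>T n\<close> has the positive stochastic transition matrices \<open>\<eta> n\<close>, which have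
  a stationary distribution depending on the environment. Started from it, the increments of \<open>T n\<close> form
  a stationary sequence; the events needed in Birkhoff's theorem are trivial, because their quenched
  probabilities are harmonic for \<open>\<eta>\<close>. So \<open>T n / n\<close> converges to the finite mean \<open>c \<ge> 1\<close> of \<open>T 1\<close>, and the
  walk, which is skip-free, has speed \<open>1 / c\<close>.
\<close>

section \<open>Bounded ergodic sums\<close>

text \<open>Truncation lets the linear algebra run before it is known that level \<open>1\<close> is
  reached at all: within \<open>N\<close> steps from \<open>0\<close> the walk sees no level below
  \<open>-N\<close>, so a recursion started from zero at the bottom of this window suffices, and its
  integrated bound does not depend on \<open>N\<close>. Finite mean and almost sure passage to every
  higher level come out together. The obstacle is that only the environment is assumed ergodic, not
  the restarted path. The half of Birkhoff's theorem used here asks for a zero-one law for a single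
  event, the unboundedness of the sums, which does not change under restarting: ergodicity and
  positive exit probabilities make its quenched probability constant, and the Markov property makes
  it \<open>0\<close> or \<open>1\<close>. Applied to \<open>T 1 - c\<close> and
  \<open>c - T 1\<close>, each lowered by \<open>1 / (k + 1)\<close>, this gives both bounds for the
  limit. The stationary law charges every state, so what is null for the averaged law is null from
  each starting state.\<close>

lemma bdd_above_range_nat:
  fixes s :: "nat \<Rightarrow> real"
  shows "bdd_above (range s) \<longleftrightarrow> (\<exists>K::nat. \<forall>n. s n \<le> real K)"
proof
  assume "bdd_above (range s)"
  then obtain c where "\<And>n. s n \<le> c" by (auto simp: bdd_above_def)
  then show "\<exists>K::nat. \<forall>n. s n \<le> real K"
    using real_arch_simple[of c] by (blast intro: order_trans)
qed (auto simp: bdd_above_def)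

text \<open>
  Half of Birkhoff's theorem. \<open>G n\<close> is the maximum of the first \<open>n + 1\<close> nonempty sums; it satisfies
  \<open>G (n + 1) = g + max 0 (G n \<circ> T)\<close>. If the sums were unbounded almost surely, the negative part of
  \<open>G n\<close> would vanish in the limit, and \<open>\<integral> G (n + 1) - G n \<circ> T \<ge> 0\<close> would give \<open>\<integral> g \<ge> 0\<close>.
\<close>

lemma (in prob_space) ergodic_sums_bounded:
  fixes g :: "'a \<Rightarrow> real"
  assumes T[measurable]: "T \<in> measurable M M" and inv: "distr M M T = M"
    and int: "integrable M g" and neg: "(\<integral>x. g x \<partial>M) < 0"
    and zero_one: "prob {x\<in>space M. \<not> bdd_above (range (\<lambda>n. \<Sum>k<n. g ((T ^^ k) x)))} \<in> {0, 1}"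
  shows "AE x in M. bdd_above (range (\<lambda>n. \<Sum>k<n. g ((T ^^ k) x)))"
proof -
  define G where "G = rec_nat g (\<lambda>_ h x. g x + max 0 (h (T x)))"
  have G0: "G 0 = g" and GS: "G (Suc n) x = g x + max 0 (G n (T x))" for n x
    by (simp_all add: G_def)
  define U where "U = {x\<in>space M. \<not> bdd_above (range (\<lambda>n. \<Sum>k<n. g ((T ^^ k) x)))}"
  have [measurable]: "g \<in> borel_measurable M"
    using int by auto
  have comp: "integrable M (\<lambda>x. h (T x))" "(\<integral>x. h (T x) \<partial>M) = (\<integral>x. h x \<partial>M)"
    if "integrable M h" for h :: "'a \<Rightarrow> real"
  proof -
    have [measurable]: "h \<in> borel_measurable M" using that by auto
    have "integrable (distr M M T) h" using that by (simp add: inv)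
    then show "integrable M (\<lambda>x. h (T x))" by (subst (asm) integrable_distr_eq) auto
    have "(\<integral>x. h x \<partial>distr M M T) = (\<integral>x. h (T x) \<partial>M)" by (rule integral_distr) auto
    then show "(\<integral>x. h (T x) \<partial>M) = (\<integral>x. h x \<partial>M)" by (simp add: inv)
  qed
  have Gint: "integrable M (G n)" for n
  proof (induction n)
    case (Suc n)
    have "integrable M (\<lambda>x. g x + max 0 (G n (T x)))"
      using int comp(1)[OF Suc] by (intro Bochner_Integration.integrable_add integrable_max) auto
    then show ?case by (simp add: GS[abs_def])
  qed (simp add: G0 int)
  have [measurable]: "G n \<in> borel_measurable M" for n
    using Gint[of n] by auto
  have Gmono1: "G n x \<le> G (Suc n) x" for n x
  proof (induction n arbitrary: x)
    case 0
    show ?case by (simp add: G0 GS)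
  next
    case (Suc n)
    have "max 0 (G n (T x)) \<le> max 0 (G (Suc n) (T x))"
      using Suc[of "T x"] by (auto simp: max_def)
    then show ?case by (simp add: GS)
  qed
  have Gmono: "G m x \<le> G n x" if "m \<le> n" for m n x
    using that Gmono1 by (rule lift_Suc_mono_le[rotated])
  have sum_le: "(\<Sum>k<Suc n. g ((T ^^ k) x)) \<le> G n x" for n x
  proof (induction n arbitrary: x)
    case 0
    show ?case by (simp add: G0)
  next
    case (Suc n)
    have "(\<Sum>k<Suc (Suc n). g ((T ^^ k) x)) = g x + (\<Sum>k<Suc n. g ((T ^^ k) (T x)))"
      by (subst sum.lessThan_Suc_shift) (simp add: funpow_Suc_right del: funpow.simps sum.lessThan_Suc)
    also have "\<dots> \<le> g x + G n (T x)"
      using Suc[of "T x"] by simp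
    finally show ?case by (simp add: GS)
  qed
  \<comment> \<open>The empty sum is \<open>0\<close>, so an unbounded sequence of sums has a
    positive one with at least one term; \<open>G\<close> is increasing and stays nonnegative from
    there on.\<close>
  have pos: "\<exists>n. \<forall>m\<ge>n. 0 \<le> G m x" if "x \<in> U" for x
  proof -
    have "\<exists>n. 0 < (\<Sum>k<n. g ((T ^^ k) x))"
      using that unfolding U_def bdd_above_def by (force simp: not_le)
    then obtain n where n: "0 < (\<Sum>k<n. g ((T ^^ k) x))" by blast
    then obtain n' where "n = Suc n'" by (cases n) auto
    then have "0 \<le> G n' x" using n sum_le[of x n'] by simp
    then show ?thesis using Gmono by (blast intro: order_trans)
  qed
  have U[measurable]: "U \<in> sets M"
    unfolding U_def bdd_above_range_nat by measurable
  have "prob U \<noteq> 1"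
  proof
    assume "prob U = 1"
    then have "AE x in M. x \<in> U"
      by (simp add: prob_eq_1)
    then have "AE x in distr M M T. x \<in> U" unfolding inv .
    then have AEU: "AE x in M. T x \<in> U"
      by (rule AE_distrD[OF T])
    \<comment> \<open>By monotonicity \<open>G n\<close> is at least \<open>G 0 = g\<close>, so the
      negative parts are dominated by \<open>\<bar>g\<bar>\<close> composed with
      \<open>T\<close>.\<close>
    have lim: "(\<lambda>n. \<integral>x. max 0 (- G n (T x)) \<partial>M) \<longlonglongrightarrow> (\<integral>x. 0 \<partial>M)"
    proof (rule integral_dominated_convergence[where w="\<lambda>x. \<bar>g (T x)\<bar>"])
      show "integrable M (\<lambda>x. \<bar>g (T x)\<bar>)" using comp(1)[OF int] by auto
      show "AE x in M. (\<lambda>n. max 0 (- G n (T x))) \<longlonglongrightarrow> 0"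
        using AEU
      proof eventually_elim
        case (elim x)
        obtain n where "\<forall>m\<ge>n. 0 \<le> G m (T x)" using pos[OF elim] by blast
        then have "eventually (\<lambda>m. max 0 (- G m (T x)) = 0) sequentially"
          unfolding eventually_sequentially by (intro exI[of _ n]) (simp add: max_absorb1)
        then show ?case by (rule tendsto_eventually)
      qed
      show "AE x in M. norm (max 0 (- G n (T x))) \<le> \<bar>g (T x)\<bar>" for n
      proof (rule AE_I2)
        fix x
        show "norm (max 0 (- G n (T x))) \<le> \<bar>g (T x)\<bar>"
          using Gmono[of 0 n "T x"] by (auto simp: G0 max_def)
      qed
    qed auto
    have "0 \<le> (\<integral>x. g x \<partial>M) + (\<integral>x. max 0 (- G n (T x)) \<partial>M)" for n
    proof -
      have "0 \<le> (\<integral>x. G (Suc n) x - G n x \<partial>M)"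
        using Gmono1 by (intro Bochner_Integration.integral_nonneg_AE) auto
      also have "\<dots> = (\<integral>x. G (Suc n) x \<partial>M) - (\<integral>x. G n (T x) \<partial>M)"
        using Gint comp(2) by simp
      also have "\<dots> = (\<integral>x. G (Suc n) x - G n (T x) \<partial>M)"
        using Gint comp(1) by simp
      also have "\<dots> = (\<integral>x. g x + max 0 (- G n (T x)) \<partial>M)"
        by (intro Bochner_Integration.integral_cong refl) (auto simp: GS max_def)
      also have "\<dots> = (\<integral>x. g x \<partial>M) + (\<integral>x. max 0 (- G n (T x)) \<partial>M)"
        using int comp(1)[OF Gint] by (intro Bochner_Integration.integral_add integrable_max) auto
      finally show ?thesis .
    qed
    then have "0 \<le> (\<integral>x. g x \<partial>M) + (\<integral>x. 0 \<partial>M)"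
      by (intro LIMSEQ_le_const[OF tendsto_add[OF tendsto_const lim]]) auto
    then show False using neg by simp
  qed
  then have "prob U = 0" using zero_one by (simp add: U_def)
  then have "U \<in> null_sets M"
    by (simp add: emeasure_eq_measure null_sets_def)
  then have "AE x in M. x \<notin> U" by (rule AE_not_in)
  then show ?thesis by (rule AE_mp) (auto simp: U_def intro!: AE_I2)
qed

section \<open>The Markov property on path space\<close>

text \<open>Cylinders and the empty set form an intersection-stable generator, and the cylinders of
  length one cover the space because the states are countable.\<close>

lemma path_measure_eqI:
  fixes M N :: "(nat \<Rightarrow> 'z::countable) measure"
  assumes sets: "sets M = sets path_space" "sets N = sets path_space"
    and fin: "finite_measure M"
    and eq: "\<And>n z. emeasure M {x. \<forall>t\<le>n. x t = z t} = emeasure N {x. \<forall>t\<le>n. x t = z t}"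
  shows "M = N"
proof (rule measure_eqI_generator_eq)
  let ?E = "insert {} {A. \<exists>n z. A = {x :: nat \<Rightarrow> 'z. \<forall>t\<le>n. x t = z t}}"
  let ?A = "\<lambda>k. {x :: nat \<Rightarrow> 'z. \<forall>t\<le>0. x t = from_nat k}"
  show "Int_stable ?E"
  proof (rule Int_stableI)
    have cyl: "{x. \<forall>t\<le>n. x t = z t} \<inter> {x. \<forall>t\<le>m. x t = w t} \<in> ?E"
      if "n \<le> m" for n m :: nat and z w :: "nat \<Rightarrow> 'z"
    proof (cases "\<forall>t\<le>n. z t = w t")
      case True
      then have "{x. \<forall>t\<le>n. x t = z t} \<inter> {x. \<forall>t\<le>m. x t = w t} = {x. \<forall>t\<le>m. x t = w t}"
        using that by auto
      then show ?thesis by blast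
    next
      case False
      then have "{x. \<forall>t\<le>n. x t = z t} \<inter> {x. \<forall>t\<le>m. x t = w t} = {}"
        using that by fastforce
      then show ?thesis by simp
    qed
    fix a b assume "a \<in> ?E" "b \<in> ?E"
    then consider "a \<inter> b = {}"
      | n z m w where "a = {x. \<forall>t\<le>n. x t = z t}" "b = {x. \<forall>t\<le>m. x t = w t}"
      by blast
    then show "a \<inter> b \<in> ?E"
    proof cases
      case (2 n z m w)
      show ?thesis
      proof (cases "n \<le> m")
        case True
        then show ?thesis unfolding 2 by (rule cyl)
      next
        case False
        then show ?thesis unfolding 2 by (subst Int_commute, intro cyl) simp
      qed
    qed simp
  qed
  show "sets M = sigma_sets UNIV ?E" "sets N = sigma_sets UNIV ?E"
    by (simp_all add: sets sets_path_space_cylinders)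
  have "?A k \<in> ?E" for k
    by (intro insertI2 CollectI exI[of _ 0] exI[of _ "\<lambda>_. from_nat k"] refl)
  then show "range ?A \<subseteq> ?E" by (rule image_subsetI)
  show "(\<Union>k. ?A k) = UNIV"
  proof -
    have "x \<in> ?A (to_nat (x 0))" for x by simp
    then show ?thesis by blast
  qed
  show "emeasure M (?A k) \<noteq> \<infinity>" for k
    using finite_measure.emeasure_finite[OF fin] by simp
qed (use eq in auto)

lemma measurable_coordinate [measurable]:
  "(\<lambda>x. x t) \<in> measurable path_space (count_space UNIV)"
  unfolding path_space_def by measurable

lemma measurable_path_spaceI:
  assumes "\<And>t. (\<lambda>x. f x t) \<in> measurable M (count_space UNIV)"
  shows "f \<in> measurable M path_space"
  unfolding path_space_def using assms by (intro measurable_PiM_single') auto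

lemma cylinder_in_sets:
  "{x :: nat \<Rightarrow> 'z::countable. \<forall>t\<le>n. x t = z t} \<in> sets path_space"
  unfolding sets_path_space_cylinders by (intro sigma_sets.Basic) blast

lemma space_chain_law [simp]:
  "space (chain_law \<nu> K) = (UNIV :: (nat \<Rightarrow> 'z::countable) set)"
  using sets_eq_imp_space_eq[OF prob_space_chain_law(2)] by simp

lemma measurable_chain_law_dom:
  "measurable (chain_law \<nu> K) N = measurable (path_space :: (nat \<Rightarrow> 'z::countable) measure) N"
  by (rule measurable_cong_sets[OF prob_space_chain_law(2) refl])

text \<open>Both sides are finite measures in \<open>B\<close>: the law restricted to the cylinder
  and pushed forward by the time shift, and a multiple of the law from \<open>z t\<close>. It is
  enough to compare them on cylinders, where both are products of transition probabilities.\<close>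

lemma chain_law_Markov_cylinder:
  fixes \<nu> :: "'z::countable pmf"
  assumes B: "B \<in> sets path_space"
  shows "emeasure (chain_law \<nu> K) ({x. \<forall>s\<le>t. x s = z s} \<inter> {x. (\<lambda>s. x (t + s)) \<in> B}) =
    emeasure (chain_law \<nu> K) {x. \<forall>s\<le>t. x s = z s} * emeasure (chain_law (return_pmf (z t)) K) B"
proof -
  interpret prob_space "chain_law \<nu> K" by (rule prob_space_chain_law)
  let ?C = "{x :: nat \<Rightarrow> 'z. \<forall>s\<le>t. x s = z s}"
  let ?sh = "\<lambda>x :: nat \<Rightarrow> 'z. \<lambda>s. x (t + s)"
  have sh: "?sh \<in> measurable (chain_law \<nu> K) path_space"
    unfolding measurable_chain_law_dom by (rule measurable_path_spaceI) measurable
  have C: "?C \<in> sets (chain_law \<nu> K)"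
    by (simp add: prob_space_chain_law cylinder_in_sets)
  define M where "M = distr (density (chain_law \<nu> K) (indicator ?C)) path_space ?sh"
  define N where "N = scale_measure (emeasure (chain_law \<nu> K) ?C) (chain_law (return_pmf (z t)) K)"
  have eM: "emeasure M B = emeasure (chain_law \<nu> K) (?C \<inter> {x. ?sh x \<in> B})"
    if "B \<in> sets path_space" for B
  proof -
    have "?sh -` B \<inter> space (chain_law \<nu> K) \<in> sets (chain_law \<nu> K)"
      using sh that by (rule measurable_sets)
    then have B': "{x. ?sh x \<in> B} \<in> sets (chain_law \<nu> K)" by (simp add: vimage_def)
    have "emeasure M B = emeasure (density (chain_law \<nu> K) (indicator ?C)) {x. ?sh x \<in> B}"
      unfolding M_def using sh that by (subst emeasure_distr) (auto simp: vimage_def)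
    also have "\<dots> = (\<integral>\<^sup>+x. indicator ?C x * indicator {x. ?sh x \<in> B} x \<partial>chain_law \<nu> K)"
      using B' C by (intro emeasure_density) auto
    also have "\<dots> = (\<integral>\<^sup>+x. indicator (?C \<inter> {x. ?sh x \<in> B}) x \<partial>chain_law \<nu> K)"
      by (simp add: indicator_inter_arith)
    also have "\<dots> = emeasure (chain_law \<nu> K) (?C \<inter> {x. ?sh x \<in> B})"
      using B' C by (intro nn_integral_indicator) auto
    finally show ?thesis .
  qed
  have "M = N"
  proof (rule path_measure_eqI)
    show "sets M = sets path_space" "sets N = sets path_space"
      by (simp_all add: M_def N_def prob_space_chain_law)
    show "finite_measure M"
    proof
      have "emeasure M (space M) = emeasure M UNIV" by (simp add: M_def)
      also have "\<dots> \<noteq> \<infinity>" using sets.top[of path_space] by (subst eM) auto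
      finally show "emeasure M (space M) \<noteq> \<infinity>" .
    qed
    fix n w
    let ?D = "{x :: nat \<Rightarrow> 'z. \<forall>s\<le>n. x s = w s}"
    show "emeasure M ?D = emeasure N ?D"
    proof (cases "w 0 = z t")
      case True
      \<comment> \<open>The path that follows \<open>z\<close> up to time \<open>t\<close> and
        \<open>w\<close> afterwards; the pieces fit because \<open>w 0 = z t\<close>.\<close>
      define y where "y s = (if s \<le> t then z s else w (s - t))" for s
      have y: "y (t + s) = w s" for s using True by (auto simp: y_def)
      have "?C \<inter> {x. ?sh x \<in> ?D} = {x. \<forall>s\<le>t + n. x s = y s}"
      proof (intro set_eqI iffI)
        fix x assume x: "x \<in> ?C \<inter> {x. ?sh x \<in> ?D}"
        show "x \<in> {x. \<forall>s\<le>t + n. x s = y s}"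
        proof (clarify)
          fix s assume "s \<le> t + n"
          then show "x s = y s"
            using x by (cases "s \<le> t") (auto simp: y_def dest!: spec[of _ "s - t"])
        qed
      next
        fix x assume "x \<in> {x. \<forall>s\<le>t + n. x s = y s}"
        then have x: "\<And>s. s \<le> t + n \<Longrightarrow> x s = y s" by blast
        show "x \<in> ?C \<inter> {x. ?sh x \<in> ?D}"
          using x y by (auto simp: y_def)
      qed
      then have "emeasure M ?D = ennreal (pmf \<nu> (y 0) * (\<Prod>s<t + n. pmf (K (y s)) (y (Suc s))))"
        by (simp add: eM cylinder_in_sets emeasure_chain_law)
      also have "(\<Prod>s<t + n. pmf (K (y s)) (y (Suc s))) =
          (\<Prod>s<t. pmf (K (y s)) (y (Suc s))) * (\<Prod>s<n. pmf (K (y (t + s))) (y (Suc (t + s))))"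
        by (induction n) (simp_all add: mult.assoc)
      also have "\<dots> = (\<Prod>s<t. pmf (K (z s)) (z (Suc s))) * (\<Prod>s<n. pmf (K (w s)) (w (Suc s)))"
        using y by (intro arg_cong2[where f="(*)"] prod.cong) (simp_all add: y_def flip: add_Suc_right)
      finally show ?thesis
        using True by (simp add: N_def emeasure_chain_law prod_nonneg ennreal_mult y_def mult.assoc)
    next
      case False
      then have "?C \<inter> {x. ?sh x \<in> ?D} = {}" by fastforce
      then have "emeasure M ?D = 0" by (simp only: eM cylinder_in_sets emeasure_empty)
      moreover have "emeasure N ?D = 0"
        using False by (simp add: N_def emeasure_chain_law)
      ultimately show ?thesis by simp
    qed
  qed
  then show ?thesis using eM[OF B] by (simp add: N_def)
qed

text \<open>By the first condition on \<open>E\<close>, the event is decided by the coordinates up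
  to \<open>t\<close>; it is therefore a countable disjoint union of cylinders, all ending in
  \<open>a\<close>.\<close>

lemma chain_law_Markov:
  fixes \<nu> :: "'z::countable pmf"
  assumes B: "B \<in> sets path_space"
    and E: "\<And>x y. (\<And>s. s \<le> t \<Longrightarrow> x s = y s) \<Longrightarrow> x \<in> E \<Longrightarrow> y \<in> E"
    and a: "\<And>x. x \<in> E \<Longrightarrow> x t = a"
  shows "emeasure (chain_law \<nu> K) (E \<inter> {x. (\<lambda>s. x (t + s)) \<in> B}) =
    emeasure (chain_law \<nu> K) E * emeasure (chain_law (return_pmf a) K) B"
proof -
  let ?L = "chain_law \<nu> K"
  \<comment> \<open>Values of \<open>w ! s\<close> beyond the length are unspecified, which is
    harmless because \<open>E\<close> looks only at times up to \<open>t\<close>.\<close>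
  define W where "W = {w :: 'z list. length w = Suc t \<and> (\<lambda>s. w ! s) \<in> E}"
  define C where "C w = {x :: nat \<Rightarrow> 'z. \<forall>s\<le>t. x s = w ! s}" for w
  let ?D = "{x. (\<lambda>s. x (t + s)) \<in> B}"
  have EC: "E = (\<Union>w\<in>W. C w)"
  proof (intro set_eqI iffI)
    fix x assume x: "x \<in> E"
    let ?w = "map x [0..<Suc t]"
    have w: "?w ! s = x s" if "s \<le> t" for s using that by (simp del: upt_Suc)
    have "(\<lambda>s. ?w ! s) \<in> E" by (rule E[OF _ x]) (rule w[symmetric])
    then show "x \<in> (\<Union>w\<in>W. C w)"
      using w by (intro UN_I[of ?w]) (simp_all add: W_def C_def del: upt_Suc)
  next
    fix x assume "x \<in> (\<Union>w\<in>W. C w)"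
    then obtain w where "(\<lambda>s. w ! s) \<in> E" "\<And>s. s \<le> t \<Longrightarrow> w ! s = x s"
      by (auto simp: W_def C_def)
    then show "x \<in> E" using E by blast
  qed
  have disj: "disjoint_family_on C W"
  proof (clarsimp simp: disjoint_family_on_def)
    fix v w assume "v \<in> W" "w \<in> W" "v \<noteq> w"
    then have "\<exists>s\<le>t. v ! s \<noteq> w ! s" by (auto simp: W_def list_eq_iff_nth_eq less_Suc_eq_le)
    then show "C v \<inter> C w = {}" by (auto simp: C_def)
  qed
  have D: "?D \<in> sets ?L"
  proof -
    have "(\<lambda>x :: nat \<Rightarrow> 'z. \<lambda>s. x (t + s)) \<in> measurable ?L path_space"
      unfolding measurable_chain_law_dom by (rule measurable_path_spaceI) measurable
    from measurable_sets[OF this B] show ?thesis by (simp add: vimage_def)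
  qed
  have Cs: "C w \<in> sets ?L" for w
    by (simp add: C_def prob_space_chain_law cylinder_in_sets)
  have "E \<inter> ?D = (\<Union>w\<in>W. C w \<inter> ?D)" by (auto simp: EC)
  then have "emeasure ?L (E \<inter> ?D) = (\<integral>\<^sup>+w. emeasure ?L (C w \<inter> ?D) \<partial>count_space W)"
    using D Cs disj by (simp only:) (intro emeasure_UN_countable, auto simp: disjoint_family_on_def, blast)
  also have "\<dots> = (\<integral>\<^sup>+w. emeasure ?L (C w) * emeasure (chain_law (return_pmf a) K) B \<partial>count_space W)"
  proof (intro nn_integral_cong)
    fix w assume "w \<in> space (count_space W)"
    then have "w ! t = a" using a by (auto simp: W_def)
    then show "emeasure ?L (C w \<inter> ?D) = emeasure ?L (C w) * emeasure (chain_law (return_pmf a) K) B"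
      unfolding C_def using chain_law_Markov_cylinder[OF B, of \<nu> K t "\<lambda>s. w ! s"] by simp
  qed
  also have "\<dots> = (\<integral>\<^sup>+w. emeasure ?L (C w) \<partial>count_space W) * emeasure (chain_law (return_pmf a) K) B"
    by (rule nn_integral_multc) simp
  also have "(\<integral>\<^sup>+w. emeasure ?L (C w) \<partial>count_space W) = emeasure ?L E"
    unfolding EC using Cs disj by (intro emeasure_UN_countable[symmetric]) auto
  finally show ?thesis .
qed

text \<open>Used for the translation of levels, which exchanges a walk started at level
  \<open>m\<close> for a walk started at level \<open>0\<close> in the shifted environment.\<close>

lemma distr_chain_law_bij:
  fixes \<nu> :: "'z::countable pmf"
    and \<phi> :: "'z \<Rightarrow> 'z"
  assumes "bij \<phi>" and K': "\<And>z z'. pmf (K' (\<phi> z)) (\<phi> z') = pmf (K z) z'"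
  shows "distr (chain_law \<nu> K) path_space (\<lambda>x t. \<phi> (x t)) = chain_law (map_pmf \<phi> \<nu>) K'"
proof (rule path_measure_eqI)
  have m: "(\<lambda>x t. \<phi> (x t)) \<in> measurable (chain_law \<nu> K) path_space"
    unfolding measurable_chain_law_dom by (rule measurable_path_spaceI) measurable
  show "finite_measure (distr (chain_law \<nu> K) path_space (\<lambda>x t. \<phi> (x t)))"
    using prob_space.prob_space_distr[OF prob_space_chain_law(1) m] by (rule prob_space.finite_measure)
  fix n :: nat and z :: "nat \<Rightarrow> 'z"
  define w where "w t = inv \<phi> (z t)" for t
  have z: "z = (\<lambda>t. \<phi> (w t))"
    using assms(1) by (auto simp: w_def bij_is_surj surj_f_inv_f)
  have inj: "inj \<phi>" using assms(1) by (rule bij_is_inj)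
  have "emeasure (distr (chain_law \<nu> K) path_space (\<lambda>x t. \<phi> (x t))) {x. \<forall>t\<le>n. x t = z t} =
      emeasure (chain_law \<nu> K) {x. \<forall>t\<le>n. x t = w t}"
    using m inj by (subst emeasure_distr) (auto simp: cylinder_in_sets z vimage_def inj_eq)
  also have "\<dots> = emeasure (chain_law (map_pmf \<phi> \<nu>) K') {x. \<forall>t\<le>n. x t = z t}"
    using inj by (simp add: emeasure_chain_law z K' pmf_map_inj')
  finally show "emeasure (distr (chain_law \<nu> K) path_space (\<lambda>x t. \<phi> (x t))) {x. \<forall>t\<le>n. x t = z t} =
      emeasure (chain_law (map_pmf \<phi> \<nu>) K') {x. \<forall>t\<le>n. x t = z t}" .
qed (simp_all add: prob_space_chain_law)

section \<open>The walk and its hitting times\<close>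

text \<open>A path with a forbidden start or step lies in one of countably many cylinders whose
  probability has a zero factor.\<close>

lemma AE_chain_law_step:
  fixes \<nu> :: "'z::countable pmf"
  shows "AE x in chain_law \<nu> K. x 0 \<in> set_pmf \<nu> \<and> (\<forall>t. x (Suc t) \<in> set_pmf (K (x t)))"
proof -
  let ?L = "chain_law \<nu> K"
  define W where "W t = {w :: 'z list. length w = Suc (Suc t) \<and> (w ! 0 \<notin> set_pmf \<nu> \<or> w ! Suc t \<notin> set_pmf (K (w ! t)))}" for t
  define C where "C t w = {x :: nat \<Rightarrow> 'z. \<forall>s\<le>Suc t. x s = w ! s}" for t w
  have "C t w \<in> null_sets ?L" if "w \<in> W t" for t w
  proof (rule null_setsI)
    have z: "pmf \<nu> (w ! 0) * (\<Prod>s<Suc t. pmf (K (w ! s)) (w ! Suc s)) = 0"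
      using that by (auto simp: W_def set_pmf_eq)
    show "emeasure ?L (C t w) = 0"
      unfolding C_def emeasure_chain_law by (simp only: z ennreal_0)
  qed (simp add: C_def prob_space_chain_law cylinder_in_sets)
  then have null: "(\<Union>w\<in>W t. C t w) \<in> null_sets ?L" for t
    by (intro null_sets_UN') auto
  have "AE x in ?L. x 0 \<in> set_pmf \<nu> \<and> x (Suc t) \<in> set_pmf (K (x t))" for t
  proof (rule AE_mp[OF AE_not_in[OF null[of t]]], rule AE_I2, rule impI, rule ccontr)
    fix x assume x: "x \<notin> (\<Union>w\<in>W t. C t w)" "\<not> (x 0 \<in> set_pmf \<nu> \<and> x (Suc t) \<in> set_pmf (K (x t)))"
    let ?w = "map x [0..<Suc (Suc t)]"
    have w: "?w ! s = x s" if "s \<le> Suc t" for s using that by (simp del: upt_Suc)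
    have "?w \<in> W t" using x(2) w[of 0] w[of t] w[of "Suc t"] by (auto simp: W_def simp del: upt_Suc)
    moreover have "x \<in> C t ?w" unfolding C_def using w by auto
    ultimately show False using x(1) by blast
  qed
  then have "AE x in ?L. \<forall>t. x 0 \<in> set_pmf \<nu> \<and> x (Suc t) \<in> set_pmf (K (x t))"
    by (simp add: AE_all_countable)
  then show ?thesis by (rule AE_mp) (auto intro!: AE_I2)
qed

section \<open>Shifts, first visits and restarted paths\<close>

lemma env_shift_apply: "env_shift n \<omega> k = \<omega> (k + n)"
  by (simp add: env_shift_def)

lemma env_shift_0 [simp]: "env_shift 0 \<omega> = \<omega>"
  and env_shift_env_shift [simp]: "env_shift m (env_shift n \<omega>) = env_shift (m + n) \<omega>"
  by (simp_all add: fun_eq_iff env_shift_apply ac_simps)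

definition hits :: "int \<Rightarrow> (nat \<Rightarrow> int \<times> 'd) \<Rightarrow> bool" where
  "hits m x \<longleftrightarrow> (\<exists>t. fst (x t) = m)"

text \<open>Unspecified off \<open>hits m\<close>. Separating existence from the value lets hitting
  times be added in \<open>nat\<close>; \<open>hit_time_eq\<close> links both to
  \<open>hit_time\<close>.\<close>

definition first_hit :: "int \<Rightarrow> (nat \<Rightarrow> int \<times> 'd) \<Rightarrow> nat" where
  "first_hit m x = (LEAST t. fst (x t) = m)"

text \<open>Subtracting the level makes the continuation a walk from level \<open>0\<close> again,
  now in the environment \<open>env_shift m\<close>; restarting becomes a self-map of path
  space.\<close>

definition recenter :: "nat \<Rightarrow> int \<Rightarrow> (nat \<Rightarrow> int \<times> 'd) \<Rightarrow> (nat \<Rightarrow> int \<times> 'd)" where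
  "recenter t m x = (\<lambda>s. (fst (x (t + s)) - m, snd (x (t + s))))"

definition after_hit :: "int \<Rightarrow> (nat \<Rightarrow> int \<times> 'd) \<Rightarrow> (nat \<Rightarrow> int \<times> 'd)" where
  "after_hit m x = recenter (first_hit m x) m x"

lemma hit_time_eq: "hit_time m x = (if hits m x then enat (first_hit m x) else \<infinity>)"
proof (cases "hits m x")
  case True
  then have ne: "enat ` {t. fst (x t) = m} \<noteq> {}" by (auto simp: hits_def)
  have "hit_time m x = enat (first_hit m x)"
    unfolding hit_time_def first_hit_def
  proof (rule cInf_eq_minimum)
    show "enat (LEAST t. fst (x t) = m) \<in> enat ` {t. fst (x t) = m}"
      using True by (auto simp: hits_def intro: LeastI)
  qed (auto intro: Least_le)
  then show ?thesis using True by simp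
next
  case False
  then have "{t. fst (x t) = m} = {}" by (auto simp: hits_def)
  then show ?thesis using False by (simp add: hit_time_def Inf_enat_def)
qed

lemma first_hit_fst: "hits m x \<Longrightarrow> fst (x (first_hit m x)) = m"
  unfolding hits_def first_hit_def by (auto intro: LeastI)

lemma first_hit_least: "fst (x t) = m \<Longrightarrow> first_hit m x \<le> t"
  unfolding first_hit_def by (rule Least_le)

lemma first_hit_eqI: "fst (x t) = m \<Longrightarrow> (\<And>s. s < t \<Longrightarrow> fst (x s) \<noteq> m) \<Longrightarrow> first_hit m x = t"
  unfolding first_hit_def by (rule Least_equality) (auto simp: not_less[symmetric])

lemma measurable_hits [measurable]:
  "Measurable.pred path_space (hits m :: (nat \<Rightarrow> int \<times> 'd::countable) \<Rightarrow> bool)"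
  unfolding hits_def[abs_def] by measurable

lemma measurable_first_hit [measurable]:
  "(first_hit m :: (nat \<Rightarrow> int \<times> 'd::countable) \<Rightarrow> nat) \<in> measurable path_space (count_space UNIV)"
  unfolding first_hit_def[abs_def] by measurable

lemma measurable_recenter [measurable]:
  "(recenter t m :: (nat \<Rightarrow> int \<times> 'd::countable) \<Rightarrow> _) \<in> measurable path_space path_space"
proof (rule measurable_path_spaceI)
  fix s
  have "(\<lambda>x :: nat \<Rightarrow> int \<times> 'd. (\<lambda>z. (fst z - m, snd z)) (x (t + s))) \<in> measurable path_space (count_space UNIV)"
    by (rule measurable_compose[OF measurable_coordinate]) simp
  then show "(\<lambda>x :: nat \<Rightarrow> int \<times> 'd. recenter t m x s) \<in> measurable path_space (count_space UNIV)"
    by (simp add: recenter_def)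
qed

lemma measurable_after_hit [measurable]:
  "(after_hit m :: (nat \<Rightarrow> int \<times> 'd::countable) \<Rightarrow> _) \<in> measurable path_space path_space"
proof (rule measurable_path_spaceI)
  fix t
  have "(\<lambda>x :: nat \<Rightarrow> int \<times> 'd. x (first_hit m x + t)) \<in> measurable path_space (count_space UNIV)"
    by (rule measurable_compose_countable[where f="\<lambda>k x. x (k + t)"]) measurable
  then have "(\<lambda>x :: nat \<Rightarrow> int \<times> 'd. (\<lambda>z. (fst z - m, snd z)) (x (first_hit m x + t))) \<in> measurable path_space (count_space UNIV)"
    by (rule measurable_compose) simp
  then show "(\<lambda>x :: nat \<Rightarrow> int \<times> 'd. after_hit m x t) \<in> measurable path_space (count_space UNIV)"
    by (simp add: after_hit_def recenter_def)
qed

lemma measurable_hit_position [measurable]: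
  "(\<lambda>x :: nat \<Rightarrow> int \<times> 'd::countable. x (first_hit m x)) \<in> measurable path_space (count_space UNIV)"
  by (rule measurable_compose_countable[where f="\<lambda>k x. x k"]) measurable

lemma borel_measurable_matrix_entry [measurable (raw)]:
  fixes f :: "'a \<Rightarrow> real^'d::finite^'d"
  assumes [measurable]: "f \<in> borel_measurable M"
  shows "(\<lambda>x. f x $ i $ j) \<in> borel_measurable M"
proof -
  have "(\<lambda>A::real^'d^'d. A $ i $ j) \<in> borel_measurable borel"
    by (intro borel_measurable_continuous_onI continuous_intros)
  then show ?thesis by measurable
qed

section \<open>The walk in a stationary environment\<close>

locale strip_walk = prob_space P for P :: "(int \<Rightarrow> 's) measure" +
  fixes S :: "'s measure" and p q r :: "'s \<Rightarrow> real^'d::finite^'d"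
  assumes sets_P: "sets P = sets (env_space S)"
    and p_meas [measurable]: "p \<in> borel_measurable S"
    and q_meas [measurable]: "q \<in> borel_measurable S"
    and r_meas [measurable]: "r \<in> borel_measurable S"
    and nonneg: "\<And>s. s \<in> space S \<Longrightarrow> nonneg_matrix (p s) \<and> nonneg_matrix (q s) \<and> nonneg_matrix (r s)"
    and stoch: "\<And>s. s \<in> space S \<Longrightarrow> stochastic_matrix (p s + q s + r s)"
    and stationary: "distr P P (env_shift 1) = P"
    and ergodic: "ergodic_env P"
begin

lemma env_coordinate [measurable]: "(\<lambda>\<omega>. \<omega> n) \<in> measurable P S"
  unfolding measurable_cong_sets[OF sets_P refl] env_space_def by measurable

lemma env_mem: "\<omega> \<in> space P \<Longrightarrow> \<omega> n \<in> space S"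
  using measurable_space[OF env_coordinate] by blast

lemma space_P: "space P = UNIV \<rightarrow> space S"
  using sets_eq_imp_space_eq[OF sets_P] by (simp add: env_space_def space_PiM PiE_UNIV_domain)

lemma env_shift_space [simp]: "env_shift n \<omega> \<in> space P \<longleftrightarrow> \<omega> \<in> space P"
proof
  assume "env_shift n \<omega> \<in> space P"
  then have "env_shift n \<omega> (k - n) \<in> space S" for k by (rule env_mem)
  then have "\<omega> k \<in> space S" for k by (simp add: env_shift_apply)
  then show "\<omega> \<in> space P" by (auto simp: space_P)
qed (auto simp: space_P env_shift_apply)

lemma measurable_env_shift [measurable]: "env_shift n \<in> measurable P P"
proof -
  have "(\<lambda>\<omega>. \<lambda>k\<in>UNIV. env_shift n \<omega> k) \<in> measurable P (env_space S)"
    unfolding env_space_def by (rule measurable_restrict) (simp add: env_shift_apply)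
  then show ?thesis
    by (simp add: measurable_cong_sets[OF refl sets_P] restrict_UNIV env_shift_def[abs_def])
qed

text \<open>Stationarity is assumed for the forward shift. Writing \<open>P\<close> as its own image
  under the opposite forward shift makes a backward shift cancel.\<close>

lemma distr_env_shift: "distr P P (env_shift n) = P"
proof -
  have pos: "distr P P (env_shift (int k)) = P" for k
  proof (induction k)
    case 0
    have "env_shift 0 = (\<lambda>\<omega>. \<omega> :: int \<Rightarrow> 's)" by (simp add: fun_eq_iff)
    then show ?case by (simp add: distr_id)
  next
    case (Suc k)
    have "env_shift (int (Suc k)) = env_shift 1 \<circ> (env_shift (int k) :: _ \<Rightarrow> int \<Rightarrow> 's)"
      by (simp add: fun_eq_iff)
    then have "distr P P (env_shift (int (Suc k))) = distr (distr P P (env_shift (int k))) P (env_shift 1)"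
      by (simp only: distr_distr[OF measurable_env_shift measurable_env_shift])
    then show ?case by (simp only: Suc stationary)
  qed
  show ?thesis
  proof (cases "n \<ge> 0")
    case True
    then show ?thesis using pos[of "nat n"] by simp
  next
    case False
    have "distr P P (env_shift n) = distr (distr P P (env_shift (- n))) P (env_shift n)"
      using pos[of "nat (- n)"] False by simp
    also have "\<dots> = distr P P (env_shift n \<circ> env_shift (- n))"
      by (rule distr_distr) measurable
    also have "env_shift n \<circ> env_shift (- n) = (env_shift 0 :: _ \<Rightarrow> int \<Rightarrow> 's)"
      by (simp add: fun_eq_iff)
    also have "distr P P (env_shift 0) = P" using pos[of 0] by simp
    finally show ?thesis .
  qed
qed

lemma AE_env_shift: "AE \<omega> in P. Q \<omega> \<Longrightarrow> AE \<omega> in P. Q (env_shift n \<omega>)"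
  using AE_distrD[OF measurable_env_shift, of Q n] by (simp only: distr_env_shift)

lemma nn_integral_env_shift:
  "f \<in> borel_measurable P \<Longrightarrow> (\<integral>\<^sup>+\<omega>. f (env_shift n \<omega>) \<partial>P) = (\<integral>\<^sup>+\<omega>. f \<omega> \<partial>P)"
  using nn_integral_distr[OF measurable_env_shift, of f n] by (simp only: distr_env_shift)

lemma integral_env_shift:
  "f \<in> borel_measurable P \<Longrightarrow> (\<integral>\<omega>. (f (env_shift n \<omega>) :: real) \<partial>P) = (\<integral>\<omega>. f \<omega> \<partial>P)"
  using integral_distr[OF measurable_env_shift, of f n] by (simp only: distr_env_shift)

lemma pmf_step:
  "\<omega> \<in> space P \<Longrightarrow> pmf (walk_step p q r \<omega> z) z' = jump_prob p q r \<omega> z z'"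
  using nonneg[OF env_mem] stoch[OF env_mem] by (cases z) (simp add: pmf_walk_step)

lemma measurable_quenched_law:
  assumes \<mu>: "\<And>j. (\<lambda>\<omega>. pmf (\<mu> \<omega>) j) \<in> borel_measurable P"
  shows "(\<lambda>\<omega>. quenched_law p q r \<omega> (\<mu> \<omega>)) \<in> measurable P (prob_algebra path_space)"
  unfolding quenched_law_def
proof (rule measurable_chain_law)
  fix z z' :: "int \<times> 'd"
  have "(\<lambda>\<omega>. jump_prob p q r \<omega> z z') \<in> borel_measurable P"
    by (cases z, cases z') (simp add: jump_prob_def)
  then show "(\<lambda>\<omega>. pmf (walk_step p q r \<omega> z) z') \<in> borel_measurable P"
    by (rule measurable_cong[THEN iffD1, rotated]) (simp add: pmf_step)
  show "(\<lambda>\<omega>. pmf (map_pmf (Pair (0::int)) (\<mu> \<omega>)) z) \<in> borel_measurable P"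
  proof (cases "fst z = 0")
    case True
    then have "pmf (map_pmf (Pair (0::int)) (\<mu> \<omega>)) z = pmf (\<mu> \<omega>) (snd z)" for \<omega>
      using pmf_map_inj'[of "Pair (0::int)" "\<mu> \<omega>" "snd z"] by (cases z) (auto simp: inj_def)
    then show ?thesis using \<mu> by simp
  next
    case False
    then have "pmf (map_pmf (Pair (0::int)) (\<mu> \<omega>)) z = 0" for \<omega>
      by (intro pmf_map_outside) auto
    then show ?thesis by simp
  qed
qed

definition walk_law :: "(int \<Rightarrow> 's) \<Rightarrow> 'd \<Rightarrow> (nat \<Rightarrow> int \<times> 'd) measure" where
  "walk_law \<omega> i = quenched_law p q r \<omega> (return_pmf i)"

lemma walk_law_eq: "walk_law \<omega> i = chain_law (return_pmf (0, i)) (walk_step p q r \<omega>)"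
  by (simp add: walk_law_def quenched_law_def)

lemma sets_quenched_law [simp, measurable_cong]: "sets (quenched_law p q r \<omega> \<nu>) = sets path_space"
  by (simp add: quenched_law_def prob_space_chain_law)

lemma sets_walk_law [simp, measurable_cong]: "sets (walk_law \<omega> i) = sets path_space"
  by (simp add: walk_law_def)

lemma space_quenched_law [simp]: "space (quenched_law p q r \<omega> \<nu>) = UNIV"
  by (simp add: quenched_law_def)

lemma space_walk_law [simp]: "space (walk_law \<omega> i) = UNIV"
  by (simp add: walk_law_eq)

lemma prob_space_quenched_law: "prob_space (quenched_law p q r \<omega> \<nu>)"
  by (simp add: quenched_law_def prob_space_chain_law)

lemma prob_space_walk_law: "prob_space (walk_law \<omega> i)"
  by (simp add: walk_law_eq prob_space_chain_law)

sublocale walk: prob_space "walk_law \<omega> i" for \<omega> i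
  by (rule prob_space_walk_law)

lemma measurable_walk_law_measure [measurable]:
  "B \<in> sets path_space \<Longrightarrow> (\<lambda>\<omega>. measure (walk_law \<omega> i) B) \<in> borel_measurable P"
  unfolding walk_law_def
  by (rule measurable_compose[OF measurable_prob_algebraD[OF measurable_quenched_law] measurable_measure_subprob_algebra])
    simp_all

text \<open>Jump probabilities depend only on the environment at the current level and on the
  increment, so the translation \<open>\<phi>\<close> carries the chain restarted at level
  \<open>m\<close> into the walk in the shifted environment.\<close>

lemma walk_law_Markov:
  assumes \<omega>: "\<omega> \<in> space P" and B: "B \<in> sets path_space"
    and E: "\<And>x y. (\<And>s. s \<le> t \<Longrightarrow> x s = y s) \<Longrightarrow> x \<in> E \<Longrightarrow> y \<in> E"
    and a: "\<And>x. x \<in> E \<Longrightarrow> x t = (m, j)"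
  shows "emeasure (walk_law \<omega> i) (E \<inter> {x. recenter t m x \<in> B}) =
    emeasure (walk_law \<omega> i) E * emeasure (walk_law (env_shift m \<omega>) j) B"
proof -
  define \<phi> :: "int \<times> 'd \<Rightarrow> int \<times> 'd" where "\<phi> = (\<lambda>z. (fst z - m, snd z))"
  have bij: "bij \<phi>"
    by (rule o_bij[where g="\<lambda>z. (fst z + m, snd z)"]) (auto simp: \<phi>_def fun_eq_iff)
  have "pmf (walk_step p q r (env_shift m \<omega>) (\<phi> z)) (\<phi> z') = pmf (walk_step p q r \<omega> z) z'" for z z'
    using \<omega> by (cases z, cases z') (simp add: pmf_step \<phi>_def jump_prob_def env_shift_apply)
  from distr_chain_law_bij[of \<phi> "walk_step p q r (env_shift m \<omega>)" "walk_step p q r \<omega>" "return_pmf (m, j)", OF bij this]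
  have d: "distr (chain_law (return_pmf (m, j)) (walk_step p q r \<omega>)) path_space (\<lambda>x t. \<phi> (x t)) =
      walk_law (env_shift m \<omega>) j"
    by (simp add: walk_law_eq \<phi>_def)
  define B' where "B' = {x. (\<lambda>t. \<phi> (x t)) \<in> B}"
  have meas: "(\<lambda>x t. \<phi> (x t)) \<in> measurable path_space path_space"
    by (rule measurable_path_spaceI) measurable
  have B': "B' \<in> sets path_space"
    using measurable_sets[OF meas B] by (simp add: B'_def vimage_def)
  have "emeasure (walk_law (env_shift m \<omega>) j) B =
      emeasure (chain_law (return_pmf (m, j)) (walk_step p q r \<omega>)) B'"
    unfolding d[symmetric] using meas B
    by (subst emeasure_distr) (auto simp: B'_def vimage_def measurable_chain_law_dom)
  moreover have "{x. recenter t m x \<in> B} = {x. (\<lambda>s. x (t + s)) \<in> B'}"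
    by (simp add: B'_def recenter_def \<phi>_def)
  moreover have "emeasure (walk_law \<omega> i) (E \<inter> {x. (\<lambda>s. x (t + s)) \<in> B'}) = emeasure (walk_law \<omega> i) E *
      emeasure (chain_law (return_pmf (m, j)) (walk_step p q r \<omega>)) B'"
    unfolding walk_law_eq[of \<omega>]
  proof (rule chain_law_Markov[OF B'])
    fix x y assume "\<And>s. s \<le> t \<Longrightarrow> x s = y s" "x \<in> E"
    then show "y \<in> E" by (rule E)
  qed (rule a)
  ultimately show ?thesis by simp
qed

text \<open>The condition \<open>E\<close> makes \<open>C\<close> decided by the path up to the
  first visit of \<open>m\<close>. Splitting by the value \<open>t\<close> of that time leaves
  events to which the Markov property at a fixed time applies.\<close>

lemma walk_law_strong_Markov:
  assumes \<omega>: "\<omega> \<in> space P" and B: "B \<in> sets path_space" and C: "C \<in> sets path_space"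
    and E: "\<And>x y. hits m x \<Longrightarrow> (\<And>s. s \<le> first_hit m x \<Longrightarrow> x s = y s) \<Longrightarrow> x \<in> C \<Longrightarrow> y \<in> C"
  shows "measure (walk_law \<omega> i) {x \<in> C. hits m x \<and> snd (x (first_hit m x)) = j \<and> after_hit m x \<in> B} =
    measure (walk_law \<omega> i) {x \<in> C. hits m x \<and> snd (x (first_hit m x)) = j} *
    measure (walk_law (env_shift m \<omega>) j) B"
proof -
  define D where "D t = {x \<in> C. hits m x \<and> snd (x (first_hit m x)) = j \<and> first_hit m x = t}" for t
  note [measurable] = B C
  have [measurable]: "D t \<in> sets path_space" for t
  proof -
    have "{x \<in> space path_space. x \<in> C \<and> hits m x \<and> snd (x (first_hit m x)) = j \<and> first_hit m x = t} \<in> sets path_space"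
      by measurable
    then show ?thesis by (simp add: D_def)
  qed
  have [measurable]: "{x. recenter t m x \<in> B} \<in> sets path_space" for t
  proof -
    from measurable_sets[OF measurable_recenter B] show ?thesis by (simp add: vimage_def)
  qed
  have M: "emeasure (walk_law \<omega> i) (D t \<inter> {x. recenter t m x \<in> B}) =
      emeasure (walk_law \<omega> i) (D t) * emeasure (walk_law (env_shift m \<omega>) j) B" for t
  proof (rule walk_law_Markov[OF \<omega> B])
    fix x y :: "nat \<Rightarrow> int \<times> 'd"
    assume eq: "\<And>s. s \<le> t \<Longrightarrow> x s = y s" and x: "x \<in> D t"
    have xt: "fst (x t) = m" "\<And>s. s < t \<Longrightarrow> fst (x s) \<noteq> m"
      using x first_hit_fst[of m x] first_hit_least[of x _ m] by (auto simp: D_def not_le[symmetric])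
    have "first_hit m y = t"
    proof (rule first_hit_eqI)
      show "fst (y t) = m" using xt(1) eq[of t] by simp
      show "fst (y s) \<noteq> m" if "s < t" for s
        using xt(2)[OF that] eq[of s] that by simp
    qed
    moreover have "hits m y" using xt(1) eq[of t] by (auto simp: hits_def intro: exI[of _ t])
    moreover have "y \<in> C"
      by (rule E[of x]) (use x eq in \<open>simp_all add: D_def\<close>)
    moreover have "snd (y t) = j" using x eq[of t] by (auto simp: D_def)
    ultimately show "y \<in> D t" by (simp add: D_def)
  next
    fix x assume "x \<in> D t"
    then show "x t = (m, j)" using first_hit_fst[of m x] by (auto simp: D_def prod_eq_iff)
  qed
  have d1: "disjoint_family (\<lambda>t. D t \<inter> {x. recenter t m x \<in> B})"
    and d2: "disjoint_family D"
    by (auto simp: disjoint_family_on_def D_def)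
  have "{x \<in> C. hits m x \<and> snd (x (first_hit m x)) = j \<and> after_hit m x \<in> B} =
      (\<Union>t. D t \<inter> {x. recenter t m x \<in> B})"
    by (auto simp: D_def after_hit_def)
  then have "emeasure (walk_law \<omega> i) {x \<in> C. hits m x \<and> snd (x (first_hit m x)) = j \<and> after_hit m x \<in> B} =
      (\<Sum>t. emeasure (walk_law \<omega> i) (D t \<inter> {x. recenter t m x \<in> B}))"
    using d1 by (simp add: suminf_emeasure image_subset_iff)
  also have "\<dots> = (\<Sum>t. emeasure (walk_law \<omega> i) (D t)) * emeasure (walk_law (env_shift m \<omega>) j) B"
    by (simp add: M ennreal_suminf_multc)
  also have "(\<Sum>t. emeasure (walk_law \<omega> i) (D t)) = emeasure (walk_law \<omega> i) (\<Union>t. D t)"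
    using d2 by (intro suminf_emeasure) auto
  also have "(\<Union>t. D t) = {x \<in> C. hits m x \<and> snd (x (first_hit m x)) = j}"
    by (auto simp: D_def)
  finally show ?thesis by (simp only: measure_def enn2real_mult)
qed

lemma AE_walk_law_path:
  assumes "\<omega> \<in> space P"
  shows "AE x in walk_law \<omega> i. x 0 = (0, i) \<and> (\<forall>t. \<bar>fst (x (Suc t)) - fst (x t)\<bar> \<le> 1)"
proof -
  have step: "\<bar>fst z' - fst z\<bar> \<le> 1" if "z' \<in> set_pmf (walk_step p q r \<omega> z)" for z z'
    using that pmf_step[OF assms, of z z']
    by (cases z, cases z') (auto simp: set_pmf_eq jump_prob_def split: if_splits)
  show ?thesis
    unfolding walk_law_eq
    by (rule AE_mp[OF AE_chain_law_step[of "return_pmf (0, i)" "walk_step p q r \<omega>"]]) (auto intro!: AE_I2 step)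
qed

lemma walk_law_first_step:
  assumes "\<omega> \<in> space P"
  shows "measure (walk_law \<omega> i) {x. x 1 = z} = jump_prob p q r \<omega> (0, i) z"
proof -
  have "emeasure (walk_law \<omega> i) {x. x 1 = z} =
      emeasure (walk_law \<omega> i) {x. \<forall>t\<le>1. x t = (if t = 0 then (0, i) else z)}"
  proof (rule emeasure_eq_AE)
    show "AE x in walk_law \<omega> i. (x \<in> {x. x 1 = z}) = (x \<in> {x. \<forall>t\<le>1. x t = (if t = 0 then (0, i) else z)})"
      using AE_walk_law_path[OF assms, of i] by eventually_elim (auto simp: le_Suc_eq)
    have "{x \<in> space path_space. x 1 = z} \<in> sets path_space" by measurable
    then show "{x. x 1 = z} \<in> sets (walk_law \<omega> i)" by simp
  qed (simp add: cylinder_in_sets)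
  also have "\<dots> = ennreal (jump_prob p q r \<omega> (0, i) z)"
    unfolding walk_law_eq by (subst emeasure_chain_law) (simp add: pmf_step[OF assms])
  finally show ?thesis
    using pmf_nonneg[of "walk_step p q r \<omega> (0, i)" z]
    by (simp add: measure_def pmf_step[OF assms])
qed

text \<open>The Markov property at time \<open>0\<close>. It reduces every initial law to the
  finitely many laws \<open>walk_law\<close>.\<close>

lemma emeasure_quenched_law:
  assumes B: "B \<in> sets path_space"
  shows "emeasure (quenched_law p q r \<omega> \<nu>) B = (\<Sum>i\<in>UNIV. ennreal (pmf \<nu> i) * emeasure (walk_law \<omega> i) B)"
proof -
  let ?L = "quenched_law p q r \<omega> \<nu>"
  note [measurable] = B
  have C: "{x :: nat \<Rightarrow> int \<times> 'd. x 0 = z} \<in> sets path_space" for z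
    using cylinder_in_sets[of 0 "\<lambda>_. z"] by simp
  have ini: "emeasure ?L ({x. x 0 = (0, i)} \<inter> B) = ennreal (pmf \<nu> i) * emeasure (walk_law \<omega> i) B" for i
  proof -
    have "emeasure ?L {x. x 0 = (0, i)} = ennreal (pmf (map_pmf (Pair (0::int)) \<nu>) (0, i))"
      using emeasure_chain_law[of "map_pmf (Pair 0) \<nu>" "walk_step p q r \<omega>" 0 "\<lambda>_. (0, i)"]
      by (simp add: quenched_law_def)
    also have "pmf (map_pmf (Pair (0::int)) \<nu>) (0, i) = pmf \<nu> i"
      using pmf_map_inj'[of "Pair (0::int)" \<nu> i] by (simp add: inj_def)
    finally have "emeasure ?L {x. x 0 = (0, i)} = ennreal (pmf \<nu> i)" .
    moreover have "emeasure ?L ({x. x 0 = (0, i)} \<inter> {x. (\<lambda>s. x (0 + s)) \<in> B}) =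
        emeasure ?L {x. x 0 = (0, i)} * emeasure (walk_law \<omega> i) B"
      unfolding quenched_law_def walk_law_eq by (rule chain_law_Markov[OF B]) auto
    ultimately show ?thesis by simp
  qed
  have "AE x in ?L. fst (x 0) = 0"
    unfolding quenched_law_def
    by (rule AE_mp[OF AE_chain_law_step[of "map_pmf (Pair 0) \<nu>" "walk_step p q r \<omega>"]]) (auto intro!: AE_I2)
  then have "AE x in ?L. (x \<in> B) = (x \<in> (\<Union>i. {x. x 0 = (0, i)} \<inter> B))"
    by eventually_elim (auto simp: prod_eq_iff)
  then have "emeasure ?L B = emeasure ?L (\<Union>i. {x. x 0 = (0, i)} \<inter> B)"
    using C B by (intro emeasure_eq_AE) auto
  also have "\<dots> = (\<Sum>i\<in>UNIV. emeasure ?L ({x. x 0 = (0, i)} \<inter> B))"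
    using C B by (intro sum_emeasure[symmetric]) (auto simp: disjoint_family_on_def)
  finally show ?thesis by (simp add: ini)
qed

end

section \<open>Nonnegative matrices and mean hitting times\<close>

lemma nonneg_matrix_mult:
  "nonneg_matrix A \<Longrightarrow> nonneg_matrix B \<Longrightarrow> nonneg_matrix (A ** B)"
  by (auto simp: nonneg_matrix_def matrix_matrix_mult_def intro!: sum_nonneg)

lemma nonneg_matrix_add: "nonneg_matrix A \<Longrightarrow> nonneg_matrix B \<Longrightarrow> nonneg_matrix (A + B)"
  by (auto simp: nonneg_matrix_def)

lemma nonneg_matrix_vec_mono:
  assumes "nonneg_matrix A" "\<And>i. u $ i \<le> v $ i"
  shows "(A *v u) $ i \<le> (A *v v) $ i"
  using assms by (auto simp: nonneg_matrix_def matrix_vector_mult_def intro!: sum_mono mult_left_mono)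

lemma nonneg_matrix_vec_nonneg:
  assumes "nonneg_matrix A" "\<And>i. 0 \<le> v $ i"
  shows "0 \<le> (A *v v) $ i"
  using assms by (auto simp: nonneg_matrix_def matrix_vector_mult_def intro!: sum_nonneg)

text \<open>Tests the quotient in \<open>max_opnorm\<close> at the all-ones vector, whose maximum
  norm is \<open>1\<close>.\<close>

lemma row_sum_le_max_opnorm: "(A *v 1) $ i \<le> max_opnorm (A :: real^'d::finite^'d)"
proof -
  obtain B where B: "\<And>x. norm (A *v x) \<le> norm x * B"
    using bounded_linear.bounded[OF matrix_vector_mul_bounded_linear[of A]] by blast
  \<comment> \<open>A real supremum bounds its members only over a bounded set; the bound comes from
    the Euclidean operator bound and the equivalence of norms.\<close>
  have "bdd_above (range (\<lambda>x. infnorm (A *v x) / infnorm x))"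
  proof (rule bdd_aboveI2)
    fix x :: "real^'d"
    have "infnorm (A *v x) \<le> norm (A *v x)" by (rule infnorm_le_norm)
    also have "\<dots> \<le> norm x * \<bar>B\<bar>" using B[of x] by (meson abs_ge_self mult_left_mono norm_ge_zero order_trans)
    also have "\<dots> \<le> (sqrt DIM(real^'d) * infnorm x) * \<bar>B\<bar>"
      by (intro mult_right_mono norm_le_infnorm) auto
    finally show "infnorm (A *v x) / infnorm x \<le> sqrt DIM(real^'d) * \<bar>B\<bar>"
      using infnorm_pos_le[of x] by (cases "infnorm x = 0") (auto simp: divide_simps mult_ac)
  qed
  then have "infnorm (A *v 1) / infnorm (1 :: real^'d) \<le> max_opnorm A"
    unfolding max_opnorm_def by (rule cSUP_upper[OF UNIV_I])
  moreover have "infnorm (1 :: real^'d) = 1"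
    by (simp add: infnorm_cart)
  moreover have "(A *v 1) $ i \<le> infnorm (A *v 1)"
    using component_le_infnorm_cart[of "A *v 1" i] by simp
  ultimately show ?thesis by simp
qed

text \<open>Minimum principle: look at an index where \<open>v\<close> is smallest.\<close>

lemma substochastic_min_principle:
  fixes M :: "real^'d::finite^'d"
  assumes M: "nonneg_matrix M" and c: "\<And>i. (M *v 1) $ i < 1"
    and v: "\<And>i. (M *v v) $ i \<le> v $ i"
  shows "0 \<le> v $ i"
proof (rule ccontr)
  assume neg: "\<not> 0 \<le> v $ i"
  obtain k where k: "\<And>j. v $ k \<le> v $ j"
    using ex_min_if_finite[of "range (\<lambda>j. v $ j)"] by (auto simp: not_less)
  have "v $ k < 0" using k[of i] neg by simp
  then have "v $ k * 1 < v $ k * (M *v 1) $ k"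
    using c[of k] by (intro mult_strict_left_mono_neg) auto
  also have "\<dots> = (\<Sum>j\<in>UNIV. M $ k $ j * v $ k)"
    by (simp add: matrix_vector_mult_def sum_distrib_left mult.commute)
  also have "\<dots> \<le> (M *v v) $ k"
    using M k by (auto simp: matrix_vector_mult_def nonneg_matrix_def intro!: sum_mono mult_left_mono)
  also have "\<dots> \<le> v $ k" by (rule v)
  finally show False by simp
qed

text \<open>The minimum principle for \<open>v\<close> and \<open>- v\<close> gives a trivial
  kernel; for the columns of the inverse it gives their nonnegativity.\<close>

lemma substochastic_resolvent:
  fixes M :: "real^'d::finite^'d"
  assumes M: "nonneg_matrix M" and c: "\<And>i. (M *v 1) $ i < 1"
  shows "(mat 1 - M) ** matrix_inv (mat 1 - M) = mat 1"
    and "nonneg_matrix (matrix_inv (mat 1 - M))"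
proof -
  have ker: "v = 0" if "(mat 1 - M) *v v = 0" for v
  proof -
    have "M *v v = v" using that by (simp add: matrix_vector_mult_diff_rdistrib)
    moreover have "M *v (- v) = - (M *v v)"
      by (simp add: vec_eq_iff matrix_vector_mult_def sum_negf)
    ultimately have "0 \<le> v $ i" "0 \<le> (- v) $ i" for i
      by (intro substochastic_min_principle[OF M c]; simp)+
    then show ?thesis by (simp add: vec_eq_iff order_antisym)
  qed
  then have "invertible (mat 1 - M)"
    by (metis invertible_left_inverse matrix_left_invertible_ker)
  then have "\<exists>B. (mat 1 - M) ** B = mat 1 \<and> B ** (mat 1 - M) = mat 1"
    by (simp add: invertible_def)
  from someI_ex[OF this] show inv: "(mat 1 - M) ** matrix_inv (mat 1 - M) = mat 1"
    unfolding matrix_inv_def by blast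
  have "0 \<le> matrix_inv (mat 1 - M) $ i $ j" for i j
  proof -
    let ?v = "matrix_inv (mat 1 - M) *v axis j 1"
    have "(mat 1 - M) *v ?v = axis j 1"
      by (simp add: matrix_vector_mul_assoc inv)
    then have eq: "?v - M *v ?v = axis j 1"
      by (simp add: matrix_vector_mult_diff_rdistrib)
    have "(M *v ?v) $ k \<le> ?v $ k" for k
    proof -
      have "?v $ k - (M *v ?v) $ k = axis j 1 $ k" by (simp only: eq flip: vector_minus_component)
      then show ?thesis by (simp add: axis_def split: if_splits)
    qed
    then have "0 \<le> ?v $ i" by (rule substochastic_min_principle[OF M c])
    then show ?thesis by (simp add: matrix_vector_mul_component inner_axis)
  qed
  then show "nonneg_matrix (matrix_inv (mat 1 - M))" by (simp add: nonneg_matrix_def)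
qed

section \<open>Measurability of matrix operations\<close>

lemma borel_measurable_matrix_mult [measurable]:
  fixes f g :: "'a \<Rightarrow> real^'d::finite^'d"
  assumes "f \<in> borel_measurable M" "g \<in> borel_measurable M"
  shows "(\<lambda>x. f x ** g x) \<in> borel_measurable M"
proof (rule borel_measurable_continuous_Pair[OF assms])
  show "continuous_on UNIV (\<lambda>x :: (real^'d^'d) \<times> (real^'d^'d). fst x ** snd x)"
    unfolding matrix_matrix_mult_def by (intro continuous_intros)
qed

text \<open>On the open set of nonzero determinant the inverse is continuous by Cramer's rule; on
  singular matrices the choice in \<open>matrix_inv\<close> is from the empty predicate, so the
  value is constant.\<close>

lemma borel_measurable_matrix_inv:
  "(matrix_inv :: real^'d::finite^'d \<Rightarrow> real^'d^'d) \<in> borel_measurable borel"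
proof -
  define cram :: "real^'d^'d \<Rightarrow> real^'d^'d" where
    "cram A = (\<chi> k l. det (\<chi> i j. if j = k then axis l 1 $ i else A $ i $ j) / det A)" for A
  have det: "continuous_on S (\<lambda>A. det (f A))" if "continuous_on S f" for f :: "real^'d^'d \<Rightarrow> real^'d^'d" and S
    unfolding det_def using that by (intro continuous_intros)
  have "matrix_inv A = (if A \<in> {A. det A \<noteq> 0} then cram A else (SOME B. False))" for A :: "real^'d^'d"
  proof (cases "det A = 0")
    case True
    then have "\<not> invertible A" by (simp add: invertible_det_nz)
    then have "(\<lambda>B. A ** B = mat 1 \<and> B ** A = mat 1) = (\<lambda>_. False)" by (auto simp: invertible_def)
    then have "matrix_inv A = (SOME B. False)" by (simp only: matrix_inv_def)
    then show ?thesis using True by simp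
  next
    case False
    then have "\<exists>B. A ** B = mat 1 \<and> B ** A = mat 1" using invertible_det_nz[of A] by (simp add: invertible_def)
    from someI_ex[OF this] have "A ** matrix_inv A = mat 1" unfolding matrix_inv_def by blast
    then have "A *v (matrix_inv A *v axis l 1) = axis l 1" for l
      by (simp add: matrix_vector_mul_assoc)
    then have "(matrix_inv A *v axis l 1) $ k = cram A $ k $ l" for k l
      using cramer[OF False, of "matrix_inv A *v axis l 1" "axis l 1"]
      by (simp add: cram_def)
    then have "matrix_inv A = cram A"
      by (simp add: vec_eq_iff matrix_vector_mul_component inner_axis)
    then show ?thesis using False by simp
  qed
  moreover have "(\<lambda>A. if A \<in> {A. det A \<noteq> 0} then cram A else (SOME B. False)) \<in> borel_measurable borel"
  proof (rule borel_measurable_continuous_on_if)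
    show "continuous_on {A. det A \<noteq> 0} cram"
      unfolding cram_def
    proof (intro continuous_on_vec_lambda continuous_on_divide det)
      fix k l i j
      show "continuous_on {A. det A \<noteq> 0} (\<lambda>A :: real^'d^'d. if j = k then axis l 1 $ i else A $ i $ j)"
        by (cases "j = k") (auto intro!: continuous_intros)
    qed (auto intro!: continuous_intros)
    have "open {A :: real^'d^'d. det A \<noteq> 0}"
      by (intro open_Collect_neq det continuous_intros)
    then show "{A :: real^'d^'d. det A \<noteq> 0} \<in> sets borel" by simp
  qed simp
  ultimately show ?thesis by presburger
qed

section \<open>Truncated mean hitting times\<close>

context strip_walk
begin

text \<open>The tail of the hitting time of \<open>m\<close>: the sum over all \<open>s\<close> is
  its mean, infinite if \<open>m\<close> is missed with positive probability, and the sum over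
  \<open>s < N\<close> is the mean of the time truncated at \<open>N\<close>.\<close>

definition avoid_prob :: "(int \<Rightarrow> 's) \<Rightarrow> int \<Rightarrow> 'd \<Rightarrow> nat \<Rightarrow> real" where
  "avoid_prob \<omega> m i s = measure (walk_law \<omega> i) {x. \<forall>t\<le>s. fst (x t) \<noteq> m}"

lemma avoid_event_sets [measurable]: "{x :: nat \<Rightarrow> int \<times> 'd. \<forall>t\<le>s. fst (x t) \<noteq> m} \<in> sets path_space"
proof -
  have "{x \<in> space path_space. \<forall>t\<le>s. fst (x t :: int \<times> 'd) \<noteq> m} \<in> sets path_space" by measurable
  then show ?thesis by simp
qed

lemma measurable_avoid_prob [measurable]: "(\<lambda>\<omega>. avoid_prob \<omega> m i s) \<in> borel_measurable P"
  unfolding avoid_prob_def by measurable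

lemma avoid_prob_0: "\<omega> \<in> space P \<Longrightarrow> avoid_prob \<omega> 0 i s = 0"
proof -
  assume "\<omega> \<in> space P"
  from AE_walk_law_path[OF this, of i] have "AE x in walk_law \<omega> i. x \<notin> {x. \<forall>t\<le>s. fst (x t) \<noteq> 0}"
    by eventually_elim auto
  then show ?thesis unfolding avoid_prob_def by (simp add: walk.prob_eq_0)
qed

lemma avoid_prob_time_0: "\<omega> \<in> space P \<Longrightarrow> m \<noteq> 0 \<Longrightarrow> avoid_prob \<omega> m i 0 = 1"
proof -
  assume *: "\<omega> \<in> space P" "m \<noteq> 0"
  from AE_walk_law_path[OF *(1), of i] have "AE x in walk_law \<omega> i. x \<in> {x. \<forall>t\<le>0. fst (x t) \<noteq> m}"
    by eventually_elim (use *(2) in auto)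
  then show ?thesis unfolding avoid_prob_def using avoid_event_sets[of 0 m] by (subst walk.prob_eq_1) auto
qed

text \<open>First-step analysis. As \<open>m \<noteq> 0\<close>, the start avoids \<open>m\<close>
  and only the path after the first step has to be checked.\<close>

lemma avoid_prob_Suc:
  assumes \<omega>: "\<omega> \<in> space P" and m: "m \<noteq> 0"
  shows "avoid_prob \<omega> m i (Suc s) =
    (\<Sum>(d, j)\<in>{-1, 0, 1} \<times> UNIV. jump_prob p q r \<omega> (0, i) (d, j) * avoid_prob (env_shift d \<omega>) (m - d) j s)"
proof -
  let ?A = "{-1, 0, 1} \<times> (UNIV :: 'd set)"
  define B where "B d = {x :: nat \<Rightarrow> int \<times> 'd. \<forall>t\<le>s. fst (x t) \<noteq> m - d}" for d
  define E where "E z = {x :: nat \<Rightarrow> int \<times> 'd. x 1 = z} \<inter> {x. recenter 1 (fst z) x \<in> B (fst z)}" for z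
  have B: "B d \<in> sets path_space" for d unfolding B_def by measurable
  have E: "E z \<in> sets path_space" for z
  proof -
    have "{x \<in> space path_space. x 1 = z} \<in> sets path_space" by measurable
    moreover have "{x \<in> space path_space. recenter 1 (fst z) x \<in> B (fst z)} \<in> sets path_space"
      using B by measurable
    ultimately show ?thesis by (simp add: E_def sets.Int)
  qed
  have "avoid_prob \<omega> m i (Suc s) = measure (walk_law \<omega> i) (\<Union>z\<in>?A. E z)"
    unfolding avoid_prob_def
  proof (rule measure_eq_AE)
    show "AE x in walk_law \<omega> i. (x \<in> {x. \<forall>t\<le>Suc s. fst (x t) \<noteq> m}) = (x \<in> (\<Union>z\<in>?A. E z))"
      using AE_walk_law_path[OF \<omega>, of i]
    proof eventually_elim
      case (elim x)
      have "\<bar>fst (x 1)\<bar> \<le> 1" using elim by (metis One_nat_def diff_zero fst_conv)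
      then have "x 1 \<in> ?A" by (cases "x 1") auto
      then have "x \<in> (\<Union>z\<in>?A. E z) \<longleftrightarrow> (\<forall>t\<le>s. fst (x (Suc t)) \<noteq> m)"
        by (auto simp: E_def B_def recenter_def)
      also have "\<dots> \<longleftrightarrow> (\<forall>t\<le>Suc s. fst (x t) \<noteq> m)"
        using elim m by (auto simp: le_Suc_eq all_conj_distrib)
           (metis Suc_le_mono not0_implies_Suc fst_conv le_Suc_eq)+
      finally show ?case by simp
    qed
    show "(\<Union>z\<in>?A. E z) \<in> sets (walk_law \<omega> i)" using E by (intro sets.finite_UN) auto
  qed simp
  also have "\<dots> = (\<Sum>z\<in>?A. measure (walk_law \<omega> i) (E z))"
    using E by (intro walk.finite_measure_finite_Union) (auto simp: disjoint_family_on_def E_def)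
  also have "\<dots> = (\<Sum>(d, j)\<in>?A. jump_prob p q r \<omega> (0, i) (d, j) * avoid_prob (env_shift d \<omega>) (m - d) j s)"
  proof (rule sum.cong[OF refl], clarify)
    fix d :: int and j
    have "emeasure (walk_law \<omega> i) (E (d, j)) =
        emeasure (walk_law \<omega> i) {x. x 1 = (d, j)} * emeasure (walk_law (env_shift d \<omega>) j) (B d)"
      unfolding E_def fst_conv by (rule walk_law_Markov[OF \<omega> B]) auto
    then have "measure (walk_law \<omega> i) (E (d, j)) =
        measure (walk_law \<omega> i) {x. x 1 = (d, j)} * measure (walk_law (env_shift d \<omega>) j) (B d)"
      by (simp only: measure_def enn2real_mult)
    also have "measure (walk_law \<omega> i) {x. x 1 = (d, j)} = jump_prob p q r \<omega> (0, i) (d, j)"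
      by (rule walk_law_first_step[OF \<omega>])
    finally show "measure (walk_law \<omega> i) (E (d, j)) =
        jump_prob p q r \<omega> (0, i) (d, j) * avoid_prob (env_shift d \<omega>) (m - d) j s"
      by (simp only: avoid_prob_def B_def)
  qed
  finally show ?thesis .
qed

text \<open>A supersolution of the equation for the expected time to reach level \<open>1\<close> dominates the
  truncated expectation as long as the walk cannot have left the levels where it is one.\<close>

lemma sum_avoid_prob_le:
  assumes \<omega>: "\<omega> \<in> space P"
    and h0: "\<And>n j. n \<le> 1 \<Longrightarrow> 0 \<le> h n $ j"
    and h: "\<And>n j. l \<le> n \<Longrightarrow> n \<le> 0 \<Longrightarrow>
      1 + (p (\<omega> n) *v h (n + 1) + r (\<omega> n) *v h n + q (\<omega> n) *v h (n - 1)) $ j \<le> h n $ j"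
    and n: "n \<le> 1" "l - 1 \<le> n - int N"
  shows "(\<Sum>s<N. avoid_prob (env_shift n \<omega>) (1 - n) i s) \<le> h n $ i"
  using n
proof (induction N arbitrary: n i)
  case 0
  then show ?case using h0 by simp
next
  case (Suc N)
  show ?case
  proof (cases "n = 1")
    case True
    then show ?thesis using h0[of 1 i] \<omega> by (simp add: avoid_prob_0)
  next
    case False
    then have n: "n \<le> 0" "l \<le> n" using Suc.prems by auto
    let ?\<omega> = "env_shift n \<omega>" and ?A = "{-1, 0, 1} \<times> (UNIV :: 'd set)"
    \<comment> \<open>The tail at time \<open>0\<close> equals \<open>1\<close> and supplies the
      constant term of the equation.\<close>
    have first: "(\<Sum>s<Suc N. avoid_prob ?\<omega> (1 - n) i s) = 1 + (\<Sum>s<N. avoid_prob ?\<omega> (1 - n) i (Suc s))"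
      using \<omega> False by (subst sum.lessThan_Suc_shift) (simp add: avoid_prob_time_0)
    have "(\<Sum>s<N. avoid_prob ?\<omega> (1 - n) i (Suc s)) =
        (\<Sum>s<N. \<Sum>(d, j)\<in>?A. jump_prob p q r ?\<omega> (0, i) (d, j) * avoid_prob (env_shift (n + d) \<omega>) (1 - (n + d)) j s)"
      using \<omega> False by (intro sum.cong refl, subst avoid_prob_Suc)
        (auto simp: add.commute algebra_simps intro!: sum.cong)
    also have "\<dots> = (\<Sum>(d, j)\<in>?A. jump_prob p q r ?\<omega> (0, i) (d, j) *
        (\<Sum>s<N. avoid_prob (env_shift (n + d) \<omega>) (1 - (n + d)) j s))"
      by (subst sum.swap) (simp add: sum_distrib_left split_def)
    also have "\<dots> \<le> (\<Sum>(d, j)\<in>?A. jump_prob p q r ?\<omega> (0, i) (d, j) * h (n + d) $ j)"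
    proof (rule sum_mono, clarify)
      fix d :: int and j assume "d \<in> {- 1, 0, 1}"
      \<comment> \<open>A step lowers the level by at most one and leaves one step less to count, so
        the lower bound \<open>l - 1\<close> survives.\<close>
      then have "(\<Sum>s<N. avoid_prob (env_shift (n + d) \<omega>) (1 - (n + d)) j s) \<le> h (n + d) $ j"
        using n Suc.prems by (intro Suc.IH) auto
      moreover have "0 \<le> jump_prob p q r ?\<omega> (0, i) (d, j)"
        using pmf_step[of ?\<omega> "(0, i)" "(d, j)"] \<omega> pmf_nonneg[of "walk_step p q r ?\<omega> (0, i)" "(d, j)"] by simp
      ultimately show "jump_prob p q r ?\<omega> (0, i) (d, j) * (\<Sum>s<N. avoid_prob (env_shift (n + d) \<omega>) (1 - (n + d)) j s)
          \<le> jump_prob p q r ?\<omega> (0, i) (d, j) * h (n + d) $ j"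
        by (rule mult_left_mono)
    qed
    also have "\<dots> = (\<Sum>d\<in>{-1, 0, 1}. \<Sum>j\<in>UNIV. jump_prob p q r ?\<omega> (0, i) (d, j) * h (n + d) $ j)"
      by (simp add: sum.cartesian_product)
    also have "\<dots> = (p (\<omega> n) *v h (n + 1) + r (\<omega> n) *v h n + q (\<omega> n) *v h (n - 1)) $ i"
      by (simp add: jump_prob_def matrix_vector_mult_def env_shift_apply)
    finally show ?thesis using h[OF n(2,1), of i] first by simp
  qed
qed

end

section \<open>Finite mean hitting time from the decay of the products\<close>

lemma stochastic_matrix_mult_1: "stochastic_matrix A \<Longrightarrow> A *v 1 = (1 :: real^'d::finite)"
  by (simp add: stochastic_matrix_def vec_eq_iff matrix_vector_mult_def)

lemma matrix_vector_mult_sum: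
  "(A :: real^'d::finite^'d) *v (\<Sum>x\<in>X. f x) = (\<Sum>x\<in>X. A *v f x)"
  by (induction X rule: infinite_finite_induct) (simp_all add: matrix_vector_right_distrib)

text \<open>Any \<open>c\<close> strictly between the limsup and \<open>0\<close> works, with
  \<open>\<rho> = exp c\<close>. The values \<open>0\<close> and \<open>\<infinity>\<close> of
  \<open>e n\<close> are treated apart because \<open>extended_ln\<close> is infinite there.\<close>

lemma limsup_ln_neg_imp_geometric:
  assumes "limsup (\<lambda>n. ereal (1 / real n) * extended_ln (e n)) < 0"
  obtains \<rho> where "0 < \<rho>" "\<rho> < 1" "\<forall>\<^sub>F n in sequentially. e n \<le> ennreal (\<rho> ^ n)"
proof -
  obtain c where c: "limsup (\<lambda>n. ereal (1 / real n) * extended_ln (e n)) < ereal c" "ereal c < 0"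
    using ereal_dense2[OF assms] by auto
  have "\<forall>\<^sub>F n in sequentially. e n \<le> ennreal (exp c ^ n)"
    using Limsup_lessD[OF c(1)] eventually_gt_at_top[of 0]
  proof eventually_elim
    case (elim n)
    show ?case
    proof (cases "e n" rule: ennreal_cases)
      case (real x)
      show ?thesis
      proof (cases "x = 0")
        case False
        then have x: "x > 0" using real by simp
        have "ln x / real n < c"
          using elim x real by (simp add: extended_ln_def ennreal_eq_0_iff)
        then have "ln x < c * real n" using elim by (simp add: field_simps)
        then have "exp (ln x) < exp (real n * c)" by (simp add: mult.commute)
        then show ?thesis using x real by (simp add: exp_of_nat_mult ennreal_leI)
      qed (use real in simp)
    next
      case top
      then show ?thesis using elim by (simp add: extended_ln_def)
    qed
  qed
  moreover have "exp c < 1" using c(2) by simp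
  ultimately show ?thesis using that[of "exp c"] by simp
qed

locale strip_walk_drift = strip_walk P S p q r
  for P :: "(int \<Rightarrow> 's) measure" and S and p q r :: "'s \<Rightarrow> real^'d::finite^'d" +
  fixes \<zeta> :: "int \<Rightarrow> (int \<Rightarrow> 's) \<Rightarrow> real^'d^'d" and \<epsilon> :: real
  assumes zeta: "stationary_solution P p q r \<zeta>"
    and \<epsilon>_pos: "0 < \<epsilon>"
    and elliptic: "AE \<omega> in P. \<forall>i n. (\<Sum>j\<in>UNIV. p (\<omega> n) $ i $ j) > \<epsilon>"
    and decay: "limsup (\<lambda>n. ereal (1 / real n) *
                extended_ln (\<integral>\<^sup>+\<omega>. ennreal (max_opnorm (a_prod q r \<zeta> n \<omega>)) \<partial>P)) < 0"
begin

abbreviation "g \<equiv> gamma_mat q r \<zeta>"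
abbreviation "a \<equiv> a_mat q r \<zeta>"

text \<open>The almost sure properties at all levels and shifts, collected in one condition, so that
  every estimate before integration is deterministic.\<close>

definition good_env :: "(int \<Rightarrow> 's) \<Rightarrow> bool" where
  "good_env \<omega> \<longleftrightarrow> \<omega> \<in> space P \<and> (\<forall>i n. (\<Sum>j\<in>UNIV. p (\<omega> n) $ i $ j) > \<epsilon>) \<and>
    (\<forall>n. stochastic_matrix (\<zeta> n \<omega>) \<and> \<zeta> n \<omega> = g n \<omega> ** p (\<omega> n)) \<and>
    (\<forall>n s. \<zeta> n (env_shift s \<omega>) = \<zeta> (n + s) \<omega>)"

lemma good_envD:
  assumes "good_env \<omega>"
  shows "\<omega> \<in> space P" and "\<epsilon> < (\<Sum>j\<in>UNIV. p (\<omega> n) $ i $ j)"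
    and "stochastic_matrix (\<zeta> n \<omega>)" and "\<zeta> n \<omega> = g n \<omega> ** p (\<omega> n)"
    and "\<zeta> n (env_shift s \<omega>) = \<zeta> (n + s) \<omega>"
  using assms unfolding good_env_def by blast+

text \<open>Stationarity of \<open>\<zeta>\<close> is given for a single shift. Forward shifts
  follow by iteration, and a backward shift from the forward identity read in the shifted
  environment.\<close>

lemma AE_good_env: "AE \<omega> in P. good_env \<omega>"
proof -
  have one: "AE \<omega> in P. \<forall>n. \<zeta> (n + 1) \<omega> = \<zeta> n (env_shift 1 \<omega>)"
    using zeta by (simp add: stationary_solution_def AE_all_countable)
  have pos: "AE \<omega> in P. \<forall>n. \<zeta> n (env_shift (int k) \<omega>) = \<zeta> (n + int k) \<omega>" for k
  proof (induction k)
    case (Suc k)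
    show ?case
      using Suc AE_env_shift[OF one, of "int k"]
    proof eventually_elim
      case (elim \<omega>)
      then have "\<zeta> n (env_shift (1 + int k) \<omega>) = \<zeta> (n + 1) (env_shift (int k) \<omega>)" for n
        by simp
      also have "\<dots> n = \<zeta> (n + 1 + int k) \<omega>" for n using elim by simp
      finally show ?case by (simp add: add.assoc)
    qed
  qed simp
  have shift: "AE \<omega> in P. \<forall>n. \<zeta> n (env_shift s \<omega>) = \<zeta> (n + s) \<omega>" for s
  proof (cases "s \<ge> 0")
    case True
    then show ?thesis using pos[of "nat s"] by simp
  next
    case False
    show ?thesis
      using AE_env_shift[OF pos[of "nat (- s)"], of s]
    proof eventually_elim
      case (elim \<omega>)
      then have "\<zeta> (n + s) \<omega> = \<zeta> n (env_shift s \<omega>)" for n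
        using False elim[rule_format, of "n + s"] by simp
      then show ?case by simp
    qed
  qed
  have "AE \<omega> in P. \<forall>s n. \<zeta> n (env_shift s \<omega>) = \<zeta> (n + s) \<omega>"
    using shift by (simp add: AE_all_countable)
  moreover have "AE \<omega> in P. \<forall>n. stochastic_matrix (\<zeta> n \<omega>)" "AE \<omega> in P. \<forall>n. \<zeta> n \<omega> = g n \<omega> ** p (\<omega> n)"
    using zeta by (simp_all add: stationary_solution_def AE_all_countable)
  ultimately show ?thesis
    using elliptic AE_space[of P] unfolding good_env_def by eventually_elim auto
qed

text \<open>
  \<open>tau \<omega> l k\<close> bounds the mean time to climb from level \<open>l + k - 1\<close> to level \<open>l + k\<close>, ignoring what
  happens below level \<open>l\<close>; \<open>upto_one \<omega> l k\<close> is the resulting bound for the way from level \<open>1 - k\<close> to level \<open>1\<close>.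
\<close>

primrec tau :: "(int \<Rightarrow> 's) \<Rightarrow> int \<Rightarrow> nat \<Rightarrow> real^'d" where
  "tau \<omega> l 0 = 0"
| "tau \<omega> l (Suc k) = g (l + int k) \<omega> *v (1 + q (\<omega> (l + int k)) *v tau \<omega> l k)"

primrec upto_one :: "(int \<Rightarrow> 's) \<Rightarrow> int \<Rightarrow> nat \<Rightarrow> real^'d" where
  "upto_one \<omega> l 0 = 0"
| "upto_one \<omega> l (Suc k) = tau \<omega> l (nat (1 - int k - l)) + \<zeta> (- int k) \<omega> *v upto_one \<omega> l k"

lemma mats_nonneg:
  assumes "good_env \<omega>"
  shows "nonneg_matrix (p (\<omega> n))" "nonneg_matrix (q (\<omega> n))" "nonneg_matrix (r (\<omega> n))" "nonneg_matrix (\<zeta> n \<omega>)"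
  using good_envD(1,3)[OF assms] nonneg[OF env_mem] by (auto simp: stochastic_matrix_def)

text \<open>Since \<open>\<zeta>\<close> has row sums \<open>1\<close>, the row sums of
  \<open>M\<close> are one minus those of \<open>p\<close>, hence below \<open>1\<close>. For the
  last bound, apply \<open>g\<close> to \<open>\<epsilon> 1 \<le> p 1\<close> and use
  \<open>g p 1 = \<zeta> 1 = 1\<close>.\<close>

lemma resolvent:
  assumes good: "good_env \<omega>"
  shows "(mat 1 - q (\<omega> n) ** \<zeta> (n - 1) \<omega> - r (\<omega> n)) ** g n \<omega> = mat 1"
    and "nonneg_matrix (g n \<omega>)"
    and "(g n \<omega> *v 1) $ i \<le> 1 / \<epsilon>"
proof -
  define M where "M = q (\<omega> n) ** \<zeta> (n - 1) \<omega> + r (\<omega> n)"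
  note nn = mats_nonneg[OF good]
  have M: "nonneg_matrix M"
    unfolding M_def by (intro nonneg_matrix_add nonneg_matrix_mult nn)
  have z1: "\<zeta> m \<omega> *v 1 = 1" for m
    by (rule stochastic_matrix_mult_1[OF good_envD(3)[OF good]])
  have p1: "(p (\<omega> n) *v 1) $ i > \<epsilon>" for i
    using good_envD(2)[OF good] by (simp add: matrix_vector_mult_def)
  have "(p (\<omega> n) + q (\<omega> n) + r (\<omega> n)) *v 1 = 1"
    by (intro stochastic_matrix_mult_1 stoch env_mem good_envD(1)[OF good])
  then have sum1: "p (\<omega> n) *v 1 + q (\<omega> n) *v 1 + r (\<omega> n) *v 1 = 1"
    by (simp add: matrix_vector_mult_add_rdistrib)
  have "M *v 1 = q (\<omega> n) *v 1 + r (\<omega> n) *v 1"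
    by (simp add: M_def matrix_vector_mult_add_rdistrib z1 flip: matrix_vector_mul_assoc)
  also have "\<dots> = 1 - p (\<omega> n) *v 1"
    using sum1 by (simp add: algebra_simps)
  finally have M1: "(M *v 1) $ i < 1" for i
    using p1[of i] \<epsilon>_pos by simp
  have gM: "g n \<omega> = matrix_inv (mat 1 - M)"
    by (simp add: gamma_mat_def M_def diff_diff_eq)
  show "(mat 1 - q (\<omega> n) ** \<zeta> (n - 1) \<omega> - r (\<omega> n)) ** g n \<omega> = mat 1"
    using substochastic_resolvent(1)[OF M M1] unfolding gM by (simp add: M_def diff_diff_eq)
  show gn: "nonneg_matrix (g n \<omega>)"
    using substochastic_resolvent(2)[OF M M1] by (simp add: gM)
  have "\<epsilon> * (g n \<omega> *v 1) $ i = (g n \<omega> *v (\<epsilon> *s 1)) $ i"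
    by (simp add: vector_scalar_commute)
  also have "\<dots> \<le> (g n \<omega> *v (p (\<omega> n) *v 1)) $ i"
    using p1 by (intro nonneg_matrix_vec_mono gn) (simp add: less_imp_le)
  also have "g n \<omega> *v (p (\<omega> n) *v 1) = \<zeta> n \<omega> *v 1"
    by (simp add: matrix_vector_mul_assoc flip: good_envD(4)[OF good])
  finally show "(g n \<omega> *v 1) $ i \<le> 1 / \<epsilon>"
    using \<epsilon>_pos by (simp add: z1 field_simps)
qed

lemma nonneg_a: "good_env \<omega> \<Longrightarrow> nonneg_matrix (a n \<omega>)"
  unfolding a_mat_def by (intro nonneg_matrix_mult resolvent mats_nonneg)

lemma a_shift:
  assumes "good_env \<omega>"
  shows "a n (env_shift s \<omega>) = a (n + s) \<omega>"
proof -
  have "\<zeta> (n - 1) (env_shift s \<omega>) = \<zeta> (n + s - 1) \<omega>"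
    using good_envD(5)[OF assms, of "n - 1" s] by (simp add: algebra_simps)
  then show ?thesis by (simp add: a_mat_def gamma_mat_def env_shift_apply)
qed

lemma nonneg_a_prod: "good_env \<omega> \<Longrightarrow> nonneg_matrix (a_prod q r \<zeta> n (env_shift s \<omega>))"
proof (induction n)
  case 0
  show ?case by (simp add: nonneg_matrix_def mat_def)
next
  case (Suc n)
  then show ?case by (simp add: a_shift nonneg_matrix_mult nonneg_a)
qed

lemma tau_nonneg: "good_env \<omega> \<Longrightarrow> 0 \<le> tau \<omega> l k $ i"
proof (induction k arbitrary: i)
  case (Suc k)
  have "0 \<le> (1 + q (\<omega> (l + int k)) *v tau \<omega> l k) $ j" for j
    using nonneg_matrix_vec_nonneg[OF mats_nonneg(2)[OF Suc.prems] Suc.IH[OF Suc.prems]] by simp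
  then show ?case
    unfolding tau.simps by (rule nonneg_matrix_vec_nonneg[OF resolvent(2)[OF Suc.prems]])
qed simp

lemma upto_one_nonneg: "good_env \<omega> \<Longrightarrow> 0 \<le> upto_one \<omega> l k $ i"
proof (induction k arbitrary: i)
  case (Suc k)
  then show ?case
    using nonneg_matrix_vec_nonneg[OF mats_nonneg(4)[OF Suc.prems] Suc.IH[OF Suc.prems]] tau_nonneg
    by simp
qed simp

text \<open>Multiplying \<open>h n\<close> by the inverse \<open>W\<close> of \<open>g n\<close>
  leaves \<open>1 + q T + p h (n + 1)\<close>. The level below satisfies
  \<open>h (n - 1) = T + \<zeta> (n - 1) h n\<close>, which combines the terms with \<open>T\<close>
  and \<open>\<zeta>\<close> into \<open>q h (n - 1)\<close>.\<close>

lemma upto_one_harmonic: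
  assumes good: "good_env \<omega>" and n: "l \<le> n" "n \<le> 0"
  defines "h \<equiv> \<lambda>m. upto_one \<omega> l (nat (1 - m))"
  shows "h n = 1 + (p (\<omega> n) *v h (n + 1) + r (\<omega> n) *v h n + q (\<omega> n) *v h (n - 1))"
proof -
  have h: "h m = tau \<omega> l (nat (m + 1 - l)) + \<zeta> m \<omega> *v h (m + 1)" if "m \<le> 0" for m
  proof -
    have "nat (1 - m) = Suc (nat (- m))" using that by simp
    moreover have "nat (1 - (m + 1)) = nat (- m)" by simp
    moreover have "1 - int (nat (- m)) - l = m + 1 - l" "- int (nat (- m)) = m" using that by auto
    ultimately show ?thesis by (simp only: h_def upto_one.simps)
  qed
  define W where "W = mat 1 - q (\<omega> n) ** \<zeta> (n - 1) \<omega> - r (\<omega> n)"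
  \<comment> \<open>The bound for the climb from \<open>n - 1\<close> to \<open>n\<close>; at
    \<open>n = l\<close> it is the starting value \<open>0\<close> of the recursion.\<close>
  define T where "T = tau \<omega> l (nat (n - l))"
  have "nat (n + 1 - l) = Suc (nat (n - l))" using n by simp
  then have "tau \<omega> l (nat (n + 1 - l)) = g n \<omega> *v (1 + q (\<omega> n) *v T)"
    using n by (simp add: T_def)
  moreover note good_envD(4)[OF good, of n]
  ultimately have "h n = g n \<omega> *v (1 + q (\<omega> n) *v T + p (\<omega> n) *v h (n + 1))"
    using h[OF n(2)] by (simp add: matrix_vector_right_distrib matrix_vector_mul_assoc)
  then have "W *v h n = 1 + q (\<omega> n) *v T + p (\<omega> n) *v h (n + 1)"
    using resolvent(1)[OF good, of n] by (simp add: W_def matrix_vector_mul_assoc)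
  moreover have "W *v h n = h n - q (\<omega> n) *v (\<zeta> (n - 1) \<omega> *v h n) - r (\<omega> n) *v h n"
    by (simp add: W_def matrix_vector_mult_diff_rdistrib matrix_vector_mul_assoc)
  moreover have "q (\<omega> n) *v h (n - 1) = q (\<omega> n) *v T + q (\<omega> n) *v (\<zeta> (n - 1) \<omega> *v h n)"
    using h[of "n - 1"] n by (simp add: T_def matrix_vector_right_distrib)
  ultimately show ?thesis by (simp add: algebra_simps)
qed

text \<open>Unrolls \<open>tau (k + 1) = g 1 + a tau k\<close> with
  \<open>g 1 \<le> 1 / \<epsilon>\<close>. Term \<open>m\<close> carries the product of the matrices
  \<open>a\<close> at levels \<open>l + m + 1\<close> to \<open>l + k - 1\<close>, written as a
  shifted \<open>a_prod\<close> so that stationarity can remove the shift.\<close>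

lemma tau_le:
  assumes good: "good_env \<omega>"
  shows "tau \<omega> l k $ i \<le> (\<Sum>m<k. (a_prod q r \<zeta> (k - 1 - m) (env_shift (l + int m + 1) \<omega>) *v 1) $ i) / \<epsilon>"
proof (induction k arbitrary: i)
  case (Suc k)
  let ?b = "\<lambda>k m. a_prod q r \<zeta> (k - 1 - m) (env_shift (l + int m + 1) \<omega>) *v (1 :: real^'d)"
  have "tau \<omega> l (Suc k) $ i = (g (l + int k) \<omega> *v 1) $ i + (a (l + int k) \<omega> *v tau \<omega> l k) $ i"
    by (simp add: a_mat_def matrix_vector_right_distrib matrix_vector_mul_assoc)
  also have "\<dots> \<le> 1 / \<epsilon> + (a (l + int k) \<omega> *v ((1 / \<epsilon>) *s (\<Sum>m<k. ?b k m))) $ i"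
    by (intro add_mono resolvent(3)[OF good] nonneg_matrix_vec_mono nonneg_a[OF good]) (use Suc in simp)
  also have "a (l + int k) \<omega> *v ((1 / \<epsilon>) *s (\<Sum>m<k. ?b k m)) =
      (1 / \<epsilon>) *s (\<Sum>m<k. a (l + int k) \<omega> *v ?b k m)"
    by (simp only: vector_scalar_commute matrix_vector_mult_sum)
  also have "(\<Sum>m<k. a (l + int k) \<omega> *v ?b k m) = (\<Sum>m<k. ?b (Suc k) m)"
  proof (rule sum.cong[OF refl])
    fix m assume m: "m \<in> {..<k}"
    then have "Suc k - 1 - m = Suc (k - 1 - m)" by auto
    moreover have "int (k - 1 - m) + (l + int m + 1) = l + int k" using m by auto
    ultimately show "a (l + int k) \<omega> *v ?b k m = ?b (Suc k) m"
      using a_shift[OF good, of "int (k - 1 - m)" "l + int m + 1"]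
      by (simp only: a_prod.simps matrix_vector_mul_assoc)
  qed
  finally show ?case by (simp add: add_divide_distrib)
qed simp

text \<open>A crude bound from \<open>q 1 \<le> 1\<close> and
  \<open>g 1 \<le> 1 / \<epsilon>\<close>. It makes every mean finite, including the early ones
  about which the limsup says nothing.\<close>

lemma a_prod_row_le:
  assumes good: "good_env \<omega>"
  shows "(a_prod q r \<zeta> n \<omega> *v 1) $ i \<le> (1 / \<epsilon>) ^ n"
proof (induction n arbitrary: i)
  case (Suc n)
  have "(a_prod q r \<zeta> (Suc n) \<omega> *v 1) $ i = (a (int n) \<omega> *v (a_prod q r \<zeta> n \<omega> *v 1)) $ i"
    by (simp add: matrix_vector_mul_assoc)
  also have "\<dots> \<le> (a (int n) \<omega> *v ((1 / \<epsilon>) ^ n *s 1)) $ i"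
    using Suc by (intro nonneg_matrix_vec_mono nonneg_a[OF good]) simp
  also have "\<dots> = (1 / \<epsilon>) ^ n * (g (int n) \<omega> *v (q (\<omega> (int n)) *v 1)) $ i"
    by (simp add: vector_scalar_commute a_mat_def matrix_vector_mul_assoc)
  also have "(g (int n) \<omega> *v (q (\<omega> (int n)) *v 1)) $ i \<le> (g (int n) \<omega> *v 1) $ i"
  proof (intro nonneg_matrix_vec_mono resolvent(2)[OF good])
    fix j
    have "(p (\<omega> n) + q (\<omega> n) + r (\<omega> n)) *v 1 = 1"
      by (intro stochastic_matrix_mult_1 stoch env_mem good_envD(1)[OF good])
    then have "(p (\<omega> n) *v 1) $ j + (q (\<omega> n) *v 1) $ j + (r (\<omega> n) *v 1) $ j = 1 $ j"
      by (simp add: matrix_vector_mult_add_rdistrib flip: vector_add_component)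
    then show "(q (\<omega> n) *v 1) $ j \<le> 1 $ j"
      using nonneg_matrix_vec_nonneg[OF mats_nonneg(1)[OF good], of 1 n j]
        nonneg_matrix_vec_nonneg[OF mats_nonneg(3)[OF good], of 1 n j] by simp
  qed
  also have "(g (int n) \<omega> *v 1) $ i \<le> 1 / \<epsilon>" by (rule resolvent(3)[OF good])
  finally show ?case using \<epsilon>_pos by (simp add: mult_left_mono mult.commute)
qed simp

lemma measurable_a_prod [measurable]: "a_prod q r \<zeta> n \<in> borel_measurable P"
proof -
  have [measurable]: "\<zeta> k \<in> borel_measurable P" for k
    using zeta by (simp add: stationary_solution_def)
  have "(\<lambda>\<omega>. matrix_inv (mat 1 - q (\<omega> k) ** \<zeta> (k - 1) \<omega> - r (\<omega> k))) \<in> borel_measurable P" for k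
    by (rule measurable_compose[OF _ borel_measurable_matrix_inv]) measurable
  then have [measurable]: "g k \<in> borel_measurable P" for k
    by (simp add: gamma_mat_def[abs_def])
  have [measurable]: "a k \<in> borel_measurable P" for k
    unfolding a_mat_def[abs_def] by measurable
  show ?thesis by (induction n) (simp_all add: a_prod.simps[abs_def])
qed

text \<open>Row sums stand in for \<open>max_opnorm\<close>: they are measurable, so stationarity
  applies to them, and \<open>max_opnorm\<close> dominates them.\<close>

definition row_mean :: "'d \<Rightarrow> nat \<Rightarrow> ennreal" where
  "row_mean i k = (\<integral>\<^sup>+\<omega>. ennreal ((a_prod q r \<zeta> k \<omega> *v 1) $ i) \<partial>P)"

lemma measurable_row: "(\<lambda>\<omega>. (a_prod q r \<zeta> k \<omega> *v 1) $ i) \<in> borel_measurable P"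
  by (simp add: matrix_vector_mult_def)

lemma row_mean_summable: "(\<Sum>k. row_mean i k) < \<infinity>"
proof -
  obtain \<rho> where \<rho>: "0 < \<rho>" "\<rho> < 1"
    and ev: "\<forall>\<^sub>F n in sequentially. (\<integral>\<^sup>+\<omega>. ennreal (max_opnorm (a_prod q r \<zeta> n \<omega>)) \<partial>P) \<le> ennreal (\<rho> ^ n)"
    using limsup_ln_neg_imp_geometric[OF decay] .
  have fin: "row_mean i k < \<infinity>" for k
  proof -
    have "row_mean i k \<le> (\<integral>\<^sup>+\<omega>. ennreal ((1 / \<epsilon>) ^ k) \<partial>P)"
      unfolding row_mean_def using AE_good_env
      by (intro nn_integral_mono_AE, eventually_elim) (intro ennreal_leI a_prod_row_le)
    also have "\<dots> < \<infinity>" by (simp add: emeasure_space_1)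
    finally show ?thesis .
  qed
  have "\<forall>\<^sub>F n in sequentially. norm (enn2real (row_mean i n)) \<le> \<rho> ^ n"
    using ev
  proof eventually_elim
    case (elim n)
    have "row_mean i n \<le> (\<integral>\<^sup>+\<omega>. ennreal (max_opnorm (a_prod q r \<zeta> n \<omega>)) \<partial>P)"
      unfolding row_mean_def by (intro nn_integral_mono ennreal_leI row_sum_le_max_opnorm)
    also note elim
    finally show ?case using \<rho> by (simp add: enn2real_leI)
  qed
  then have "summable (\<lambda>n. enn2real (row_mean i n))"
    by (rule summable_comparison_test_ev) (use \<rho> in \<open>simp add: summable_geometric\<close>)
  then have "(\<Sum>k. ennreal (enn2real (row_mean i k))) = ennreal (\<Sum>k. enn2real (row_mean i k))"
    by (intro suminf_ennreal2) auto
  then show ?thesis using fin by simp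
qed

text \<open>The truncated means are bounded uniformly in \<open>N\<close>: stationarity removes the
  shifts after integration and leaves a partial sum of the convergent series of
  \<open>row_mean\<close>.\<close>

lemma mean_hitting_time_finite: "(\<integral>\<^sup>+\<omega>. (\<Sum>s. ennreal (avoid_prob \<omega> 1 i s)) \<partial>P) < \<infinity>"
proof -
  have partial: "(\<Sum>s<N. \<integral>\<^sup>+\<omega>. ennreal (avoid_prob \<omega> 1 i s) \<partial>P) \<le> ennreal (1 / \<epsilon>) * (\<Sum>k. row_mean i k)" for N
  proof -
    \<comment> \<open>Within \<open>N\<close> steps from \<open>0\<close> the walk descends at most
      to \<open>?l - 1\<close>, where no further step is counted.\<close>
    let ?l = "1 - int N"
    have "AE \<omega> in P. ennreal (\<Sum>s<N. avoid_prob \<omega> 1 i s) \<le>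
        ennreal (1 / \<epsilon>) * (\<Sum>m<N. ennreal ((a_prod q r \<zeta> (N - 1 - m) (env_shift (?l + int m + 1) \<omega>) *v 1) $ i))"
      using AE_good_env
    proof eventually_elim
      case (elim \<omega>)
      let ?h = "\<lambda>m. upto_one \<omega> ?l (nat (1 - m))"
      have nn: "0 \<le> (a_prod q r \<zeta> k (env_shift s \<omega>) *v 1) $ i" for k s
        by (intro nonneg_matrix_vec_nonneg nonneg_a_prod elim) simp
      have "(\<Sum>s<N. avoid_prob (env_shift 0 \<omega>) (1 - 0) i s) \<le> ?h 0 $ i"
      proof (rule sum_avoid_prob_le[where l="?l"])
        show "\<omega> \<in> space P" using elim by (simp add: good_env_def)
        show "0 \<le> ?h m $ j" for m j by (rule upto_one_nonneg[OF elim])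
        show "1 + (p (\<omega> n) *v ?h (n + 1) + r (\<omega> n) *v ?h n + q (\<omega> n) *v ?h (n - 1)) $ j \<le> ?h n $ j"
          if "?l \<le> n" "n \<le> 0" for n j
          using upto_one_harmonic[OF elim that] by (metis order_refl vector_add_component one_index)
      qed simp_all
      also have "?h 0 $ i = tau \<omega> ?l N $ i" by (simp add: matrix_vector_mult_0_right)
      also have "\<dots> \<le> (\<Sum>m<N. (a_prod q r \<zeta> (N - 1 - m) (env_shift (?l + int m + 1) \<omega>) *v 1) $ i) / \<epsilon>"
        by (rule tau_le[OF elim])
      finally show ?case
        using nn \<epsilon>_pos by (simp add: ennreal_leI sum_nonneg flip: ennreal_mult)
    qed
    then have "(\<integral>\<^sup>+\<omega>. ennreal (\<Sum>s<N. avoid_prob \<omega> 1 i s) \<partial>P) \<le> (\<integral>\<^sup>+\<omega>. ennreal (1 / \<epsilon>) *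
        (\<Sum>m<N. ennreal ((a_prod q r \<zeta> (N - 1 - m) (env_shift (?l + int m + 1) \<omega>) *v 1) $ i)) \<partial>P)"
      by (rule nn_integral_mono_AE)
    also have "\<dots> = ennreal (1 / \<epsilon>) *
        (\<Sum>m<N. \<integral>\<^sup>+\<omega>. ennreal ((a_prod q r \<zeta> (N - 1 - m) (env_shift (?l + int m + 1) \<omega>) *v 1) $ i) \<partial>P)"
      using measurable_compose[OF measurable_env_shift measurable_row]
      by (subst nn_integral_cmult) (auto intro!: borel_measurable_sum simp: nn_integral_sum)
    also have "(\<Sum>m<N. \<integral>\<^sup>+\<omega>. ennreal ((a_prod q r \<zeta> (N - 1 - m) (env_shift (?l + int m + 1) \<omega>) *v 1) $ i) \<partial>P) =
        (\<Sum>m<N. row_mean i (N - 1 - m))"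
      unfolding row_mean_def
      by (intro sum.cong refl nn_integral_env_shift) (use measurable_row in measurable)
    also have "\<dots> = (\<Sum>k<N. row_mean i k)"
      using sum.nat_diff_reindex[of "row_mean i" N] by simp
    also have "\<dots> \<le> (\<Sum>k. row_mean i k)"
      by (intro sum_le_suminf) auto
    also have "(\<integral>\<^sup>+\<omega>. ennreal (\<Sum>s<N. avoid_prob \<omega> 1 i s) \<partial>P) = (\<Sum>s<N. \<integral>\<^sup>+\<omega>. ennreal (avoid_prob \<omega> 1 i s) \<partial>P)"
      by (subst nn_integral_sum[symmetric]) (auto simp: sum_ennreal avoid_prob_def)
    finally show ?thesis by (simp add: mult_left_mono)
  qed
  have "(\<integral>\<^sup>+\<omega>. (\<Sum>s. ennreal (avoid_prob \<omega> 1 i s)) \<partial>P) = (\<Sum>s. \<integral>\<^sup>+\<omega>. ennreal (avoid_prob \<omega> 1 i s) \<partial>P)"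
    by (intro nn_integral_suminf) measurable
  also have "\<dots> \<le> ennreal (1 / \<epsilon>) * (\<Sum>k. row_mean i k)"
    using partial by (intro suminf_le_const) auto
  also have "\<dots> < \<infinity>"
    using row_mean_summable[of i] by (simp add: ennreal_mult_less_top)
  finally show ?thesis .
qed

end

section \<open>Skip-free paths\<close>

definition skip_free :: "(nat \<Rightarrow> int \<times> 'd) \<Rightarrow> bool" where
  "skip_free x \<longleftrightarrow> fst (x 0) = 0 \<and> (\<forall>t. \<bar>fst (x (Suc t)) - fst (x t)\<bar> \<le> 1)"

lemma skip_free_crossing:
  assumes "skip_free x" "0 \<le> m" "m \<le> fst (x t)"
  shows "\<exists>s\<le>t. fst (x s) = m"
  using nat0_intermed_int_val[of t "\<lambda>s. fst (x s)" m] assms by (auto simp: skip_free_def)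

lemma skip_free_increment:
  assumes "skip_free x"
  shows "\<bar>fst (x (s + t)) - fst (x s)\<bar> \<le> int t"
proof (induction t)
  case (Suc t)
  have "\<bar>fst (x (s + Suc t)) - fst (x (s + t))\<bar> \<le> 1"
    using assms by (simp add: skip_free_def)
  then show ?case using Suc by linarith
qed simp

lemma first_hit_ge:
  assumes "skip_free x" "hits m x"
  shows "m \<le> int (first_hit m x)"
  using skip_free_increment[OF assms(1), of 0 "first_hit m x"] first_hit_fst[OF assms(2)] assms(1)
  by (simp add: skip_free_def)

lemma first_hit_mono:
  assumes x: "skip_free x" and "hits m x" "0 \<le> k" "k \<le> m"
  shows "hits k x" "first_hit k x \<le> first_hit m x"
proof -
  obtain s where s: "s \<le> first_hit m x" "fst (x s) = k"
    using skip_free_crossing[OF x \<open>0 \<le> k\<close>, of "first_hit m x"] first_hit_fst[OF \<open>hits m x\<close>] \<open>k \<le> m\<close>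
    by auto
  then show "hits k x" by (auto simp: hits_def)
  show "first_hit k x \<le> first_hit m x"
    using first_hit_least[of x s k] s by simp
qed

text \<open>A skip-free path from \<open>0\<close> visits \<open>m\<close> no later than
  \<open>m + n\<close>, so nothing that matters for the visit of \<open>m + n\<close> is lost by
  restarting at \<open>m\<close>.\<close>

lemma
  assumes x: "skip_free x" and m: "hits m x" "0 \<le> m" and n: "hits (m + n) x" "0 \<le> n"
  shows first_hit_after_hit: "first_hit (m + n) x = first_hit m x + first_hit n (after_hit m x)"
    and after_hit_after_hit: "after_hit n (after_hit m x) = after_hit (m + n) x"
proof -
  let ?t = "first_hit m x" and ?u = "first_hit (m + n) x"
  have tu: "?t \<le> ?u" using first_hit_mono(2)[OF x n(1), of m] m n by simp
  have pos: "fst (after_hit m x (?u - ?t)) = n"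
    using tu first_hit_fst[OF n(1)] by (simp add: after_hit_def recenter_def)
  have "first_hit n (after_hit m x) = ?u - ?t"
  proof (rule first_hit_eqI)
    show "fst (after_hit m x (?u - ?t)) = n" by (rule pos)
    fix s assume "s < ?u - ?t"
    then have "\<not> ?u \<le> ?t + s" by simp
    then have "fst (x (?t + s)) \<noteq> m + n" using first_hit_least[of x "?t + s" "m + n"] by blast
    then show "fst (after_hit m x s) \<noteq> n" by (auto simp: after_hit_def recenter_def)
  qed
  then show *: "?u = ?t + first_hit n (after_hit m x)" using tu by simp
  show "after_hit n (after_hit m x) = after_hit (m + n) x"
    unfolding after_hit_def[of n] after_hit_def[of "m + n"] *
    by (simp add: after_hit_def recenter_def fun_eq_iff add.assoc)
qed

text \<open>What is needed for the times \<open>T n\<close> to be partial sums of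
  \<open>first_hit 1\<close> along the iterates of \<open>after_hit 1\<close>.\<close>

definition transient_path :: "(nat \<Rightarrow> int \<times> 'd) \<Rightarrow> bool" where
  "transient_path x \<longleftrightarrow> skip_free x \<and> (\<forall>n. hits (int n) x)"

lemma after_hit_iterate:
  assumes "transient_path x"
  shows "(after_hit 1 ^^ m) x = after_hit (int m) x"
proof (induction m)
  case 0
  have "first_hit 0 x = 0"
    using assms by (intro first_hit_eqI) (auto simp: transient_path_def skip_free_def)
  then show ?case by (simp add: after_hit_def recenter_def)
next
  case (Suc m)
  have "hits (int m + 1) x" "hits (int m) x" "skip_free x"
    using assms unfolding transient_path_def by (metis of_nat_Suc add.commute)+
  then show ?case
    using after_hit_after_hit[of x "int m" 1] Suc by (simp add: add.commute)
qed

lemma sum_first_hit: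
  assumes "transient_path x"
  shows "(\<Sum>k<n. first_hit 1 ((after_hit 1 ^^ k) x)) = first_hit (int n) x"
proof (induction n)
  case 0
  have "first_hit 0 x = 0"
    using assms by (intro first_hit_eqI) (auto simp: transient_path_def skip_free_def)
  then show ?case by simp
next
  case (Suc n)
  have "hits (int n + 1) x" "hits (int n) x" "skip_free x"
    using assms unfolding transient_path_def by (metis of_nat_Suc add.commute)+
  then show ?case
    using first_hit_after_hit[of x "int n" 1] Suc assms by (simp add: after_hit_iterate add.commute)
qed

lemma measurable_skip_free [measurable]:
  "Measurable.pred path_space (skip_free :: (nat \<Rightarrow> int \<times> 'd::countable) \<Rightarrow> bool)"
proof -
  have [measurable]: "Measurable.pred path_space (\<lambda>x :: nat \<Rightarrow> int \<times> 'd. \<bar>fst (x (Suc t)) - fst (x t)\<bar> \<le> 1)" for t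
  proof -
    have "(\<lambda>x :: nat \<Rightarrow> int \<times> 'd. fst (x s)) \<in> measurable path_space (count_space UNIV)" for s
      by measurable
    from this[of "Suc t"] this[of t] show ?thesis by measurable
  qed
  show ?thesis unfolding skip_free_def[abs_def] by measurable
qed

lemma measurable_transient_path [measurable]:
  "Measurable.pred path_space (transient_path :: (nat \<Rightarrow> int \<times> 'd::countable) \<Rightarrow> bool)"
  unfolding transient_path_def[abs_def] by measurable

text \<open>If \<open>N t\<close> is the highest level visited up to time \<open>t\<close>, then \<open>N t - (T (N t + 1) - T (N t)) \<le> \<xi> t \<le> N t\<close>,
  because the walk descends by at most one level per step.\<close>

lemma speed_from_hitting_times:
  assumes x: "transient_path x" and c: "0 < c"
    and lim: "(\<lambda>n. real (first_hit (int n) x) / real n) \<longlonglongrightarrow> c"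
  shows "(\<lambda>t. real_of_int (fst (x t)) / real t) \<longlonglongrightarrow> 1 / c"
proof -
  define T where "T n = first_hit (int n) x" for n
  have sf: "skip_free x" and hit: "hits (int n) x" for n
    using x by (auto simp: transient_path_def)
  have T_ge: "n \<le> T n" for n
    using first_hit_ge[OF sf hit[of n]] by (simp add: T_def)
  have T_mono: "T m \<le> T n" if "m \<le> n" for m n
    unfolding T_def using that by (intro first_hit_mono(2)[OF sf hit]) auto
  \<comment> \<open>Well defined: \<open>T 0 = 0\<close> makes the set nonempty and
    \<open>n \<le> T n\<close> bounds it by \<open>t\<close>.\<close>
  define N where "N t = (GREATEST n. T n \<le> t)" for t
  have T0: "T 0 = 0" using sf by (auto simp: T_def skip_free_def intro: first_hit_eqI)
  have TN: "T (N t) \<le> t" for t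
    unfolding N_def by (rule GreatestI_nat[of _ 0 t]) (use T0 T_ge in \<open>auto intro: order_trans\<close>)
  have N_greatest: "n \<le> N t" if "T n \<le> t" for n t
    unfolding N_def by (rule Greatest_le_nat[of _ n t]) (use that T_ge in \<open>auto intro: order_trans\<close>)
  have TSN: "t < T (Suc (N t))" for t
    using N_greatest[of "Suc (N t)" t] by force
  have up: "fst (x t) \<le> int (N t)" for t
  proof (rule ccontr)
    assume "\<not> fst (x t) \<le> int (N t)"
    then obtain s where "s \<le> t" "fst (x s) = int (Suc (N t))"
      using skip_free_crossing[OF sf, of "int (Suc (N t))" t] by auto
    then have "T (Suc (N t)) \<le> t" using first_hit_least[of x s] unfolding T_def by force
    then show False using TSN[of t] by simp
  qed
  have down: "int (N t) - (int (T (Suc (N t))) - int (T (N t))) \<le> fst (x t)" for t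
  proof -
    have "\<bar>fst (x (T (N t) + (t - T (N t)))) - fst (x (T (N t)))\<bar> \<le> int (t - T (N t))"
      by (rule skip_free_increment[OF sf])
    moreover have "fst (x (T (N t))) = int (N t)"
      unfolding T_def by (rule first_hit_fst[OF hit])
    ultimately show ?thesis using TN[of t] TSN[of t] by simp
  qed
  have N_top: "filterlim N at_top sequentially"
    unfolding filterlim_at_top
  proof
    fix k
    show "\<forall>\<^sub>F t in sequentially. k \<le> N t"
      using eventually_ge_at_top[of "T k"] by eventually_elim (rule N_greatest)
  qed
  have lim0: "(\<lambda>n. real (T n) / real n) \<longlonglongrightarrow> c" using lim by (simp add: T_def)
  have lim1: "(\<lambda>n. real (T (Suc n)) / real n) \<longlonglongrightarrow> c"
  proof -
    have "(\<lambda>n. real (T (Suc n)) / real (Suc n) * (real (Suc n) / real n)) \<longlonglongrightarrow> c * 1"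
      by (intro tendsto_mult LIMSEQ_Suc[OF lim0] LIMSEQ_Suc_n_over_n)
    then show ?thesis by simp
  qed
  have tN: "(\<lambda>t. real t / real (N t)) \<longlonglongrightarrow> c"
  proof (rule tendsto_sandwich)
    show "\<forall>\<^sub>F t in sequentially. real (T (N t)) / real (N t) \<le> real t / real (N t)"
      by (intro always_eventually allI divide_right_mono) (use TN in auto)
    show "\<forall>\<^sub>F t in sequentially. real t / real (N t) \<le> real (T (Suc (N t))) / real (N t)"
      by (intro always_eventually allI divide_right_mono) (use TSN in \<open>auto simp: less_imp_le\<close>)
  qed (rule filterlim_compose[OF lim0 N_top] filterlim_compose[OF lim1 N_top])+
  have Nt: "(\<lambda>t. real (N t) / real t) \<longlonglongrightarrow> 1 / c"
    using tendsto_inverse[OF tN] c by (simp add: inverse_eq_divide)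
  \<comment> \<open>The time between consecutive first visits is negligible, because both quotients
    tend to the same \<open>c\<close>.\<close>
  have diff: "(\<lambda>t. (real (T (Suc (N t))) / real (N t) - real (T (N t)) / real (N t)) * (real (N t) / real t)) \<longlonglongrightarrow> (c - c) * (1 / c)"
    by (intro tendsto_mult tendsto_diff Nt filterlim_compose[OF lim0 N_top] filterlim_compose[OF lim1 N_top])
  show ?thesis
  proof (rule tendsto_sandwich[OF _ _ _ Nt])
    let ?l = "\<lambda>t. real (N t) / real t - (real (T (Suc (N t))) / real (N t) - real (T (N t)) / real (N t)) * (real (N t) / real t)"
    show "?l \<longlonglongrightarrow> 1 / c" using tendsto_diff[OF Nt diff] by simp
    show "\<forall>\<^sub>F t in sequentially. ?l t \<le> real_of_int (fst (x t)) / real t"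
      using N_top[unfolded filterlim_at_top, rule_format, of 1]
    proof eventually_elim
      case (elim t)
      have "real_of_int (int (N t) - (int (T (Suc (N t))) - int (T (N t)))) \<le> real_of_int (fst (x t))"
        using down[of t] by (simp only: of_int_le_iff)
      then have "(real (N t) - (real (T (Suc (N t))) - real (T (N t)))) / real t \<le> real_of_int (fst (x t)) / real t"
        by (intro divide_right_mono) auto
      moreover have "?l t = (real (N t) - (real (T (Suc (N t))) - real (T (N t)))) / real t"
        using elim by (simp flip: diff_divide_distrib)
      ultimately show ?case by simp
    qed
    show "\<forall>\<^sub>F t in sequentially. real_of_int (fst (x t)) / real t \<le> real (N t) / real t"
    proof (rule always_eventually, rule allI, rule divide_right_mono)
      fix t
      show "real_of_int (fst (x t)) \<le> real (N t)" using up[of t] by linarith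
    qed simp
  qed
qed

section \<open>Ergodic environments\<close>

lemma stochastic_matrix_mult:
  assumes "stochastic_matrix A" "stochastic_matrix (B :: real^'d::finite^'d)"
  shows "stochastic_matrix (A ** B)"
proof -
  have "(\<Sum>j\<in>UNIV. (A ** B) $ i $ j) = ((A ** B) *v 1) $ i" for i
    by (simp add: matrix_vector_mult_def)
  also have "\<dots> i = 1" for i
    using assms by (simp add: stochastic_matrix_mult_1 flip: matrix_vector_mul_assoc)
  finally show ?thesis
    using assms by (auto simp: stochastic_matrix_def intro: nonneg_matrix_mult)
qed

text \<open>Every row puts mass at least \<open>\<delta>\<close> on the index \<open>lo\<close> of
  the smallest entry, so no entry of \<open>A *v v\<close> exceeds
  \<open>v $ hi - \<delta> * (v $ hi - v $ lo)\<close>, and none lies below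
  \<open>v $ lo\<close>.\<close>

lemma stochastic_matrix_contraction:
  fixes A :: "real^'d::finite^'d"
  assumes A: "stochastic_matrix A" and \<delta>: "\<And>i j. \<delta> \<le> A $ i $ j"
    and v: "\<And>k l. v $ k - v $ l \<le> D"
  shows "(A *v v) $ i - (A *v v) $ j \<le> (1 - \<delta>) * D"
proof -
  have nn: "0 \<le> A $ i $ j" and row: "(\<Sum>j\<in>UNIV. A $ i $ j) = 1" for i j
    using A by (auto simp: stochastic_matrix_def nonneg_matrix_def)
  obtain lo where lo: "\<And>j. v $ lo \<le> v $ j"
    using ex_min_if_finite[of "range (\<lambda>j. v $ j)"] by (auto simp: not_less)
  obtain hi where hi: "\<And>j. v $ j \<le> v $ hi"
    using ex_min_if_finite[of "range (\<lambda>j. - v $ j)"] by (auto simp: not_less)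
  have "v $ hi - (A *v v) $ i = (\<Sum>k\<in>UNIV. A $ i $ k * (v $ hi - v $ k))"
    by (simp add: matrix_vector_mult_def right_diff_distrib sum_subtractf row flip: sum_distrib_right)
  also have "\<dots> \<ge> A $ i $ lo * (v $ hi - v $ lo)"
    using hi nn by (intro member_le_sum) auto
  also have "A $ i $ lo * (v $ hi - v $ lo) \<ge> \<delta> * (v $ hi - v $ lo)"
    using \<delta> hi by (intro mult_right_mono) auto
  finally have up: "(A *v v) $ i \<le> v $ hi - \<delta> * (v $ hi - v $ lo)" by simp
  have "v $ lo = (\<Sum>k\<in>UNIV. A $ j $ k * v $ lo)"
    by (simp add: row flip: sum_distrib_right)
  also have "\<dots> \<le> (A *v v) $ j"
    unfolding matrix_vector_mult_def using lo nn by (auto intro!: sum_mono mult_left_mono)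
  finally have "(A *v v) $ i - (A *v v) $ j \<le> (1 - \<delta>) * (v $ hi - v $ lo)"
    using up by (simp add: algebra_simps)
  also have "\<dots> \<le> (1 - \<delta>) * D"
  proof (rule mult_left_mono[OF v])
    have "A $ i $ lo \<le> 1"
      using member_le_sum[of lo UNIV "\<lambda>j. A $ i $ j"] nn row[of i] by simp
    then show "0 \<le> 1 - \<delta>" using \<delta>[of i lo] by simp
  qed
  finally show ?thesis .
qed

text \<open>New factors enter on the left, from ever more remote levels, so that the rows can
  converge; for the exit matrices the common limit of the rows is the vector
  \<open>\<pi>_\<omega>\<close> of the speed formula.\<close>

primrec past_prod :: "((int \<Rightarrow> 's) \<Rightarrow> real^'d::finite^'d) \<Rightarrow> nat \<Rightarrow> (int \<Rightarrow> 's) \<Rightarrow> real^'d^'d" where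
  "past_prod E 0 \<omega> = mat 1"
| "past_prod E (Suc n) \<omega> = E (env_shift (- 1 - int n) \<omega>) ** past_prod E n \<omega>"

text \<open>In the limit this becomes the invariance equation of the stationary
  distribution.\<close>

lemma past_prod_shift:
  "past_prod E (Suc n) (env_shift 1 \<omega>) = past_prod E n \<omega> ** E \<omega>"
  by (induction n) (simp_all add: matrix_mul_assoc)

context strip_walk
begin

text \<open>\<open>ergodic_env\<close> speaks of strictly invariant sets. The set \<open>A\<close>
  where \<open>R\<close> holds infinitely often along the forward orbit is strictly invariant and
  agrees with \<open>R\<close> almost surely.\<close>

lemma ergodic_pred:
  assumes [measurable]: "Measurable.pred P R"
    and inv: "AE \<omega> in P. R (env_shift 1 \<omega>) \<longleftrightarrow> R \<omega>"
  shows "(AE \<omega> in P. R \<omega>) \<or> (AE \<omega> in P. \<not> R \<omega>)"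
proof -
  define A where "A = {\<omega> \<in> space P. \<forall>N. \<exists>n\<ge>N. R (env_shift (int n) \<omega>)}"
  have A: "A \<in> sets P" unfolding A_def by measurable
  have "env_shift 1 -` A \<inter> space P = A"
  proof -
    have "(\<forall>N. \<exists>n\<ge>N. R (env_shift (int n + 1) \<omega>)) \<longleftrightarrow> (\<forall>N. \<exists>n\<ge>N. R (env_shift (int n) \<omega>))" for \<omega>
    proof safe
      fix N assume *: "\<forall>N. \<exists>n\<ge>N. R (env_shift (int n + 1) \<omega>)"
      then obtain n where "n \<ge> N" "R (env_shift (int n + 1) \<omega>)" by blast
      then show "\<exists>n\<ge>N. R (env_shift (int n) \<omega>)"
        by (intro exI[of _ "Suc n"]) (simp add: add.commute)
    next
      fix N assume *: "\<forall>N. \<exists>n\<ge>N. R (env_shift (int n) \<omega>)"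
      then obtain n where "n \<ge> Suc N" "R (env_shift (int n) \<omega>)" by blast
      then show "\<exists>n\<ge>N. R (env_shift (int n + 1) \<omega>)"
        by (intro exI[of _ "n - 1"]) (auto simp: of_nat_diff)
    qed
    then show ?thesis by (auto simp: A_def)
  qed
  then have "prob A = 0 \<or> prob A = 1"
    using ergodic A by (simp add: ergodic_env_def)
  moreover have "AE \<omega> in P. \<omega> \<in> A \<longleftrightarrow> R \<omega>"
  proof -
    have "AE \<omega> in P. R (env_shift (int n) \<omega>) \<longleftrightarrow> R \<omega>" for n
    proof (induction n)
      case (Suc n)
      then show ?case using AE_env_shift[OF inv, of "int n"] by eventually_elim simp
    qed simp
    then have "AE \<omega> in P. \<forall>n. R (env_shift (int n) \<omega>) \<longleftrightarrow> R \<omega>"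
      by (simp add: AE_all_countable)
    then show ?thesis using AE_space[of P] by eventually_elim (auto simp: A_def)
  qed
  moreover have "AE \<omega> in P. \<omega> \<notin> A" if "prob A = 0" using that A by (simp add: prob_eq_0)
  moreover have "AE \<omega> in P. \<omega> \<in> A" if "prob A = 1" using that A by (simp add: prob_eq_1)
  ultimately show ?thesis
  proof (elim disjE)
    assume "prob A = 0" "AE \<omega> in P. \<omega> \<in> A \<longleftrightarrow> R \<omega>" "prob A = 0 \<Longrightarrow> AE \<omega> in P. \<omega> \<notin> A"
    then have "AE \<omega> in P. \<omega> \<notin> A" "AE \<omega> in P. \<omega> \<in> A \<longleftrightarrow> R \<omega>" by auto
    then have "AE \<omega> in P. \<not> R \<omega>" by eventually_elim simp
    then show ?thesis ..
  next
    assume "prob A = 1" "AE \<omega> in P. \<omega> \<in> A \<longleftrightarrow> R \<omega>" "prob A = 1 \<Longrightarrow> AE \<omega> in P. \<omega> \<in> A"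
    then have "AE \<omega> in P. \<omega> \<in> A" "AE \<omega> in P. \<omega> \<in> A \<longleftrightarrow> R \<omega>" by auto
    then have "AE \<omega> in P. R \<omega>" by eventually_elim simp
    then show ?thesis ..
  qed
qed

text \<open>The events that \<open>f\<close> lies above or below its mean are invariant up to null
  sets, and neither can have probability one.\<close>

lemma ergodic_constant:
  fixes f :: "(int \<Rightarrow> 's) \<Rightarrow> real"
  assumes f: "integrable P f" and inv: "AE \<omega> in P. f (env_shift 1 \<omega>) = f \<omega>"
  shows "\<exists>c. AE \<omega> in P. f \<omega> = c"
proof -
  have [measurable]: "f \<in> borel_measurable P" using f by auto
  let ?c = "\<integral>\<omega>. f \<omega> \<partial>P"
  have "\<not> (AE \<omega> in P. ?c < f \<omega>)"
  proof
    assume "AE \<omega> in P. ?c < f \<omega>"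
    then have "(\<integral>\<omega>. ?c \<partial>P) < (\<integral>\<omega>. f \<omega> \<partial>P)"
      using f by (intro integral_less_AE_space) (auto simp: emeasure_space_1)
    then show False by (simp add: prob_space)
  qed
  moreover have "\<not> (AE \<omega> in P. f \<omega> < ?c)"
  proof
    assume "AE \<omega> in P. f \<omega> < ?c"
    then have "(\<integral>\<omega>. f \<omega> \<partial>P) < (\<integral>\<omega>. ?c \<partial>P)"
      using f by (intro integral_less_AE_space) (auto simp: emeasure_space_1)
    then show False by (simp add: prob_space)
  qed
  moreover have "(AE \<omega> in P. ?c < f \<omega>) \<or> (AE \<omega> in P. \<not> ?c < f \<omega>)"
    by (rule ergodic_pred) (measurable, use inv in \<open>auto elim: eventually_mono\<close>)
  moreover have "(AE \<omega> in P. f \<omega> < ?c) \<or> (AE \<omega> in P. \<not> f \<omega> < ?c)"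
    by (rule ergodic_pred) (measurable, use inv in \<open>auto elim: eventually_mono\<close>)
  ultimately have "AE \<omega> in P. \<not> ?c < f \<omega>" "AE \<omega> in P. \<not> f \<omega> < ?c" by auto
  then have "AE \<omega> in P. f \<omega> = ?c" by eventually_elim simp
  then show ?thesis ..
qed

text \<open>
  The products \<open>E (\<theta>\<^sup>-\<^sup>n \<omega>) \<dots> E (\<theta>\<^sup>-\<^sup>1 \<omega>)\<close> contract by \<open>F n = \<Prod>k=1..n. 1 - \<delta> (\<theta>\<^sup>-\<^sup>k \<omega>)\<close>. The limit \<open>f\<close> of \<open>F n\<close>
  satisfies \<open>f \<circ> \<theta> = (1 - \<delta>) * f\<close>, so \<open>\<integral> \<delta> * f = 0\<close> by stationarity, and \<open>f = 0\<close> since \<open>\<delta> > 0\<close>.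
\<close>

lemma stationary_distribution:
  fixes E :: "(int \<Rightarrow> 's) \<Rightarrow> real^'d^'d"
  assumes E_meas [measurable]: "E \<in> borel_measurable P"
    and E_stoch: "AE \<omega> in P. stochastic_matrix (E \<omega>)"
    and E_pos: "AE \<omega> in P. \<forall>i j. 0 < E \<omega> $ i $ j"
  obtains \<nu> :: "(int \<Rightarrow> 's) \<Rightarrow> 'd pmf"
  where "\<And>j. (\<lambda>\<omega>. pmf (\<nu> \<omega>) j) \<in> borel_measurable P"
    and "AE \<omega> in P. \<forall>j. pmf (\<nu> (env_shift 1 \<omega>)) j = (\<Sum>i\<in>UNIV. pmf (\<nu> \<omega>) i * E \<omega> $ i $ j)"
    and "AE \<omega> in P. \<forall>j. 0 < pmf (\<nu> \<omega>) j"
proof -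
  define W where "W \<omega> \<longleftrightarrow> (\<forall>n. stochastic_matrix (E (env_shift n \<omega>)) \<and> (\<forall>i j. 0 < E (env_shift n \<omega>) $ i $ j))" for \<omega>
  have W: "AE \<omega> in P. W \<omega>"
  proof -
    have "AE \<omega> in P. stochastic_matrix (E \<omega>) \<and> (\<forall>i j. 0 < E \<omega> $ i $ j)"
      using E_stoch E_pos by eventually_elim simp
    from AE_env_shift[OF this] show ?thesis by (simp add: W_def AE_all_countable)
  qed
  \<comment> \<open>A measurable lower bound for all entries: on \<open>W\<close> they lie between
    \<open>0\<close> and \<open>1\<close>, so their product is positive and below each of
    them.\<close>
  define \<delta> where "\<delta> \<omega> = (\<Prod>i\<in>UNIV. \<Prod>j\<in>UNIV. E \<omega> $ i $ j)" for \<omega>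
  have [measurable]: "\<delta> \<in> borel_measurable P" unfolding \<delta>_def by measurable
  have entry: "0 < E (env_shift n \<omega>) $ i $ j" "E (env_shift n \<omega>) $ i $ j \<le> 1" if "W \<omega>" for \<omega> n i j
  proof -
    show "0 < E (env_shift n \<omega>) $ i $ j" using that by (simp add: W_def)
    have "E (env_shift n \<omega>) $ i $ j \<le> (\<Sum>j\<in>UNIV. E (env_shift n \<omega>) $ i $ j)"
      using that by (intro member_le_sum) (auto simp: W_def less_imp_le)
    then show "E (env_shift n \<omega>) $ i $ j \<le> 1"
      using that by (simp add: W_def stochastic_matrix_def)
  qed
  have \<delta>: "0 < \<delta> (env_shift n \<omega>)" "\<delta> (env_shift n \<omega>) \<le> E (env_shift n \<omega>) $ i $ j" if "W \<omega>" for \<omega> n i j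
  proof -
    let ?e = "\<lambda>i j. E (env_shift n \<omega>) $ i $ j"
    show "0 < \<delta> (env_shift n \<omega>)" unfolding \<delta>_def using entry[OF that] by (intro prod_pos) auto
    have row: "0 \<le> (\<Prod>j\<in>UNIV. ?e i j)" "(\<Prod>j\<in>UNIV. ?e i j) \<le> 1" for i
      using entry[OF that] by (auto intro!: prod_nonneg prod_le_1 simp: less_imp_le)
    have "\<delta> (env_shift n \<omega>) = (\<Prod>j\<in>UNIV. ?e i j) * (\<Prod>i\<in>UNIV - {i}. \<Prod>j\<in>UNIV. ?e i j)"
      unfolding \<delta>_def by (subst prod.remove[of UNIV i]) auto
    also have "\<dots> \<le> (\<Prod>j\<in>UNIV. ?e i j)"
      using row by (intro mult_left_le prod_le_1) auto
    also have "\<dots> = ?e i j * (\<Prod>j\<in>UNIV - {j}. ?e i j)"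
      by (subst prod.remove[of UNIV j]) auto
    also have "\<dots> \<le> ?e i j"
      using entry[OF that] by (intro mult_left_le prod_le_1) (auto simp: less_imp_le)
    finally show "\<delta> (env_shift n \<omega>) \<le> ?e i j" .
  qed
  have \<delta>1: "\<delta> (env_shift n \<omega>) \<le> 1" if "W \<omega>" for \<omega> n
    using \<delta>(2)[OF that, of n undefined undefined] entry(2)[OF that, of n undefined undefined] by simp
  define F where "F n \<omega> = (\<Prod>k<n. 1 - \<delta> (env_shift (- 1 - int k) \<omega>))" for n \<omega>
  have [measurable]: "F n \<in> borel_measurable P" for n unfolding F_def by measurable
  have F01: "0 \<le> F n \<omega>" "F n \<omega> \<le> 1" "F (Suc n) \<omega> \<le> F n \<omega>" if "W \<omega>" for n \<omega>
  proof -
    show 0: "0 \<le> F n \<omega>" "F n \<omega> \<le> 1"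
      unfolding F_def using \<delta>(1)[OF that] \<delta>1[OF that] by (auto intro!: prod_nonneg prod_le_1 simp: less_imp_le)
    show "F (Suc n) \<omega> \<le> F n \<omega>"
      using mult_left_le[OF _ 0(1), of "1 - \<delta> (env_shift (- 1 - int n) \<omega>)"] \<delta>(1)[OF that, of "- 1 - int n"]
      by (simp add: F_def)
  qed
  define f where "f \<omega> = lim (\<lambda>n. F n \<omega>)" for \<omega>
  have [measurable]: "f \<in> borel_measurable P" unfolding f_def[abs_def] by measurable
  have Flim: "(\<lambda>n. F n \<omega>) \<longlonglongrightarrow> f \<omega>" if "W \<omega>" for \<omega>
  proof -
    have d: "decseq (\<lambda>n. F n \<omega>)" by (rule decseq_SucI) (rule F01(3)[OF that])
    have "\<forall>n. 0 \<le> F n \<omega>" using F01(1)[OF that] by blast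
    then obtain L where "(\<lambda>n. F n \<omega>) \<longlonglongrightarrow> L"
      by (rule decseq_convergent[OF d])
    then show ?thesis by (simp add: f_def limI)
  qed
  have f01: "0 \<le> f \<omega>" "f \<omega> \<le> 1" if "W \<omega>" for \<omega>
    using LIMSEQ_le_const[OF Flim[OF that]] LIMSEQ_le_const2[OF Flim[OF that]] F01[OF that] by blast+
  have f_shift: "f (env_shift 1 \<omega>) = f \<omega> - \<delta> \<omega> * f \<omega>" if "W \<omega>" for \<omega>
  proof -
    have "F (Suc n) (env_shift 1 \<omega>) = (1 - \<delta> \<omega>) * F n \<omega>" for n
      unfolding F_def by (subst prod.lessThan_Suc_shift) (simp add: algebra_simps)
    then have "(\<lambda>n. F (Suc n) (env_shift 1 \<omega>)) \<longlonglongrightarrow> (1 - \<delta> \<omega>) * f \<omega>"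
      using tendsto_mult_left[OF Flim[OF that]] by simp
    then have "(\<lambda>n. F n (env_shift 1 \<omega>)) \<longlonglongrightarrow> (1 - \<delta> \<omega>) * f \<omega>"
      by (rule LIMSEQ_imp_Suc)
    then show ?thesis by (simp add: f_def[of "env_shift 1 \<omega>"] limI algebra_simps)
  qed
  have f_int: "integrable P f" "integrable P (\<lambda>\<omega>. \<delta> \<omega> * f \<omega>)"
  proof -
    show "integrable P f"
      by (rule integrable_const_bound[where B=1]) (use W in eventually_elim, use f01 in auto)
    show "integrable P (\<lambda>\<omega>. \<delta> \<omega> * f \<omega>)"
    proof (rule integrable_const_bound[where B=1])
      show "AE \<omega> in P. norm (\<delta> \<omega> * f \<omega>) \<le> 1"
        using W
      proof eventually_elim
        case (elim \<omega>)
        then show ?case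
          using \<delta>(1)[OF elim, of 0] \<delta>1[OF elim, of 0] f01[OF elim] by (simp add: mult_le_one)
      qed
    qed measurable
  qed
  have "(\<integral>\<omega>. f (env_shift 1 \<omega>) \<partial>P) = (\<integral>\<omega>. f \<omega> - \<delta> \<omega> * f \<omega> \<partial>P)"
    by (rule integral_cong_AE) (measurable, use W in eventually_elim, rule f_shift)
  then have "(\<integral>\<omega>. \<delta> \<omega> * f \<omega> \<partial>P) = 0"
    using f_int by (simp add: integral_env_shift)
  moreover have "AE \<omega> in P. 0 \<le> \<delta> \<omega> * f \<omega>"
    using W
  proof eventually_elim
    case (elim \<omega>)
    then show ?case using \<delta>(1)[OF elim, of 0] f01[OF elim] by simp
  qed
  ultimately have "AE \<omega> in P. \<delta> \<omega> * f \<omega> = 0"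
    using integral_nonneg_eq_0_iff_AE[OF f_int(2)] by blast
  then have good: "AE \<omega> in P. W \<omega> \<and> f \<omega> = 0"
    using W
  proof eventually_elim
    case (elim \<omega>)
    then show ?case using \<delta>(1)[OF elim(2), of 0] by simp
  qed
  let ?Pr = "past_prod E"
  have osc: "?Pr n \<omega> $ i $ l - ?Pr n \<omega> $ j $ l \<le> F n \<omega>" if "W \<omega>" for n \<omega> i j l
  proof (induction n arbitrary: i j)
    case 0
    show ?case by (simp add: F_def mat_def)
  next
    case (Suc n)
    have col: "?Pr (Suc n) \<omega> $ i $ l = (E (env_shift (- 1 - int n) \<omega>) *v column l (?Pr n \<omega>)) $ i" for i
      by (simp add: matrix_matrix_mult_def matrix_vector_mult_def column_def)
    have "?Pr (Suc n) \<omega> $ i $ l - ?Pr (Suc n) \<omega> $ j $ l \<le> (1 - \<delta> (env_shift (- 1 - int n) \<omega>)) * F n \<omega>"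
      unfolding col using Suc \<delta>(2)[OF that] that
      by (intro stochastic_matrix_contraction) (auto simp: W_def column_def)
    then show ?case by (simp add: F_def mult.commute)
  qed
  \<comment> \<open>Rows of a longer product are convex combinations of rows of the shorter one,
    which differ by at most \<open>F n\<close>.\<close>
  have near: "\<bar>?Pr (n + m) \<omega> $ i $ l - ?Pr n \<omega> $ j $ l\<bar> \<le> F n \<omega>" if "W \<omega>" for n m \<omega> i j l
  proof (induction m arbitrary: i)
    case 0
    show ?case using osc[OF that, of n i l j] osc[OF that, of n j l i] by simp
  next
    case (Suc m)
    let ?E = "E (env_shift (- 1 - int (n + m)) \<omega>)"
    have st: "(\<Sum>k\<in>UNIV. ?E $ i $ k) = 1" "0 \<le> ?E $ i $ k" for k
      using that by (auto simp: W_def stochastic_matrix_def less_imp_le)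
    have "?Pr (n + Suc m) \<omega> $ i $ l - ?Pr n \<omega> $ j $ l =
        (\<Sum>k\<in>UNIV. ?E $ i $ k * (?Pr (n + m) \<omega> $ k $ l - ?Pr n \<omega> $ j $ l))"
      using st by (simp add: matrix_matrix_mult_def right_diff_distrib sum_subtractf flip: sum_distrib_right)
    also have "\<bar>\<dots>\<bar> \<le> (\<Sum>k\<in>UNIV. \<bar>?E $ i $ k * (?Pr (n + m) \<omega> $ k $ l - ?Pr n \<omega> $ j $ l)\<bar>)"
      by (rule sum_abs)
    also have "\<dots> \<le> (\<Sum>k\<in>UNIV. ?E $ i $ k * F n \<omega>)"
      using st Suc by (intro sum_mono) (auto simp: abs_mult intro!: mult_left_mono)
    also have "\<dots> = F n \<omega>" using st by (simp flip: sum_distrib_right)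
    finally show ?case .
  qed
  \<comment> \<open>Any fixed row would do, since the rows merge as \<open>F n\<close> tends to
    \<open>0\<close>.\<close>
  define \<pi> where "\<pi> \<omega> j = lim (\<lambda>n. ?Pr n \<omega> $ undefined $ j)" for \<omega> j
  have [measurable]: "?Pr n \<in> borel_measurable P" for n
    by (induction n) (simp_all add: past_prod.simps[abs_def])
  have [measurable]: "(\<lambda>\<omega>. \<pi> \<omega> j) \<in> borel_measurable P" for j
    unfolding \<pi>_def by measurable
  have \<pi>lim: "(\<lambda>n. ?Pr n \<omega> $ undefined $ j) \<longlonglongrightarrow> \<pi> \<omega> j" if "W \<omega> \<and> f \<omega> = 0" for \<omega> j
  proof -
    have "Cauchy (\<lambda>n. ?Pr n \<omega> $ undefined $ j)"
    proof (rule CauchyI')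
      fix e :: real assume "0 < e"
      then have "W \<omega>" "f \<omega> < e" using that by auto
      then obtain M where M: "\<forall>n\<ge>M. F n \<omega> < e"
        using order_tendstoD(2)[OF Flim, of \<omega> e] by (auto simp: eventually_sequentially)
      have "dist (?Pr m \<omega> $ undefined $ j) (?Pr n \<omega> $ undefined $ j) < e" if "m \<ge> M" "n > m" for m n
        using near[of \<omega> m "n - m" undefined j undefined] \<open>W \<omega> \<and> f \<omega> = 0\<close> M that by (force simp: dist_real_def abs_minus_commute)
      then show "\<exists>M. \<forall>m\<ge>M. \<forall>n>m. dist (?Pr m \<omega> $ undefined $ j) (?Pr n \<omega> $ undefined $ j) < e"
        by blast
    qed
    then show ?thesis
      unfolding \<pi>_def using Cauchy_convergent convergent_LIMSEQ_iff by blast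
  qed
  have Pr_stoch: "stochastic_matrix (?Pr n \<omega>)" if "W \<omega>" for n \<omega>
    using that by (induction n)
      (auto simp: W_def intro!: stochastic_matrix_mult, simp add: stochastic_matrix_def nonneg_matrix_def mat_def)
  have \<pi>_nonneg: "0 \<le> \<pi> \<omega> j" if "W \<omega> \<and> f \<omega> = 0" for \<omega> j
    using Pr_stoch that
    by (intro LIMSEQ_le_const[OF \<pi>lim[OF that]]) (auto simp: stochastic_matrix_def nonneg_matrix_def)
  have \<pi>_sum: "(\<Sum>j\<in>UNIV. \<pi> \<omega> j) = 1" if "W \<omega> \<and> f \<omega> = 0" for \<omega>
  proof -
    have "(\<lambda>n. \<Sum>j\<in>UNIV. ?Pr n \<omega> $ undefined $ j) \<longlonglongrightarrow> (\<Sum>j\<in>UNIV. \<pi> \<omega> j)"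
      by (intro tendsto_sum \<pi>lim that)
    then have "(\<lambda>n. 1) \<longlonglongrightarrow> (\<Sum>j\<in>UNIV. \<pi> \<omega> j)"
      using Pr_stoch that by (simp add: stochastic_matrix_def)
    from LIMSEQ_unique[OF this tendsto_const] show ?thesis by simp
  qed
  have \<pi>_shift: "\<pi> (env_shift 1 \<omega>) j = (\<Sum>i\<in>UNIV. \<pi> \<omega> i * E \<omega> $ i $ j)" if "W \<omega> \<and> f \<omega> = 0" for \<omega> j
  proof -
    have "(\<lambda>n. \<Sum>i\<in>UNIV. ?Pr n \<omega> $ undefined $ i * E \<omega> $ i $ j) \<longlonglongrightarrow> (\<Sum>i\<in>UNIV. \<pi> \<omega> i * E \<omega> $ i $ j)"
      by (intro tendsto_sum tendsto_mult \<pi>lim that tendsto_const)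
    then have "(\<lambda>n. ?Pr (Suc n) (env_shift 1 \<omega>) $ undefined $ j) \<longlonglongrightarrow> (\<Sum>i\<in>UNIV. \<pi> \<omega> i * E \<omega> $ i $ j)"
      unfolding past_prod_shift by (simp add: matrix_matrix_mult_def)
    then show ?thesis
      unfolding \<pi>_def[of "env_shift 1 \<omega>"] by (intro limI) (rule LIMSEQ_imp_Suc)
  qed
  \<comment> \<open>Off \<open>V\<close> the limits need not form a probability vector; a point mass
    replaces them there and keeps \<open>\<nu>\<close> measurable.\<close>
  define V where "V \<omega> \<longleftrightarrow> (\<forall>j. 0 \<le> \<pi> \<omega> j) \<and> (\<Sum>j\<in>UNIV. \<pi> \<omega> j) = 1" for \<omega>
  define \<nu> where "\<nu> \<omega> = (if V \<omega> then embed_pmf (\<pi> \<omega>) else return_pmf undefined)" for \<omega>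
  have pmf: "pmf (\<nu> \<omega>) j = (if V \<omega> then \<pi> \<omega> j else pmf (return_pmf undefined) j)" for \<omega> j
  proof (cases "V \<omega>")
    case True
    have "(\<integral>\<^sup>+j. ennreal (\<pi> \<omega> j) \<partial>count_space UNIV) = 1"
      using True by (simp add: V_def nn_integral_count_space_finite sum_ennreal)
    then show ?thesis using True by (simp add: \<nu>_def V_def pmf_embed_pmf)
  qed (simp add: \<nu>_def)
  have V: "AE \<omega> in P. V \<omega>"
    using good by eventually_elim (simp add: V_def \<pi>_nonneg \<pi>_sum)
  have V_shift: "AE \<omega> in P. V (env_shift 1 \<omega>)"
    by (rule AE_env_shift[OF V])
  have [measurable]: "Measurable.pred P V" unfolding V_def by measurable
  show ?thesis
  proof (rule that[of \<nu>])
    show "(\<lambda>\<omega>. pmf (\<nu> \<omega>) j) \<in> borel_measurable P" for j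
      unfolding pmf by measurable
    show "AE \<omega> in P. \<forall>j. pmf (\<nu> (env_shift 1 \<omega>)) j = (\<Sum>i\<in>UNIV. pmf (\<nu> \<omega>) i * E \<omega> $ i $ j)"
      using good V V_shift by eventually_elim (simp add: pmf \<pi>_shift)
    \<comment> \<open>Positivity is visible one level later: some state has positive mass and
      \<open>E\<close> spreads it to all states. Stationarity then moves the statement back.\<close>
    have "AE \<omega> in P. \<forall>j. 0 < pmf (\<nu> (env_shift 1 \<omega>)) j"
      using good V_shift
    proof eventually_elim
      case (elim \<omega>)
      show ?case
      proof
        fix j
        obtain k where "\<pi> \<omega> k \<noteq> 0" using \<pi>_sum[OF elim(1)] by (metis sum.neutral zero_neq_one)
        then have "0 < \<pi> \<omega> k * E \<omega> $ k $ j"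
          using \<pi>_nonneg[OF elim(1), of k] entry(1)[of \<omega> 0 k j] elim(1) by simp
        also have "\<dots> \<le> (\<Sum>i\<in>UNIV. \<pi> \<omega> i * E \<omega> $ i $ j)"
          using \<pi>_nonneg[OF elim(1)] entry(1)[of \<omega> 0] elim(1)
          by (intro member_le_sum) (auto simp: less_imp_le)
        finally show "0 < pmf (\<nu> (env_shift 1 \<omega>)) j"
          using elim by (simp add: pmf \<pi>_shift)
      qed
    qed
    from AE_env_shift[OF this, of "- 1"] show "AE \<omega> in P. \<forall>j. 0 < pmf (\<nu> \<omega>) j" by simp
  qed
qed

end

section \<open>Tail events\<close>

text \<open>The interface between the mean bound, where \<open>\<zeta>\<close> is used, and the
  ergodic argument, which is fed only with the finite mean of \<open>T 1\<close> and the positivity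
  of the exit matrix.\<close>

locale strip_walk_hitting = strip_walk P S p q r
  for P :: "(int \<Rightarrow> 's) measure" and S and p q r :: "'s \<Rightarrow> real^'d::finite^'d" +
  assumes mean_hit: "\<And>i. (\<integral>\<^sup>+\<omega>. (\<Sum>s. ennreal (avoid_prob \<omega> 1 i s)) \<partial>P) < \<infinity>"
    and eta_pos: "\<And>i j. AE \<omega> in P. eta p q r 0 \<omega> $ i $ j > 0"
begin

abbreviation "exit_matrix \<equiv> eta p q r 0"

lemma exit_matrix_entry:
  "exit_matrix \<omega> $ i $ j = measure (walk_law \<omega> i) {x. hits 1 x \<and> snd (x (first_hit 1 x)) = j}"
proof -
  have "{x :: nat \<Rightarrow> int \<times> 'd. hit_time 1 x < \<infinity> \<and> snd (x (the_enat (hit_time 1 x))) = j} =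
      {x. hits 1 x \<and> snd (x (first_hit 1 x)) = j}"
    by (auto simp: hit_time_eq)
  then show ?thesis by (simp add: eta_def walk_law_def)
qed

lemma strong_Markov_sum:
  assumes \<omega>: "\<omega> \<in> space P" and B: "B \<in> sets path_space" and C: "C \<in> sets path_space"
    and E: "\<And>x y. hits m x \<Longrightarrow> (\<And>s. s \<le> first_hit m x \<Longrightarrow> x s = y s) \<Longrightarrow> x \<in> C \<Longrightarrow> y \<in> C"
  shows "measure (walk_law \<omega> i) {x \<in> C. hits m x \<and> after_hit m x \<in> B} =
    (\<Sum>j\<in>UNIV. measure (walk_law \<omega> i) {x \<in> C. hits m x \<and> snd (x (first_hit m x)) = j} *
      measure (walk_law (env_shift m \<omega>) j) B)"
proof -
  note [measurable] = B C
  let ?D = "\<lambda>j. {x \<in> C. hits m x \<and> snd (x (first_hit m x)) = j \<and> after_hit m x \<in> B}"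
  have D: "?D j \<in> sets path_space" for j
  proof -
    have "{x \<in> space path_space. x \<in> C \<and> hits m x \<and> snd (x (first_hit m x)) = j \<and> after_hit m x \<in> B} \<in> sets path_space"
      by measurable
    then show ?thesis by simp
  qed
  have "{x \<in> C. hits m x \<and> after_hit m x \<in> B} = (\<Union>j. ?D j)" by auto
  also have "measure (walk_law \<omega> i) \<dots> = (\<Sum>j\<in>UNIV. measure (walk_law \<omega> i) (?D j))"
    using D by (intro walk.finite_measure_finite_Union) (auto simp: disjoint_family_on_def)
  also have "\<dots> = (\<Sum>j\<in>UNIV. measure (walk_law \<omega> i) {x \<in> C. hits m x \<and> snd (x (first_hit m x)) = j} *
      measure (walk_law (env_shift m \<omega>) j) B)"
    using E by (intro sum.cong refl walk_law_strong_Markov[OF \<omega> B C]) blast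
  finally show ?thesis .
qed

lemma exit_matrix_Markov:
  assumes "\<omega> \<in> space P" "B \<in> sets path_space"
  shows "measure (walk_law \<omega> i) {x. hits 1 x \<and> after_hit 1 x \<in> B} =
    (\<Sum>j\<in>UNIV. exit_matrix \<omega> $ i $ j * measure (walk_law (env_shift 1 \<omega>) j) B)"
  using strong_Markov_sum[OF assms, of UNIV 1 i] sets.top[of path_space]
  by (simp add: exit_matrix_entry)

text \<open>The tails of a finite mean tend to \<open>0\<close>, and each of them bounds the
  probability that level \<open>1\<close> is never reached.\<close>

lemma AE_hits_1: "AE \<omega> in P. \<forall>i. AE x in walk_law \<omega> i. hits 1 x"
proof -
  have "AE \<omega> in P. AE x in walk_law \<omega> i. hits 1 x" for i
  proof -
    have "AE \<omega> in P. (\<Sum>s. ennreal (avoid_prob \<omega> 1 i s)) \<noteq> \<infinity>"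
      using mean_hit[of i] by (intro nn_integral_noteq_infinite) auto
    then show ?thesis
    proof eventually_elim
      case (elim \<omega>)
      have "summable (avoid_prob \<omega> 1 i)"
        using elim by (intro summable_suminf_not_top) (auto simp: avoid_prob_def)
      then have lim: "avoid_prob \<omega> 1 i \<longlonglongrightarrow> 0" by (rule summable_LIMSEQ_zero)
      have sets: "{x. \<not> hits 1 x} \<in> sets (walk_law \<omega> i)"
      proof -
        have "{x \<in> space path_space. \<not> hits 1 (x :: nat \<Rightarrow> int \<times> 'd)} \<in> sets path_space" by measurable
        then show ?thesis by simp
      qed
      have "measure (walk_law \<omega> i) {x. \<not> hits 1 x} \<le> avoid_prob \<omega> 1 i s" for s
        unfolding avoid_prob_def
        by (intro walk.finite_measure_mono) (auto simp: hits_def)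
      then have "measure (walk_law \<omega> i) {x. \<not> hits 1 x} \<le> 0"
        by (intro LIMSEQ_le_const[OF lim]) auto
      then have "measure (walk_law \<omega> i) {x. \<not> hits 1 x} = 0" by (simp add: measure_le_0_iff)
      then show ?case using sets by (simp add: walk.prob_eq_0)
    qed
  qed
  then show ?thesis by (simp add: AE_all_countable)
qed

text \<open>All shifts are included because a path restarted at level \<open>n\<close> sees
  \<open>env_shift n \<omega>\<close>.\<close>

definition transient_env :: "(int \<Rightarrow> 's) \<Rightarrow> bool" where
  "transient_env \<omega> \<longleftrightarrow> \<omega> \<in> space P \<and> (\<forall>n i. AE x in walk_law (env_shift n \<omega>) i. transient_path x)"

text \<open>Induction on the level: restarted at level \<open>1\<close>, the path lives in the
  shifted environment and almost surely climbs \<open>m\<close> further levels.\<close>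

lemma AE_transient_env: "AE \<omega> in P. transient_env \<omega>"
proof -
  have hit: "AE \<omega> in P. \<forall>i. AE x in walk_law \<omega> i. hits (int m) x" for m
  proof (induction m)
    case 0
    show ?case
      using AE_space[of P]
    proof eventually_elim
      case (elim \<omega>)
      show ?case
      proof
        fix i
        show "AE x in walk_law \<omega> i. hits (int 0) x"
          using AE_walk_law_path[OF elim, of i] by eventually_elim (auto simp: hits_def intro: exI[of _ 0])
      qed
    qed
  next
    case (Suc m)
    show ?case
      using AE_space[of P] AE_hits_1 AE_env_shift[OF Suc, of 1]
    proof eventually_elim
      case (elim \<omega>)
      let ?B = "{y :: nat \<Rightarrow> int \<times> 'd. hits (int m) y}"
      have B: "?B \<in> sets path_space"
      proof -
        have "{x \<in> space path_space. hits (int m) (x :: nat \<Rightarrow> int \<times> 'd)} \<in> sets path_space" by measurable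
        then show ?thesis by simp
      qed
      have "measure (walk_law (env_shift 1 \<omega>) j) ?B = 1" for j
        using elim(3) B by (subst walk.prob_eq_1) auto
      moreover have "measure (walk_law (env_shift 1 \<omega>) j) UNIV = 1" for j
        using walk.prob_space by simp
      ultimately have "measure (walk_law \<omega> i) {x. hits 1 x \<and> after_hit 1 x \<in> ?B} =
          measure (walk_law \<omega> i) {x. hits 1 x \<and> after_hit 1 x \<in> UNIV}" for i
        by (simp only: exit_matrix_Markov[OF elim(1) B] exit_matrix_Markov[OF elim(1) sets.top[of path_space, simplified]])
      moreover have meas: "{x. hits 1 x \<and> after_hit 1 x \<in> D} \<in> sets path_space" if [measurable]: "D \<in> sets path_space"
        for D :: "(nat \<Rightarrow> int \<times> 'd) set"
      proof -
        have "{x \<in> space path_space. hits 1 x \<and> after_hit 1 x \<in> D} \<in> sets path_space" by measurable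
        then show ?thesis by simp
      qed
      moreover have "measure (walk_law \<omega> i) {x. hits 1 x \<and> after_hit 1 x \<in> UNIV} = 1" for i
        using elim(2) meas[of UNIV] sets.top[of path_space] by (subst walk.prob_eq_1) auto
      ultimately have "AE x in walk_law \<omega> i. x \<in> {x. hits 1 x \<and> after_hit 1 x \<in> ?B}" for i
        using meas[OF B] by (subst walk.prob_eq_1[symmetric]) auto
      then have "AE x in walk_law \<omega> i. hits (int (Suc m)) x" for i
        by eventually_elim (auto simp: hits_def after_hit_def recenter_def algebra_simps)
      then show ?case by blast
    qed
  qed
  then have "AE \<omega> in P. \<forall>m i. AE x in walk_law \<omega> i. hits (int m) x"
    by (simp add: AE_all_countable)
  then have "AE \<omega> in P. \<forall>i. AE x in walk_law \<omega> i. transient_path x"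
    using AE_space[of P]
  proof eventually_elim
    case (elim \<omega>)
    show ?case
    proof
      fix i
      have "AE x in walk_law \<omega> i. \<forall>m. hits (int m) x" using elim(1) by (simp add: AE_all_countable)
      then show "AE x in walk_law \<omega> i. transient_path x"
        using AE_walk_law_path[OF elim(2), of i]
        by eventually_elim (simp add: transient_path_def skip_free_def)
    qed
  qed
  from AE_env_shift[OF this] have "AE \<omega> in P. \<forall>n i. AE x in walk_law (env_shift n \<omega>) i. transient_path x"
    by (simp add: AE_all_countable)
  then show ?thesis using AE_space[of P] by eventually_elim (simp add: transient_env_def)
qed

lemma transient_env_walk: "transient_env \<omega> \<Longrightarrow> AE x in walk_law \<omega> i. transient_path x"
  unfolding transient_env_def by (metis env_shift_0)

lemma transient_env_space: "transient_env \<omega> \<Longrightarrow> \<omega> \<in> space P"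
  by (simp add: transient_env_def)

lemma exit_matrix_harmonic:
  assumes good: "transient_env \<omega>" and B: "B \<in> sets path_space"
  shows "measure (walk_law \<omega> i) {x. after_hit 1 x \<in> B} =
    (\<Sum>j\<in>UNIV. exit_matrix \<omega> $ i $ j * measure (walk_law (env_shift 1 \<omega>) j) B)"
proof -
  note [measurable] = B
  have "measure (walk_law \<omega> i) {x. after_hit 1 x \<in> B} = measure (walk_law \<omega> i) {x. hits 1 x \<and> after_hit 1 x \<in> B}"
  proof (rule measure_eq_AE)
    show "AE x in walk_law \<omega> i. (x \<in> {x. after_hit 1 x \<in> B}) = (x \<in> {x. hits 1 x \<and> after_hit 1 x \<in> B})"
      using transient_env_walk[OF good] unfolding transient_path_def
      by eventually_elim (metis (mono_tags, lifting) mem_Collect_eq of_nat_1)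
    have "{x \<in> space path_space. after_hit 1 x \<in> B} \<in> sets path_space"
      "{x \<in> space path_space. hits 1 x \<and> after_hit 1 x \<in> B} \<in> sets path_space"
      by measurable
    then show "{x. after_hit 1 x \<in> B} \<in> sets (walk_law \<omega> i)"
      "{x. hits 1 x \<and> after_hit 1 x \<in> B} \<in> sets (walk_law \<omega> i)" by simp_all
  qed
  then show ?thesis using exit_matrix_Markov[OF transient_env_space[OF good] B] by simp
qed

lemma exit_matrix_stochastic:
  assumes "transient_env \<omega>"
  shows "stochastic_matrix (exit_matrix \<omega>)"
proof -
  have "(\<Sum>j\<in>UNIV. exit_matrix \<omega> $ i $ j) = 1" for i
    using exit_matrix_harmonic[OF assms sets.top[of path_space], of i] walk.prob_space by simp
  then show ?thesis
    by (simp add: stochastic_matrix_def nonneg_matrix_def exit_matrix_entry)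
qed

lemma measurable_exit_matrix [measurable]: "exit_matrix \<in> borel_measurable P"
proof -
  have "(\<lambda>\<omega>. exit_matrix \<omega> $ i $ j) \<in> borel_measurable P" for i j
  proof -
    have "{x \<in> space path_space. hits 1 x \<and> snd (x (first_hit 1 x)) = (j :: 'd)} \<in> sets path_space"
      by measurable
    then show ?thesis by (simp add: exit_matrix_entry measurable_walk_law_measure)
  qed
  then show ?thesis
    by (subst borel_measurable_euclidean_space) (auto simp: Basis_vec_def inner_axis)
qed

lemma AE_exit_matrix_pos: "AE \<omega> in P. \<forall>i j. 0 < exit_matrix \<omega> $ i $ j"
  using eta_pos by (simp add: AE_all_countable)

text \<open>The probabilities of a tail event are harmonic, so their maximum over the starting layer
  is subinvariant, hence invariant, and the positivity of the exit matrix spreads it to all states.\<close>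

lemma tail_prob_constant:
  assumes B: "B \<in> sets path_space"
    and tail: "\<And>x m. transient_path x \<Longrightarrow> after_hit (int m) x \<in> B \<longleftrightarrow> x \<in> B"
  obtains c where "AE \<omega> in P. \<forall>i. measure (walk_law \<omega> i) B = c"
proof -
  define f where "f \<omega> i = measure (walk_law \<omega> i) B" for \<omega> i
  define F where "F \<omega> = Max ((\<lambda>i. f \<omega> i) ` UNIV)" for \<omega>
  note [measurable] = B
  have [measurable]: "(\<lambda>\<omega>. f \<omega> i) \<in> borel_measurable P" for i
    unfolding f_def by measurable
  have [measurable]: "F \<in> borel_measurable P" unfolding F_def by measurable
  have fF: "f \<omega> i \<le> F \<omega>" for \<omega> i unfolding F_def by (intro Max_ge) auto
  have F_ex: "\<exists>i. F \<omega> = f \<omega> i" for \<omega>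
  proof -
    have "F \<omega> \<in> (\<lambda>i. f \<omega> i) ` UNIV" unfolding F_def by (rule Max_in) auto
    then show ?thesis by blast
  qed
  have f01: "0 \<le> f \<omega> i" "f \<omega> i \<le> 1" for \<omega> i by (auto simp: f_def)
  have F01: "0 \<le> F \<omega>" "F \<omega> \<le> 1" for \<omega>
    using F_ex[of \<omega>] f01 by auto
  have F_int: "integrable P F"
    by (rule integrable_const_bound[where B=1]) (use F01 in auto)
  have Fs_int: "integrable P (\<lambda>\<omega>. F (env_shift 1 \<omega>))"
    by (rule integrable_const_bound[where B=1]) (use F01 in auto)
  have harm: "f \<omega> i = (\<Sum>j\<in>UNIV. exit_matrix \<omega> $ i $ j * f (env_shift 1 \<omega>) j)" if "transient_env \<omega>" for \<omega> i
  proof -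
    have "f \<omega> i = measure (walk_law \<omega> i) {x. after_hit 1 x \<in> B}"
      unfolding f_def
    proof (rule measure_eq_AE)
      show "AE x in walk_law \<omega> i. (x \<in> B) = (x \<in> {x. after_hit 1 x \<in> B})"
        using transient_env_walk[OF that] by eventually_elim (use tail[of _ 1] in simp)
      have "{x \<in> space path_space. after_hit 1 x \<in> B} \<in> sets path_space" by measurable
      then show "{x. after_hit 1 x \<in> B} \<in> sets (walk_law \<omega> i)" by simp
    qed simp
    then show ?thesis using exit_matrix_harmonic[OF that B] by (simp add: f_def)
  qed
  have gap: "F (env_shift 1 \<omega>) - f \<omega> i = (\<Sum>j\<in>UNIV. exit_matrix \<omega> $ i $ j * (F (env_shift 1 \<omega>) - f (env_shift 1 \<omega>) j))"
    if "transient_env \<omega>" for \<omega> i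
  proof -
    have "(\<Sum>j\<in>UNIV. exit_matrix \<omega> $ i $ j) = 1"
      using exit_matrix_stochastic[OF that] by (simp add: stochastic_matrix_def)
    then show ?thesis
      by (simp add: harm[OF that] right_diff_distrib sum_subtractf flip: sum_distrib_right)
  qed
  have enn: "0 \<le> exit_matrix \<omega> $ i $ j" for \<omega> i j by (simp add: exit_matrix_entry)
  \<comment> \<open>At a maximizing \<open>i\<close> the right side of \<open>gap\<close> is
    nonnegative. By stationarity the increment of \<open>F\<close> has mean \<open>0\<close>, so it
    vanishes almost surely.\<close>
  have F_le: "AE \<omega> in P. 0 \<le> F (env_shift 1 \<omega>) - F \<omega>"
    using AE_transient_env
  proof eventually_elim
    case (elim \<omega>)
    obtain i where "F \<omega> = f \<omega> i" using F_ex by blast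
    then show ?case using gap[OF elim, of i] fF enn by (simp add: sum_nonneg)
  qed
  have "(\<integral>\<omega>. F (env_shift 1 \<omega>) - F \<omega> \<partial>P) = 0"
    using F_int Fs_int by (simp add: integral_env_shift)
  then have F_inv: "AE \<omega> in P. F (env_shift 1 \<omega>) - F \<omega> = 0"
    using integral_nonneg_eq_0_iff_AE[OF _ F_le] F_int Fs_int by simp
  then have "AE \<omega> in P. F (env_shift 1 \<omega>) = F \<omega>" by eventually_elim simp
  then obtain c where c: "AE \<omega> in P. F \<omega> = c"
    using ergodic_constant[OF F_int] by blast
  have "AE \<omega> in P. \<forall>j. f (env_shift 1 \<omega>) j = c"
    using AE_transient_env AE_exit_matrix_pos F_inv c
  proof eventually_elim
    case (elim \<omega>)
    obtain i where "F \<omega> = f \<omega> i" using F_ex by blast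
    \<comment> \<open>A vanishing sum of nonnegative terms with positive weights: every state
      attains the maximum.\<close>
    then have "(\<Sum>j\<in>UNIV. exit_matrix \<omega> $ i $ j * (F (env_shift 1 \<omega>) - f (env_shift 1 \<omega>) j)) = 0"
      using gap[OF elim(1), of i] elim by simp
    then have "exit_matrix \<omega> $ i $ j * (F (env_shift 1 \<omega>) - f (env_shift 1 \<omega>) j) = 0" for j
      using fF enn by (subst (asm) sum_nonneg_eq_0_iff) auto
    moreover have "exit_matrix \<omega> $ i $ j \<noteq> 0" for j using elim(2) by (metis less_irrefl)
    ultimately show ?case using elim by simp
  qed
  from AE_env_shift[OF this, of "- 1"] show ?thesis
    by (intro that[of c]) (simp add: f_def)
qed

text \<open>A tail event has the same conditional probability given any initial piece of the path, so it
  is independent of itself.\<close>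

lemma tail_zero_one:
  assumes B: "B \<in> sets path_space"
    and tail: "\<And>x m. transient_path x \<Longrightarrow> after_hit (int m) x \<in> B \<longleftrightarrow> x \<in> B"
  obtains c where "c \<in> {0, 1}" "AE \<omega> in P. \<forall>i. measure (walk_law \<omega> i) B = c"
proof -
  obtain c where c: "AE \<omega> in P. \<forall>i. measure (walk_law \<omega> i) B = c"
    using tail_prob_constant[OF assms] .
  have "AE \<omega> in P. \<forall>n i. measure (walk_law (env_shift n \<omega>) i) B = c"
    using AE_env_shift[OF c] by (simp add: AE_all_countable)
  with AE_transient_env have "AE \<omega> in P. transient_env \<omega> \<and> (\<forall>n i. measure (walk_law (env_shift n \<omega>) i) B = c)"
    by eventually_elim simp
  \<comment> \<open>One typical environment suffices, because \<open>c\<close> no longer depends on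
    it; the rest concerns a single quenched law.\<close>
  then have "\<exists>\<omega>. transient_env \<omega> \<and> (\<forall>n i. measure (walk_law (env_shift n \<omega>) i) B = c)"
    by (rule eventually_happens'[OF ae_filter_bot])
  then obtain \<omega> where good: "transient_env \<omega>" and c': "\<And>n i. measure (walk_law (env_shift n \<omega>) i) B = c"
    by blast
  define i :: 'd where "i = undefined"
  note [measurable] = B
  have cyl: "measure (walk_law \<omega> i) ({x. \<forall>t\<le>n. x t = z t} \<inter> B) = c * measure (walk_law \<omega> i) {x. \<forall>t\<le>n. x t = z t}"
    for n :: nat and z :: "nat \<Rightarrow> int \<times> 'd"
  proof -
    \<comment> \<open>A skip-free path needs at least \<open>n\<close> steps to reach level
      \<open>n\<close>, so the cylinder is decided by the time of that visit.\<close>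
    define m where "m = int n"
    let ?Z = "{x :: nat \<Rightarrow> int \<times> 'd. \<forall>t\<le>n. x t = z t}"
    \<comment> \<open>The extra condition makes \<open>C\<close> decided by the path up to the visit
      of \<open>m\<close> for every path, skip-free or not, as \<open>strong_Markov_sum\<close>
      requires.\<close>
    define C where "C = {x \<in> ?Z. n \<le> first_hit m x}"
    have Z[measurable]: "?Z \<in> sets path_space" by (rule cylinder_in_sets)
    have C[measurable]: "C \<in> sets path_space"
    proof -
      have "{x \<in> space path_space. x \<in> ?Z \<and> n \<le> first_hit m x} \<in> sets path_space" by measurable
      then show ?thesis by (simp add: C_def)
    qed
    have ZC: "AE x in walk_law \<omega> i. x \<in> ?Z \<longleftrightarrow> x \<in> C \<and> hits m x"
      using transient_env_walk[OF good]
    proof eventually_elim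
      case (elim x)
      then have "hits m x" "skip_free x" by (auto simp: transient_path_def m_def)
      then show ?case using first_hit_ge[of x m] by (auto simp: C_def m_def)
    qed
    have Csets: "{x \<in> C. hits m x \<and> after_hit m x \<in> D} \<in> sets path_space" if [measurable]: "D \<in> sets path_space" for D
    proof -
      have "{x \<in> space path_space. x \<in> C \<and> hits m x \<and> after_hit m x \<in> D} \<in> sets path_space" by measurable
      then show ?thesis by simp
    qed
    have CM: "measure (walk_law \<omega> i) {x \<in> C. hits m x \<and> after_hit m x \<in> D} =
        (\<Sum>j\<in>UNIV. measure (walk_law \<omega> i) {x \<in> C. hits m x \<and> snd (x (first_hit m x)) = j} *
          measure (walk_law (env_shift m \<omega>) j) D)" if D: "D \<in> sets path_space" for D
    proof (rule strong_Markov_sum[OF transient_env_space[OF good] D C])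
      fix x y :: "nat \<Rightarrow> int \<times> 'd"
      assume h: "hits m x" and eq: "\<And>s. s \<le> first_hit m x \<Longrightarrow> x s = y s" and x: "x \<in> C"
      have "first_hit m y = first_hit m x"
      proof (rule first_hit_eqI)
        show "fst (y (first_hit m x)) = m" using first_hit_fst[OF h] eq[of "first_hit m x"] by simp
        show "fst (y s) \<noteq> m" if "s < first_hit m x" for s
          using first_hit_least[of x s m] eq[of s] that by force
      qed
      moreover have "y t = z t" if "t \<le> n" for t
        using x eq[of t] that by (auto simp: C_def)
      ultimately show "y \<in> C" using x by (simp add: C_def)
    qed
    have "measure (walk_law \<omega> i) (?Z \<inter> B) = measure (walk_law \<omega> i) {x \<in> C. hits m x \<and> after_hit m x \<in> B}"
    proof (rule measure_eq_AE)
      show "AE x in walk_law \<omega> i. (x \<in> ?Z \<inter> B) = (x \<in> {x \<in> C. hits m x \<and> after_hit m x \<in> B})"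
        using ZC transient_env_walk[OF good]
        by eventually_elim (use tail[of _ n] in \<open>auto simp: m_def\<close>)
      show "?Z \<inter> B \<in> sets (walk_law \<omega> i)" using Z B by auto
      show "{x \<in> C. hits m x \<and> after_hit m x \<in> B} \<in> sets (walk_law \<omega> i)" using Csets[OF B] by simp
    qed
    also have "\<dots> = c * measure (walk_law \<omega> i) {x \<in> C. hits m x \<and> after_hit m x \<in> UNIV}"
      using CM[OF B] CM[OF sets.top[of path_space, simplified]] walk.prob_space
      by (simp add: c' sum_distrib_left mult.commute)
    also have "measure (walk_law \<omega> i) {x \<in> C. hits m x \<and> after_hit m x \<in> UNIV} = measure (walk_law \<omega> i) ?Z"
    proof (rule measure_eq_AE)
      show "AE x in walk_law \<omega> i. (x \<in> {x \<in> C. hits m x \<and> after_hit m x \<in> UNIV}) = (x \<in> ?Z)"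
        using ZC by eventually_elim auto
      show "{x \<in> C. hits m x \<and> after_hit m x \<in> UNIV} \<in> sets (walk_law \<omega> i)"
        using Csets[OF sets.top[of path_space, simplified]] by simp
      show "?Z \<in> sets (walk_law \<omega> i)" using Z by simp
    qed
    finally show ?thesis .
  qed
  have c0: "0 \<le> c" using c'[of 0 i] by (metis measure_nonneg)
  have eM: "emeasure (density (walk_law \<omega> i) (indicator B)) D = emeasure (walk_law \<omega> i) (D \<inter> B)"
    if D: "D \<in> sets path_space" for D
  proof -
    have "emeasure (density (walk_law \<omega> i) (indicator B)) D = (\<integral>\<^sup>+x. indicator B x * indicator D x \<partial>walk_law \<omega> i)"
      using B D by (intro emeasure_density) auto
    also have "\<dots> = (\<integral>\<^sup>+x. indicator (D \<inter> B) x \<partial>walk_law \<omega> i)"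
      by (intro nn_integral_cong) (simp add: indicator_inter_arith mult.commute)
    also have "\<dots> = emeasure (walk_law \<omega> i) (D \<inter> B)"
      using B D by (intro nn_integral_indicator) auto
    finally show ?thesis .
  qed
  \<comment> \<open>The identity holds on cylinders, hence for all events; evaluated at
    \<open>B\<close> itself it reads \<open>c = c * c\<close>.\<close>
  have "density (walk_law \<omega> i) (indicator B) = scale_measure (ennreal c) (walk_law \<omega> i)"
  proof (rule path_measure_eqI)
    show "finite_measure (density (walk_law \<omega> i) (indicator B))"
      using eM[OF sets.top[of path_space]] by (intro finite_measureI) (simp add: walk.emeasure_eq_measure)
    show "emeasure (density (walk_law \<omega> i) (indicator B)) {x. \<forall>t\<le>n. x t = z t} =
        emeasure (scale_measure (ennreal c) (walk_law \<omega> i)) {x. \<forall>t\<le>n. x t = z t}" for n z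
      using cyl[of n z] c0 by (simp add: eM cylinder_in_sets walk.emeasure_eq_measure ennreal_mult)
  qed simp_all
  then have "emeasure (walk_law \<omega> i) (B \<inter> B) = ennreal c * emeasure (walk_law \<omega> i) B"
    using eM[OF B] by simp
  then have "c = c * c"
    using c'[of 0 i] c0 by (simp add: walk.emeasure_eq_measure flip: ennreal_mult)
  then have "c \<in> {0, 1}" by auto
  then show ?thesis using that c by blast
qed

end

section \<open>The law of large numbers\<close>

text \<open>All quantifiers are countable, so convergence to a given limit is a measurable
  event.\<close>

lemma LIMSEQ_iff_inverse_Suc:
  fixes X :: "nat \<Rightarrow> real"
  shows "X \<longlonglongrightarrow> l \<longleftrightarrow> (\<forall>k. \<exists>N. \<forall>n\<ge>N. \<bar>X n - l\<bar> < 1 / real (Suc k))"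
proof
  assume X: "X \<longlonglongrightarrow> l"
  show "\<forall>k. \<exists>N. \<forall>n\<ge>N. \<bar>X n - l\<bar> < 1 / real (Suc k)"
  proof
    fix k
    show "\<exists>N. \<forall>n\<ge>N. \<bar>X n - l\<bar> < 1 / real (Suc k)"
      using LIMSEQ_D[OF X, of "1 / real (Suc k)"] by simp
  qed
next
  assume X: "\<forall>k. \<exists>N. \<forall>n\<ge>N. \<bar>X n - l\<bar> < 1 / real (Suc k)"
  show "X \<longlonglongrightarrow> l"
  proof (rule LIMSEQ_I)
    fix e :: real assume "0 < e"
    then obtain k where "inverse (real (Suc k)) < e" using reals_Archimedean by blast
    moreover obtain N where "\<forall>n\<ge>N. \<bar>X n - l\<bar> < 1 / real (Suc k)" using X by blast
    ultimately show "\<exists>N. \<forall>n\<ge>N. norm (X n - l) < e"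
      by (intro exI[of _ N]) (force simp: inverse_eq_divide)
  qed
qed

lemma measurable_LIMSEQ_pred:
  fixes X :: "nat \<Rightarrow> 'a \<Rightarrow> real"
  assumes [measurable]: "\<And>n. X n \<in> borel_measurable M"
  shows "Measurable.pred M (\<lambda>x. (\<lambda>n. X n x) \<longlonglongrightarrow> l)"
  unfolding LIMSEQ_iff_inverse_Suc by measurable

text \<open>Makes unboundedness of the ergodic sums insensitive to restarting the path.\<close>

lemma bdd_above_range_offset:
  fixes s :: "nat \<Rightarrow> real"
  shows "bdd_above (range (\<lambda>n. s (n + m) - s m)) \<longleftrightarrow> bdd_above (range s)"
proof
  assume "bdd_above (range (\<lambda>n. s (n + m) - s m))"
  then obtain K where K: "\<And>n. s (n + m) - s m \<le> K" by (auto simp: bdd_above_def)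
  have "bdd_above (s ` {m..})"
  proof (rule bdd_aboveI2)
    fix k assume "k \<in> {m..}"
    then show "s k \<le> K + s m" using K[of "k - m"] by simp
  qed
  moreover have "bdd_above (s ` {..<m})" by simp
  moreover have "range s = s ` {..<m} \<union> s ` {m..}"
    unfolding image_Un[symmetric] by (rule arg_cong[where f="image s"]) auto
  ultimately show "bdd_above (range s)" by (simp add: bdd_above_Un)
next
  assume "bdd_above (range s)"
  then obtain K where K: "\<And>n. s n \<le> K" by (auto simp: bdd_above_def)
  show "bdd_above (range (\<lambda>n. s (n + m) - s m))"
    using K by (intro bdd_aboveI2[where M="K - s m"]) simp
qed

text \<open>A constant upper bound disappears after division by \<open>n\<close>, which leaves an
  error of at most \<open>1 / (k + 1)\<close> on either side.\<close>

lemma LIMSEQ_of_linear_bounds: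
  fixes T :: "nat \<Rightarrow> real"
  assumes up: "\<And>k. bdd_above (range (\<lambda>n. T n - real n * c - real n / real (Suc k)))"
    and down: "\<And>k. bdd_above (range (\<lambda>n. real n * c - T n - real n / real (Suc k)))"
  shows "(\<lambda>n. T n / real n) \<longlonglongrightarrow> c"
proof (rule LIMSEQ_I)
  fix e :: real assume "0 < e"
  then obtain k where k: "inverse (real (Suc k)) < e / 2" using reals_Archimedean[of "e / 2"] by auto
  obtain K L where K: "\<And>n. T n - real n * c - real n / real (Suc k) \<le> K"
    and L: "\<And>n. real n * c - T n - real n / real (Suc k) \<le> L"
    using up[of k] down[of k] by (auto simp: bdd_above_def)
  obtain N where N: "max K L / (e / 2) < real N" using reals_Archimedean2 by blast
  show "\<exists>N. \<forall>n\<ge>N. norm (T n / real n - c) < e"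
  proof (intro exI[of _ "Suc N"] allI impI)
    fix n assume n: "Suc N \<le> n"
    have "max K L < real N * (e / 2)" using N \<open>0 < e\<close> by (simp add: field_simps)
    also have "\<dots> \<le> real n * (e / 2)" using n \<open>0 < e\<close> by (intro mult_right_mono) auto
    finally have "K < real n * (e / 2)" "L < real n * (e / 2)" by auto
    moreover have "real n / real (Suc k) < real n * (e / 2)"
    proof -
      have "0 < real n" using n by simp
      from mult_strict_left_mono[OF k this] show ?thesis by (simp only: divide_inverse)
    qed
    moreover have "real n * (e / 2) + real n * (e / 2) = real n * e" by simp
    ultimately have "\<bar>T n - real n * c\<bar> < real n * e"
      using K[of n] L[of n] by linarith
    moreover have "T n / real n - c = (T n - real n * c) / real n" using n by (simp add: field_simps)
    ultimately have "norm (T n / real n - c) = \<bar>T n - real n * c\<bar> / real n"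
      by (simp add: abs_divide)
    also have "\<dots> < e"
      using \<open>\<bar>T n - real n * c\<bar> < real n * e\<close> n by (simp add: pos_divide_less_eq mult.commute)
    finally show "norm (T n / real n - c) < e" .
  qed
qed

context strip_walk_hitting
begin

text \<open>
  \<open>Q\<close> is the annealed law of the walk started from the stationary distribution of the exit
  matrices. It is invariant under restarting the path at the first visit to level \<open>1\<close>.
\<close>

lemma hitting_time_LLN:
  "\<exists>c>0. AE \<omega> in P. \<forall>i. AE x in walk_law \<omega> i.
    transient_path x \<and> (\<lambda>n. real (first_hit (int n) x) / real n) \<longlonglongrightarrow> c"
proof -
  have "AE \<omega> in P. stochastic_matrix (exit_matrix \<omega>)"
    using AE_transient_env by eventually_elim (rule exit_matrix_stochastic)
  then obtain \<nu> where \<nu>[measurable]: "\<And>j. (\<lambda>\<omega>. pmf (\<nu> \<omega>) j) \<in> borel_measurable P"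
    and \<nu>_shift: "AE \<omega> in P. \<forall>j. pmf (\<nu> (env_shift 1 \<omega>)) j = (\<Sum>i\<in>UNIV. pmf (\<nu> \<omega>) i * exit_matrix \<omega> $ i $ j)"
    and \<nu>_pos: "AE \<omega> in P. \<forall>j. 0 < pmf (\<nu> \<omega>) j"
    using stationary_distribution[OF measurable_exit_matrix _ AE_exit_matrix_pos] by blast
  define Q where "Q = P \<bind> (\<lambda>\<omega>. quenched_law p q r \<omega> (\<nu> \<omega>))"
  have kern: "(\<lambda>\<omega>. quenched_law p q r \<omega> (\<nu> \<omega>)) \<in> measurable P (subprob_algebra path_space)"
    by (rule measurable_prob_algebraD[OF measurable_quenched_law[OF \<nu>]])
  have sets_Q[simp, measurable_cong]: "sets Q = sets path_space"
    unfolding Q_def by (rule sets_bind) (simp_all add: not_empty)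
  have space_Q[simp]: "space Q = UNIV"
    using sets_eq_imp_space_eq[OF sets_Q] by simp
  interpret Q: prob_space Q
    unfolding Q_def by (rule prob_space_bind[OF _ kern]) (simp add: prob_space_quenched_law)
  have emQ: "emeasure Q B = (\<integral>\<^sup>+\<omega>. ennreal (\<Sum>i\<in>UNIV. pmf (\<nu> \<omega>) i * measure (walk_law \<omega> i) B) \<partial>P)"
    if B: "B \<in> sets path_space" for B
  proof -
    have "emeasure Q B = (\<integral>\<^sup>+\<omega>. emeasure (quenched_law p q r \<omega> (\<nu> \<omega>)) B \<partial>P)"
      unfolding Q_def by (rule emeasure_bind[OF not_empty kern B])
    also have "\<dots> = (\<integral>\<^sup>+\<omega>. ennreal (\<Sum>i\<in>UNIV. pmf (\<nu> \<omega>) i * measure (walk_law \<omega> i) B) \<partial>P)"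
      by (intro nn_integral_cong)
        (simp add: emeasure_quenched_law[OF B] walk.emeasure_eq_measure ennreal_mult flip: sum_ennreal)
    finally show ?thesis .
  qed
  \<comment> \<open>\<open>\<nu>\<close> charges every state, so an event that is null for
    \<open>Q\<close> is null from each starting state in almost every environment.\<close>
  have null_Q: "AE x in Q. \<not> R x \<Longrightarrow> AE \<omega> in P. \<forall>i. AE x in walk_law \<omega> i. \<not> R x"
    if R[measurable]: "Measurable.pred path_space R" for R
  proof -
    assume "AE x in Q. \<not> R x"
    have N: "{x. R x} \<in> sets path_space" using R by (simp add: pred_def)
    have "emeasure Q {x. R x} = 0"
      using \<open>AE x in Q. \<not> R x\<close> N by (simp add: AE_iff_measurable[of "{x. R x}"])
    then have "AE \<omega> in P. ennreal (\<Sum>i\<in>UNIV. pmf (\<nu> \<omega>) i * measure (walk_law \<omega> i) {x. R x}) = 0"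
      using N by (simp add: emQ nn_integral_0_iff_AE)
    then show ?thesis
      using \<nu>_pos
    proof eventually_elim
      case (elim \<omega>)
      have "pmf (\<nu> \<omega>) i * measure (walk_law \<omega> i) {x. R x} \<le> 0" for i
      proof -
        have "pmf (\<nu> \<omega>) i * measure (walk_law \<omega> i) {x. R x} \<le>
            (\<Sum>i\<in>UNIV. pmf (\<nu> \<omega>) i * measure (walk_law \<omega> i) {x. R x})"
          by (intro member_le_sum) auto
        also have "\<dots> \<le> 0" using elim(1) by (simp add: ennreal_eq_0_iff)
        finally show ?thesis .
      qed
      then have "measure (walk_law \<omega> i) {x. R x} = 0" for i
        using elim(2) by (metis measure_le_0_iff mult_le_0_iff not_le)
      then show ?case using N by (simp add: walk.prob_eq_0)
    qed
  qed
  have AE_Q_transient: "AE x in Q. transient_path x"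
  proof -
    have N: "{x :: nat \<Rightarrow> int \<times> 'd. \<not> transient_path x} \<in> sets path_space"
    proof -
      have "{x \<in> space path_space. \<not> transient_path (x :: nat \<Rightarrow> int \<times> 'd)} \<in> sets path_space" by measurable
      then show ?thesis by simp
    qed
    have "AE \<omega> in P. (\<Sum>i\<in>UNIV. pmf (\<nu> \<omega>) i * measure (walk_law \<omega> i) {x. \<not> transient_path x}) = 0"
      using AE_transient_env
    proof eventually_elim
      case (elim \<omega>)
      then have "measure (walk_law \<omega> i) {x. \<not> transient_path x} = 0" for i
        using transient_env_walk[OF elim] N by (simp add: walk.prob_eq_0)
      then show ?case by simp
    qed
    then have "AE \<omega> in P. ennreal (\<Sum>i\<in>UNIV. pmf (\<nu> \<omega>) i * measure (walk_law \<omega> i) {x. \<not> transient_path x}) = 0"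
      by eventually_elim simp
    then have "emeasure Q {x. \<not> transient_path x} = 0"
      unfolding emQ[OF N] by (subst nn_integral_cong_AE[where v="\<lambda>_. 0"]) simp_all
    then show ?thesis using N by (simp add: AE_iff_measurable[of "{x. \<not> transient_path x}"])
  qed
  have T[measurable]: "after_hit 1 \<in> measurable Q Q"
    unfolding measurable_cong_sets[OF sets_Q sets_Q] by measurable
  \<comment> \<open>\<open>exit_matrix_harmonic\<close> passes to the shifted environment,
    \<open>\<nu>_shift\<close> recognises the new weights as the stationary ones there, and
    stationarity of \<open>P\<close> removes the shift.\<close>
  have inv: "distr Q Q (after_hit 1) = Q"
  proof (rule measure_eqI)
    fix B assume "B \<in> sets (distr Q Q (after_hit 1))"
    then have B[measurable]: "B \<in> sets path_space" by simp
    have TB: "{x. after_hit 1 x \<in> B} \<in> sets path_space"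
      using measurable_sets[OF measurable_after_hit B, of 1] by (simp add: vimage_def)
    define \<phi> where "\<phi> \<omega> = ennreal (\<Sum>i\<in>UNIV. pmf (\<nu> \<omega>) i * measure (walk_law \<omega> i) B)" for \<omega>
    have \<phi>[measurable]: "\<phi> \<in> borel_measurable P" unfolding \<phi>_def by measurable
    have "emeasure (distr Q Q (after_hit 1)) B = emeasure Q {x. after_hit 1 x \<in> B}"
      by (subst emeasure_distr) (simp_all add: T vimage_def)
    also have "\<dots> = (\<integral>\<^sup>+\<omega>. \<phi> (env_shift 1 \<omega>) \<partial>P)"
      unfolding emQ[OF TB]
    proof (rule nn_integral_cong_AE)
      show "AE \<omega> in P. ennreal (\<Sum>i\<in>UNIV. pmf (\<nu> \<omega>) i * measure (walk_law \<omega> i) {x. after_hit 1 x \<in> B}) =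
          \<phi> (env_shift 1 \<omega>)"
        using AE_transient_env \<nu>_shift
      proof eventually_elim
        case (elim \<omega>)
        let ?m = "\<lambda>j. measure (walk_law (env_shift 1 \<omega>) j) B"
        have "(\<Sum>i\<in>UNIV. pmf (\<nu> \<omega>) i * measure (walk_law \<omega> i) {x. after_hit 1 x \<in> B}) =
            (\<Sum>i\<in>UNIV. \<Sum>j\<in>UNIV. pmf (\<nu> \<omega>) i * exit_matrix \<omega> $ i $ j * ?m j)"
          by (simp add: exit_matrix_harmonic[OF elim(1) B] sum_distrib_left mult.assoc)
        also have "\<dots> = (\<Sum>j\<in>UNIV. pmf (\<nu> (env_shift 1 \<omega>)) j * ?m j)"
          using elim(2) by (subst sum.swap) (simp add: sum_distrib_right)
        finally show ?case by (simp add: \<phi>_def)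
      qed
    qed
    also have "\<dots> = (\<integral>\<^sup>+\<omega>. \<phi> \<omega> \<partial>P)" by (rule nn_integral_env_shift[OF \<phi>])
    finally show "emeasure (distr Q Q (after_hit 1)) B = emeasure Q B"
      by (simp add: emQ[OF B] \<phi>_def)
  qed simp
  let ?\<tau> = "\<lambda>x :: nat \<Rightarrow> int \<times> 'd. real (first_hit 1 x)"
  have \<tau>_int: "integrable Q ?\<tau>"
  proof (rule integrableI_nonneg)
    \<comment> \<open>Weights at most \<open>1\<close> are replaced by \<open>1\<close>, which
      leaves the finitely many tails controlled by \<open>mean_hit\<close>.\<close>
    have tail_le: "emeasure Q {x \<in> space Q. t < first_hit 1 x} \<le> (\<Sum>i\<in>UNIV. \<integral>\<^sup>+\<omega>. ennreal (avoid_prob \<omega> 1 i t) \<partial>P)" for t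
    proof -
      have D: "{x :: nat \<Rightarrow> int \<times> 'd. t < first_hit 1 x} \<in> sets path_space"
      proof -
        have "{x \<in> space path_space. t < first_hit 1 (x :: nat \<Rightarrow> int \<times> 'd)} \<in> sets path_space" by measurable
        then show ?thesis by simp
      qed
      have le: "measure (walk_law \<omega> i) {x. t < first_hit 1 x} \<le> avoid_prob \<omega> 1 i t" for \<omega> i
        unfolding avoid_prob_def
      proof (rule walk.finite_measure_mono)
        show "{x :: nat \<Rightarrow> int \<times> 'd. t < first_hit 1 x} \<subseteq> {x. \<forall>s\<le>t. fst (x s) \<noteq> 1}"
        proof clarify
          fix x :: "nat \<Rightarrow> int \<times> 'd" and s
          assume "t < first_hit 1 x" "s \<le> t" "fst (x s) = 1"
          then show False using first_hit_least[of x s 1] by simp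
        qed
      qed simp
      have "emeasure Q {x \<in> space Q. t < first_hit 1 x} =
          (\<integral>\<^sup>+\<omega>. ennreal (\<Sum>i\<in>UNIV. pmf (\<nu> \<omega>) i * measure (walk_law \<omega> i) {x. t < first_hit 1 x}) \<partial>P)"
        using emQ[OF D] by simp
      also have "\<dots> \<le> (\<integral>\<^sup>+\<omega>. (\<Sum>i\<in>UNIV. ennreal (avoid_prob \<omega> 1 i t)) \<partial>P)"
      proof (rule nn_integral_mono)
        fix \<omega>
        have "(\<Sum>i\<in>UNIV. pmf (\<nu> \<omega>) i * measure (walk_law \<omega> i) {x. t < first_hit 1 x}) \<le>
            (\<Sum>i\<in>UNIV. 1 * avoid_prob \<omega> 1 i t)"
          using le by (intro sum_mono mult_mono) (auto simp: pmf_le_1)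
        then show "ennreal (\<Sum>i\<in>UNIV. pmf (\<nu> \<omega>) i * measure (walk_law \<omega> i) {x. t < first_hit 1 x}) \<le>
            (\<Sum>i\<in>UNIV. ennreal (avoid_prob \<omega> 1 i t))"
          by (subst sum_ennreal) (auto simp: avoid_prob_def intro: ennreal_leI)
      qed
      also have "\<dots> = (\<Sum>i\<in>UNIV. \<integral>\<^sup>+\<omega>. ennreal (avoid_prob \<omega> 1 i t) \<partial>P)"
        by (rule nn_integral_sum) measurable
      finally show ?thesis .
    qed
    have "(\<integral>\<^sup>+x. ennreal (?\<tau> x) \<partial>Q) = (\<Sum>t. emeasure Q {x \<in> space Q. t < first_hit 1 x})"
      by (subst nn_integral_nat_function[symmetric]) (measurable, simp add: ennreal_of_nat_eq_real_of_nat)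
    also have "\<dots> \<le> (\<Sum>t. \<Sum>i\<in>UNIV. \<integral>\<^sup>+\<omega>. ennreal (avoid_prob \<omega> 1 i t) \<partial>P)"
      by (intro suminf_le tail_le) auto
    also have "\<dots> = (\<Sum>i\<in>UNIV. \<integral>\<^sup>+\<omega>. (\<Sum>t. ennreal (avoid_prob \<omega> 1 i t)) \<partial>P)"
      by (subst suminf_sum) (auto simp: nn_integral_suminf)
    also have "\<dots> < \<infinity>"
      using mean_hit by (simp add: less_top)
    finally show "(\<integral>\<^sup>+x. ennreal (?\<tau> x) \<partial>Q) < \<infinity>" .
  qed auto
  define c where "c = (\<integral>x. ?\<tau> x \<partial>Q)"
  \<comment> \<open>One level takes at least one step. Positivity of \<open>c\<close> is what allows
    the inversion to a speed.\<close>
  have "1 \<le> c"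
  proof -
    have "(\<integral>x. 1 \<partial>Q) \<le> c"
      unfolding c_def
    proof (rule integral_mono_AE)
      show "AE x in Q. 1 \<le> ?\<tau> x"
        using AE_Q_transient
      proof eventually_elim
        case (elim x)
        then have "hits 1 x" "skip_free x" unfolding transient_path_def by (metis of_nat_1)+
        then show ?case using first_hit_ge[of x 1] by linarith
      qed
    qed (use \<tau>_int in auto)
    then show ?thesis using Q.prob_space by simp
  qed
  \<comment> \<open>The summand has mean \<open>- \<delta>\<close>, so the one-sided theorem
    applies; \<open>\<sigma> = 1\<close> and \<open>\<sigma> = - 1\<close> give the upper and the
    lower bound.\<close>
  have bounded: "AE x in Q. bdd_above (range (\<lambda>n. \<Sum>k<n. \<sigma> * (?\<tau> ((after_hit 1 ^^ k) x) - c) - \<delta>))"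
    if \<delta>: "0 < \<delta>" for \<sigma> \<delta> :: real
  proof -
    define g where "g x = \<sigma> * (?\<tau> x - c) - \<delta>" for x
    define S where "S n x = (\<Sum>k<n. g ((after_hit 1 ^^ k) x))" for n x
    define B where "B = {x \<in> space Q. \<not> bdd_above (range (\<lambda>n. S n x))}"
    have g_int: "integrable Q g" unfolding g_def using \<tau>_int by auto
    have "(\<integral>x. g x \<partial>Q) = - \<delta>"
      unfolding g_def using \<tau>_int Q.prob_space by (simp add: c_def)
    moreover have "Q.prob B \<in> {0, 1}"
    proof -
      have [measurable]: "g \<in> borel_measurable Q" using g_int by auto
      have "B \<in> sets Q" unfolding B_def S_def bdd_above_range_nat by measurable
      then have B: "B \<in> sets path_space" by simp
      \<comment> \<open>After \<open>m\<close> restarts the sums have lost their first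
        \<open>m\<close> terms, which does not affect unboundedness.\<close>
      have tail: "after_hit (int m) x \<in> B \<longleftrightarrow> x \<in> B" if "transient_path x" for x m
      proof -
        have "S n (after_hit (int m) x) = S (n + m) x - S m x" for n
        proof -
          have "S (n + m) x = S m x + (\<Sum>k<n. g ((after_hit 1 ^^ (m + k)) x))"
            unfolding S_def by (induction n) (simp_all add: add.commute)
          also have "(\<Sum>k<n. g ((after_hit 1 ^^ (m + k)) x)) = S n ((after_hit 1 ^^ m) x)"
            unfolding S_def by (intro sum.cong refl) (simp add: add.commute[of m] funpow_add)
          finally show ?thesis by (simp add: after_hit_iterate[OF that])
        qed
        then show ?thesis using bdd_above_range_offset[of "\<lambda>n. S n x" m] by (simp add: B_def)
      qed
      obtain b where b: "b \<in> {0, 1}" "AE \<omega> in P. \<forall>i. measure (walk_law \<omega> i) B = b"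
        using tail_zero_one[OF B tail] by blast
      have "emeasure Q B = (\<integral>\<^sup>+\<omega>. ennreal b \<partial>P)"
        unfolding emQ[OF B]
      proof (rule nn_integral_cong_AE)
        show "AE \<omega> in P. ennreal (\<Sum>i\<in>UNIV. pmf (\<nu> \<omega>) i * measure (walk_law \<omega> i) B) = ennreal b"
          using b(2)
        proof eventually_elim
          case (elim \<omega>)
          have "(\<Sum>i\<in>UNIV. pmf (\<nu> \<omega>) i * measure (walk_law \<omega> i) B) = (\<Sum>i\<in>UNIV. pmf (\<nu> \<omega>) i) * b"
            using elim by (simp add: sum_distrib_right)
          also have "(\<Sum>i\<in>UNIV. pmf (\<nu> \<omega>) i) = 1" by (rule sum_pmf_eq_1) auto
          finally show ?case by simp
        qed
      qed
      then have "emeasure Q B = ennreal b" by (simp add: emeasure_space_1)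
      then show ?thesis using b(1) by (auto simp: measure_def)
    qed
    ultimately have "AE x in Q. bdd_above (range (\<lambda>n. \<Sum>k<n. g ((after_hit 1 ^^ k) x)))"
      using \<delta> by (intro Q.ergodic_sums_bounded[OF T inv g_int]) (simp_all add: B_def S_def)
    then show ?thesis by (simp add: g_def)
  qed
  have "AE x in Q. \<forall>k. bdd_above (range (\<lambda>n. \<Sum>j<n. 1 * (?\<tau> ((after_hit 1 ^^ j) x) - c) - 1 / real (Suc k)))"
    "AE x in Q. \<forall>k. bdd_above (range (\<lambda>n. \<Sum>j<n. - 1 * (?\<tau> ((after_hit 1 ^^ j) x) - c) - 1 / real (Suc k)))"
    unfolding AE_all_countable by (intro allI bounded, simp)+
  then have LQ: "AE x in Q. transient_path x \<and> (\<lambda>n. real (first_hit (int n) x) / real n) \<longlonglongrightarrow> c"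
    using AE_Q_transient
  proof eventually_elim
    case (elim x)
    have s: "(\<Sum>j<n. ?\<tau> ((after_hit 1 ^^ j) x)) = real (first_hit (int n) x)" for n
      by (simp add: sum_first_hit[OF elim(3)] flip: of_nat_sum)
    have "(\<Sum>j<n. 1 * (?\<tau> ((after_hit 1 ^^ j) x) - c) - 1 / real (Suc k)) =
        real (first_hit (int n) x) - real n * c - real n / real (Suc k)" for n k
      by (simp add: sum_subtractf s)
    moreover have "(\<Sum>j<n. - 1 * (?\<tau> ((after_hit 1 ^^ j) x) - c) - 1 / real (Suc k)) =
        real n * c - real (first_hit (int n) x) - real n / real (Suc k)" for n k
      by (simp add: sum_subtractf s)
    ultimately have "(\<lambda>n. real (first_hit (int n) x) / real n) \<longlonglongrightarrow> c"
      using elim(1,2) by (intro LIMSEQ_of_linear_bounds) (simp_all only:)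
    then show ?case using elim(3) by simp
  qed
  \<comment> \<open>Doubly negated to fit \<open>null_Q\<close>, which is stated for an exceptional
    event \<open>R\<close>.\<close>
  have "AE \<omega> in P. \<forall>i. AE x in walk_law \<omega> i.
      \<not> \<not> (transient_path x \<and> (\<lambda>n. real (first_hit (int n) x) / real n) \<longlonglongrightarrow> c)"
  proof (rule null_Q)
    have [measurable]: "Measurable.pred path_space (\<lambda>x :: nat \<Rightarrow> int \<times> 'd. (\<lambda>n. real (first_hit (int n) x) / real n) \<longlonglongrightarrow> c)"
      by (rule measurable_LIMSEQ_pred) measurable
    show "Measurable.pred path_space (\<lambda>x :: nat \<Rightarrow> int \<times> 'd.
        \<not> (transient_path x \<and> (\<lambda>n. real (first_hit (int n) x) / real n) \<longlonglongrightarrow> c))"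
      by measurable
  qed (use LQ in simp)
  then show ?thesis using \<open>1 \<le> c\<close> by (intro exI[of _ c]) simp
qed

text \<open>The limit holds from each of the finitely many starting states, and every quenched law
  is a mixture of the laws from these states.\<close>

theorem annealed_speed:
  "\<exists>v>0. \<forall>\<mu>\<in>initial_laws S. AE (\<omega>, x) in annealed_law P p q r \<mu>.
    (\<lambda>n. real_of_int (fst (x n)) / real n) \<longlonglongrightarrow> v"
proof -
  obtain c where c: "0 < c" and LLN: "AE \<omega> in P. \<forall>i. AE x in walk_law \<omega> i.
      transient_path x \<and> (\<lambda>n. real (first_hit (int n) x) / real n) \<longlonglongrightarrow> c"
    using hitting_time_LLN by blast
  let ?L = "\<lambda>x :: nat \<Rightarrow> int \<times> 'd. (\<lambda>n. real_of_int (fst (x n)) / real n) \<longlonglongrightarrow> 1 / c"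
  have [measurable]: "Measurable.pred path_space ?L"
  proof (rule measurable_LIMSEQ_pred)
    fix n
    show "(\<lambda>x :: nat \<Rightarrow> int \<times> 'd. real_of_int (fst (x n)) / real n) \<in> borel_measurable path_space"
      by (rule measurable_compose[OF measurable_coordinate]) simp
  qed
  have N: "{x. \<not> ?L x} \<in> sets path_space"
  proof -
    have "{x \<in> space path_space. \<not> ?L x} \<in> sets path_space" by measurable
    then show ?thesis by simp
  qed
  have "AE (\<omega>, x) in annealed_law P p q r \<mu>. ?L x" if \<mu>: "\<mu> \<in> initial_laws S" for \<mu>
  proof -
    have "(\<lambda>\<omega>. quenched_law p q r \<omega> (\<mu> \<omega>)) \<in> measurable P (subprob_algebra path_space)"
      using \<mu> by (intro measurable_prob_algebraD[OF measurable_quenched_law])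
        (simp add: initial_laws_def measurable_cong_sets[OF sets_P refl])
    then have kern: "(\<lambda>\<omega>. distr (quenched_law p q r \<omega> (\<mu> \<omega>)) (P \<Otimes>\<^sub>M path_space) (Pair \<omega>))
        \<in> measurable P (subprob_algebra (P \<Otimes>\<^sub>M path_space))"
      by (rule measurable_distr2[rotated]) simp
    have pair: "Pair \<omega> \<in> measurable (quenched_law p q r \<omega> (\<mu> \<omega>)) (P \<Otimes>\<^sub>M path_space)" if "\<omega> \<in> space P" for \<omega>
      unfolding measurable_cong_sets[OF sets_quenched_law refl] using that by simp
    have pred: "Measurable.pred (P \<Otimes>\<^sub>M path_space) (\<lambda>(\<omega>, x). ?L x)"
      by measurable
    have "AE \<omega> in P. AE z in distr (quenched_law p q r \<omega> (\<mu> \<omega>)) (P \<Otimes>\<^sub>M path_space) (Pair \<omega>). case z of (\<omega>, x) \<Rightarrow> ?L x"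
      using LLN AE_space[of P]
    proof eventually_elim
      case (elim \<omega>)
      have "emeasure (walk_law \<omega> i) {x. \<not> ?L x} = 0" for i
      proof -
        have "AE x in walk_law \<omega> i. ?L x"
          using elim(1)[rule_format, of i] by eventually_elim (use c speed_from_hitting_times in blast)
        then show ?thesis using N by (simp add: AE_iff_measurable[of "{x. \<not> ?L x}"])
      qed
      then have "emeasure (quenched_law p q r \<omega> (\<mu> \<omega>)) {x. \<not> ?L x} = 0"
        by (simp add: emeasure_quenched_law[OF N])
      then have "AE x in quenched_law p q r \<omega> (\<mu> \<omega>). ?L x"
        using N by (simp add: AE_iff_measurable[of "{x. \<not> ?L x}"])
      then show ?case
        using pair[OF elim(2)] pred by (subst AE_distr_iff) (auto simp: pred_def)
    qed
    then show ?thesis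
      unfolding annealed_law_def by (subst AE_bind[OF kern pred])
  qed
  then show ?thesis using c by (intro exI[of _ "1 / c"]) simp
qed

end

theorem corollary2p2:
  fixes S :: "'s measure"
    and P :: "(int \<Rightarrow> 's) measure"
    and p q r :: "'s \<Rightarrow> real^'d::finite^'d"
    and \<zeta> :: "int \<Rightarrow> (int \<Rightarrow> 's) \<Rightarrow> real^'d^'d"
  assumes "prob_space P" and "sets P = sets (env_space S)"
    and "p \<in> borel_measurable S" and "q \<in> borel_measurable S" and "r \<in> borel_measurable S"
    and "\<And>s. s \<in> space S \<Longrightarrow> nonneg_matrix (p s) \<and> nonneg_matrix (q s) \<and> nonneg_matrix (r s)"
    and "\<And>s. s \<in> space S \<Longrightarrow> stochastic_matrix (p s + q s + r s)"
    and zeta: "stationary_solution P p q r \<zeta>"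
    and i: "condition_C P p q r"
    and ii: "\<exists>\<epsilon>>0. AE \<omega> in P. \<forall>i n. (\<Sum>j\<in>UNIV. p (\<omega> n) $ i $ j) > \<epsilon>"
    and iii: "limsup (\<lambda>n. ereal (1 / real n) *
                extended_ln (\<integral>\<^sup>+\<omega>. ennreal (max_opnorm (a_prod q r \<zeta> n \<omega>)) \<partial>P)) < 0"
  shows "\<exists>v_P::real. v_P > 0 \<and>
          (\<forall>\<mu>\<in>initial_laws S. AE (\<omega>, x) in annealed_law P p q r \<mu>.
            (\<lambda>n. real_of_int (fst (x n)) / real n) \<longlonglongrightarrow> v_P)"
proof -
  obtain \<epsilon> where \<epsilon>: "0 < \<epsilon>" "AE \<omega> in P. \<forall>i n. (\<Sum>j\<in>UNIV. p (\<omega> n) $ i $ j) > \<epsilon>"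
    using ii by blast
  interpret strip_walk_drift P S p q r \<zeta> \<epsilon>
  proof (intro strip_walk_drift.intro strip_walk.intro strip_walk_axioms.intro strip_walk_drift_axioms.intro)
    show "distr P P (env_shift 1) = P" "ergodic_env P"
      using i by (simp_all add: condition_C_def stationary_env_def)
  qed (use assms \<epsilon> in auto)
  \<comment> \<open>The drift part delivers the mean bound, condition C the positivity of the exit
    matrix.\<close>
  interpret strip_walk_hitting P S p q r
    by unfold_locales (use mean_hitting_time_finite i in \<open>auto simp: condition_C_def\<close>)
  show ?thesis using annealed_speed by blast
qed

end
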